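(* Let $\mathfrak A$ be a linear ordering which admits a $T_{\mathrm{bin}}$-free tree-automatic presentation of rank $k\ge1$. Then $\mathrm{FC}(\mathfrak A)<\omega^k$.
   Context: Trees and automata: a $\Sigma$-tree is a map $t:D\to\Sigma$ with $D=\mathrm{dom}(t)$ a finite prefix-closed subset of $\{0,1\}^*$; tree automata are deterministic bottom-up $(Q,\iota,\delta:\Sigma\times Q\times Q\to Q,F)$, missing children getting state $\iota$, accepting iff the root state is in $F$; $L(\mathcal A)$ is the accepted language. The convolution of trees overlays them on the union of their domains with tuple labels, padding with a fresh symbol $\Box$. A tree-automatic presentation of $(A;\le)$ is a pair of automata $\mathcal A,\mathcal A_\le$ with a bijection $\mu:A\to L(\mathcal A)$ such that $\mathcal A_\le$ recognises $\{\otimes(\mu(a),\mu(b)):a\le b\}$. Binary trees: prefix-closed $T\subseteq\{0,1\}^*$. $T_{\mathrm{bin}}$-free: $(\{0,1\}^*,\preceq)$ does not embed into $(T,\preceq)$ ($\preceq$ the prefix order). The derivative $d(T)$ is the set of nodes of $T$ lying on at least two distinct infinite branches (infinite prefix-closed $\preceq$-chains) of $T$; $d^{(n)}$ its $n$-fold iterate. For a regular $T_{\mathrm{bin}}$-free tree, $\mathrm{CB}_*(T)$ is the least $n$ with $d^{(n)}(T)$ finite. A presentation is $T_{\mathrm{bin}}$-free if $T(L(\mathcal A))=\bigcup_{t\in L(\mathcal A)}\mathrm{dom}(t)$ is $T_{\mathrm{bin}}$-free, and its rank is $\mathrm{CB}_*(T(L(\mathcal A)))$. $\mathrm{FC}$-rank: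 $\sim_0$ is equality; $x\sim_{\beta+1}y$ iff the closed interval between the $\sim_\beta$-classes of $x,y$ in the quotient ordering $\mathfrak A/{\sim_\beta}$ is finite; at limits take the union. $\mathrm{FC}(\mathfrak A)$ is the least $\alpha$ with $\sim_\beta=\sim_\alpha$ for all $\beta\ge\alpha$. *)

theory Defs
  imports Main "HOL-Library.Sublist"
begin

text \<open>A Sigma-tree: a partial map from nodes (bool lists; False = 0, True = 1) to labels,
  whose domain is finite and prefix-closed.\<close>
type_synonym 's stree = "bool list \<Rightarrow> 's option"

definition is_tree :: "'s stree \<Rightarrow> bool" where
  "is_tree t \<longleftrightarrow> finite (dom t) \<and> (\<forall>u\<in>dom t. \<forall>v. prefix v u \<longrightarrow> v \<in> dom t)"

record ('s, 'q) tree_aut =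
  t_init  :: 'q
  t_delta :: "'s \<Rightarrow> 'q \<Rightarrow> 'q \<Rightarrow> 'q"
  t_final :: "'q set"

definition run_state :: "('s, 'q) tree_aut \<Rightarrow> 's stree \<Rightarrow> (bool list \<Rightarrow> 'q) \<Rightarrow> bool list \<Rightarrow> 'q" where
  "run_state M t \<rho> w = (if w \<in> dom t then \<rho> w else t_init M)"

definition is_run :: "('s, 'q) tree_aut \<Rightarrow> 's stree \<Rightarrow> (bool list \<Rightarrow> 'q) \<Rightarrow> bool" where
  "is_run M t \<rho> \<longleftrightarrow> (\<forall>w\<in>dom t. \<rho> w = t_delta M (the (t w))
       (run_state M t \<rho> (w @ [False])) (run_state M t \<rho> (w @ [True])))"

definition accepts :: "('s, 'q) tree_aut \<Rightarrow> 's stree \<Rightarrow> bool" where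
  "accepts M t \<longleftrightarrow> (\<exists>\<rho>. is_run M t \<rho> \<and> run_state M t \<rho> [] \<in> t_final M)"

definition lang :: "('s, 'q) tree_aut \<Rightarrow> 's stree set" where
  "lang M = {t. is_tree t \<and> accepts M t}"

text \<open>Convolution of two trees; the padding symbol Box is None.\<close>
definition conv :: "'s stree \<Rightarrow> 's stree \<Rightarrow> ('s option \<times> 's option) stree" where
  "conv t1 t2 = (\<lambda>w. if w \<in> dom t1 \<union> dom t2 then Some (t1 w, t2 w) else None)"

definition tree_aut_pres ::
  "('s::finite, 'q::finite) tree_aut \<Rightarrow> ('s option \<times> 's option, 'p::finite) tree_aut \<Rightarrow> ('a::linorder \<Rightarrow> 's stree) \<Rightarrow> bool" where
  "tree_aut_pres M Mle \<mu> \<longleftrightarrow> bij_betw \<mu> UNIV (lang M) \<and>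
     lang Mle = {conv (\<mu> a) (\<mu> b) | a b. a \<le> b}"

definition tree_of_lang :: "'s stree set \<Rightarrow> bool list set" where
  "tree_of_lang L = (\<Union>t\<in>L. dom t)"

definition Tbin_free :: "bool list set \<Rightarrow> bool" where
  "Tbin_free T \<longleftrightarrow> \<not> (\<exists>f :: bool list \<Rightarrow> bool list. (\<forall>u. f u \<in> T) \<and> (\<forall>u v. prefix u v \<longleftrightarrow> prefix (f u) (f v)))"

definition is_branch :: "bool list set \<Rightarrow> bool list set \<Rightarrow> bool" where
  "is_branch T B \<longleftrightarrow> B \<subseteq> T \<and> infinite B \<and> (\<forall>u\<in>B. \<forall>v. prefix v u \<longrightarrow> v \<in> B)
     \<and> (\<forall>u\<in>B. \<forall>v\<in>B. prefix u v \<or> prefix v u)"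

definition tree_deriv :: "bool list set \<Rightarrow> bool list set" where
  "tree_deriv T = {w \<in> T. \<exists>B1 B2. is_branch T B1 \<and> is_branch T B2 \<and> B1 \<noteq> B2 \<and> w \<in> B1 \<and> w \<in> B2}"

definition CB_star :: "bool list set \<Rightarrow> nat" where
  "CB_star T = (LEAST n. finite ((tree_deriv ^^ n) T))"

definition cls_le :: "'a::linorder set \<Rightarrow> 'a set \<Rightarrow> bool" where
  "cls_le c d \<longleftrightarrow> (\<exists>u\<in>c. \<exists>v\<in>d. u \<le> v)"

definition fc_step :: "('a::linorder) rel \<Rightarrow> 'a rel" where
  "fc_step R = {(x, y). finite {c \<in> UNIV // R.
       (cls_le (R `` {x}) c \<and> cls_le c (R `` {y})) \<or> (cls_le (R `` {y}) c \<and> cls_le c (R `` {x}))}}"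

text \<open>Ordinals below omega^k are represented by nat lists of length k
  (Cantor normal form coefficients, most significant first), ordered lexicographically.
  fc_sim alpha is the relation sim_alpha.\<close>
definition fc_sim :: "nat list \<Rightarrow> ('a::linorder) rel" where
  "fc_sim = wfrec (lex less_than) (\<lambda>F \<alpha>.
     if (\<forall>i\<in>set \<alpha>. i = 0) then Id
     else if last \<alpha> \<noteq> 0 then fc_step (F (butlast \<alpha> @ [last \<alpha> - 1]))
     else (\<Union>\<beta>\<in>{\<beta>. (\<beta>, \<alpha>) \<in> lex less_than}. F \<beta>))"

definition FC_less_omega_pow :: "'a::linorder itself \<Rightarrow> nat \<Rightarrow> bool" where
  "FC_less_omega_pow _ k \<longleftrightarrow> (\<exists>\<alpha>. length \<alpha> = k \<and>
     (\<forall>\<beta>. length \<beta> = k \<and> (\<alpha>, \<beta>) \<in> lex less_than \<longrightarrow> (fc_sim \<beta> :: 'a rel) = fc_sim \<alpha>))"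

end

theory Submission
  imports Defs "HOL-Library.Ramsey" "HOL-Library.Countable_Set"
begin

text \<open>
  If every pair of \<open>\<sim>\<^sub>\<beta>\<close>-equivalent points with \<open>\<beta> < \<omega>\<^sup>k\<close> spans an interval of
  \<open>VD\<^sub>*\<close>-rank below one fixed \<open>\<alpha> < \<omega>\<^sup>k\<close>, then the relations \<open>\<sim>\<^sub>\<beta>\<close> stabilise at \<open>\<alpha>\<close>.
  Descending along the trees \<open>x\<close> and \<open>y\<close>, an interval \<open>[x, y]\<close> splits into finitely many boxes,
  whose factors are orders on sets of trees hanging off \<open>dom x \<union> dom y\<close>. Each factor is determined by
  its state tuple and the order context, so there are only finitely many factors up to isomorphism.
  The order on a box depends only on the states reached by pairs of components, and Ramsey's
  theorem shows that its rank is at most the natural sum of the ranks of the factors.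
  All but \<open>N\<close> factors live on trees of smaller rank and have rank below \<open>\<omega>\<^sup>(\<^sup>k\<^sup>-\<^sup>1\<^sup>)\<close> by induction, where
  \<open>N\<close> is the number of infinite branches of \<open>d\<^sup>(\<^sup>k\<^sup>-\<^sup>1\<^sup>)(T)\<close>; the others have rank below
  \<open>\<omega>\<^sup>(\<^sup>k\<^sup>-\<^sup>1\<^sup>) (m + 1)\<close> for an \<open>m\<close> that is uniform by finiteness. So every interval of rank below
  \<open>\<omega>\<^sup>k\<close> has rank below \<open>\<omega>\<^sup>(\<^sup>k\<^sup>-\<^sup>1\<^sup>) (N m + 1)\<close>.
\<close>

section \<open>Ranks of scattered sets\<close>

text \<open>The ordering need not be scattered, so the ranks of its intervals cannot be bounded
  outright. Every bound is conditional: an interval that has some rank below \<omega>^k has one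
  below a fixed smaller ordinal. This is also why m is never computed. It is a maximum over those
  pairs of state tuple and order context that admit a bound at all. The same gap drives the
  induction: an order whose intervals all avoid a range of ranks cannot be built up through that
  range, so a factor of any rank has a small one. The obstacle lies in the boxes. Their order
  extends the product order, and if both coordinates run in the same direction this alone bounds the
  rank. For \<omega> against \<open>\<omega>\<^sup>*\<close> there are infinite antichains, and an
  arbitrary linear extension may contain the rationals. Only the dependence on finitely many states
  excludes this. The product N m arises because natural sums add leading coefficients, while the
  branches through the two children of a node are disjoint, so that each branch is charged to one
  factor.\<close>

abbreviation olt :: "nat list \<Rightarrow> nat list \<Rightarrow> bool" (infix "\<sqsubset>" 50) where
  "\<alpha> \<sqsubset> \<beta> \<equiv> (\<alpha>, \<beta>) \<in> lex less_than"

definition ole :: "nat list \<Rightarrow> nat list \<Rightarrow> bool" (infix "\<sqsubseteq>" 50) where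
  "\<alpha> \<sqsubseteq> \<beta> \<longleftrightarrow> \<alpha> = \<beta> \<or> \<alpha> \<sqsubset> \<beta>"

lemma olt_length: "\<alpha> \<sqsubset> \<beta> \<Longrightarrow> length \<alpha> = length \<beta>"
  by (auto simp: lex_conv)

lemma ole_length: "\<alpha> \<sqsubseteq> \<beta> \<Longrightarrow> length \<alpha> = length \<beta>"
  by (auto simp: ole_def olt_length)

lemma olt_trans: "\<alpha> \<sqsubset> \<beta> \<Longrightarrow> \<beta> \<sqsubset> \<gamma> \<Longrightarrow> \<alpha> \<sqsubset> \<gamma>"
  using lex_transI[OF trans_less_than] by (meson transD)

lemma ole_olt_trans: "\<alpha> \<sqsubseteq> \<beta> \<Longrightarrow> \<beta> \<sqsubset> \<gamma> \<Longrightarrow> \<alpha> \<sqsubset> \<gamma>"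
  by (auto simp: ole_def intro: olt_trans)

lemma olt_ole_trans: "\<alpha> \<sqsubset> \<beta> \<Longrightarrow> \<beta> \<sqsubseteq> \<gamma> \<Longrightarrow> \<alpha> \<sqsubset> \<gamma>"
  by (auto simp: ole_def intro: olt_trans)

lemma ole_refl [simp]: "\<alpha> \<sqsubseteq> \<alpha>"
  by (simp add: ole_def)

lemma olt_imp_ole: "\<alpha> \<sqsubset> \<beta> \<Longrightarrow> \<alpha> \<sqsubseteq> \<beta>"
  by (simp add: ole_def)

lemma olt_total: "length \<alpha> = length \<beta> \<Longrightarrow> \<alpha> \<sqsubset> \<beta> \<or> \<alpha> = \<beta> \<or> \<beta> \<sqsubset> \<alpha>"
proof (induction \<alpha> \<beta> rule: list_induct2)
  case (Cons x xs y ys)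
  then show ?case by (cases x y rule: linorder_cases) auto
qed simp

lemma ole_total: "length \<alpha> = length \<beta> \<Longrightarrow> \<alpha> \<sqsubseteq> \<beta> \<or> \<beta> \<sqsubseteq> \<alpha>"
  using olt_total[of \<alpha> \<beta>] by (auto simp: ole_def)

text \<open>The natural (Hessenberg) sum of two ordinals in Cantor normal form.\<close>
definition nsum :: "nat list \<Rightarrow> nat list \<Rightarrow> nat list" (infixl "\<oplus>" 65) where
  "\<alpha> \<oplus> \<beta> = map2 (+) \<alpha> \<beta>"

lemma nsum_length [simp]: "length (\<alpha> \<oplus> \<beta>) = min (length \<alpha>) (length \<beta>)"
  by (simp add: nsum_def)

lemma nsum_commute: "\<alpha> \<oplus> \<beta> = \<beta> \<oplus> \<alpha>"
  by (rule nth_equalityI) (auto simp: nsum_def)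

text \<open>Strictness in both arguments is what the induction on boxes needs: shrinking either
  factor must shrink the bound. The ordinary ordinal sum is not strictly monotone on the
  left.\<close>

lemma nsum_mono1: "\<alpha>' \<sqsubset> \<alpha> \<Longrightarrow> length \<beta> = length \<alpha> \<Longrightarrow> \<alpha>' \<oplus> \<beta> \<sqsubset> \<alpha> \<oplus> \<beta>"
proof (induction \<alpha> arbitrary: \<alpha>' \<beta>)
  case (Cons a \<alpha>)
  then obtain a' \<alpha>'' b \<beta>' where "\<alpha>' = a' # \<alpha>''" "\<beta> = b # \<beta>'"
    by (metis length_Suc_conv olt_length)
  with Cons show ?case by (auto simp: nsum_def)
qed simp

lemma nsum_mono2: "\<beta>' \<sqsubset> \<beta> \<Longrightarrow> length \<beta> = length \<alpha> \<Longrightarrow> \<alpha> \<oplus> \<beta>' \<sqsubset> \<alpha> \<oplus> \<beta>"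
  using nsum_mono1[of \<beta>' \<beta> \<alpha>] by (simp add: nsum_commute)

lemma ole_nsum: "length \<beta> = length \<alpha> \<Longrightarrow> \<alpha> \<sqsubseteq> \<alpha> \<oplus> \<beta>"
proof (induction \<alpha> arbitrary: \<beta>)
  case (Cons a \<alpha>)
  then obtain b \<beta>' where "\<beta> = b # \<beta>'"
    by (metis length_Suc_conv)
  with Cons show ?case by (auto simp: nsum_def ole_def)
qed (simp add: nsum_def)

lemma hd_nsum: "\<alpha> \<noteq> [] \<Longrightarrow> \<beta> \<noteq> [] \<Longrightarrow> hd (\<alpha> \<oplus> \<beta>) = hd \<alpha> + hd \<beta>"
  by (cases \<alpha>; cases \<beta>) (auto simp: nsum_def)

text \<open>Orders are explicit predicates on sets because a single type of trees will carry many
  orders, one for each set of accepting pair states. Reflexivity is the case x = y of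
  totality.\<close>

definition lin :: "('b \<Rightarrow> 'b \<Rightarrow> bool) \<Rightarrow> 'b set \<Rightarrow> bool" where
  "lin le S \<longleftrightarrow> (\<forall>x\<in>S. \<forall>y\<in>S. le x y \<or> le y x) \<and> (\<forall>x\<in>S. \<forall>y\<in>S. le x y \<and> le y x \<longrightarrow> x = y)
     \<and> (\<forall>x\<in>S. \<forall>y\<in>S. \<forall>z\<in>S. le x y \<and> le y z \<longrightarrow> le x z)"

lemma lin_subset: "lin le S \<Longrightarrow> S' \<subseteq> S \<Longrightarrow> lin le S'"
  unfolding lin_def by blast

lemma lin_refl: "lin le S \<Longrightarrow> x \<in> S \<Longrightarrow> le x x"
  unfolding lin_def by blast

lemma lin_total: "lin le S \<Longrightarrow> x \<in> S \<Longrightarrow> y \<in> S \<Longrightarrow> le x y \<or> le y x"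
  unfolding lin_def by blast

lemma lin_trans: "lin le S \<Longrightarrow> le x y \<Longrightarrow> le y z \<Longrightarrow> x \<in> S \<Longrightarrow> y \<in> S \<Longrightarrow> z \<in> S \<Longrightarrow> le x z"
  unfolding lin_def by blast

lemma lin_antisym: "lin le S \<Longrightarrow> le x y \<Longrightarrow> le y x \<Longrightarrow> x \<in> S \<Longrightarrow> y \<in> S \<Longrightarrow> x = y"
  unfolding lin_def by blast

lemma lin_dual: "lin le S \<Longrightarrow> lin (\<lambda>x y. le y x) S"
  unfolding lin_def by blast

text \<open>\<open>vd le \<alpha> S\<close> says that the \<open>VD\<^sub>*\<close>-rank of the scattered order \<open>(S, le)\<close> is at most \<open>\<alpha>\<close>:
  \<open>S\<close> is a finite sum of \<open>\<omega>\<close>- and \<open>\<omega>\<^sup>*\<close>-sums of orders of smaller rank.\<close>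
inductive vd :: "('b \<Rightarrow> 'b \<Rightarrow> bool) \<Rightarrow> nat list \<Rightarrow> 'b set \<Rightarrow> bool" for le where
  single: "vd le \<alpha> {x}"
| sum: "vd le \<alpha> S \<Longrightarrow> vd le \<alpha> S' \<Longrightarrow> (\<And>x y. x \<in> S \<Longrightarrow> y \<in> S' \<Longrightarrow> le x y) \<Longrightarrow> vd le \<alpha> (S \<union> S')"
| left: "(\<And>x. x \<in> S \<Longrightarrow> \<exists>\<beta>. \<beta> \<sqsubset> \<alpha> \<and> vd le \<beta> {y\<in>S. le y x}) \<Longrightarrow> vd le \<alpha> S"
| right: "(\<And>x. x \<in> S \<Longrightarrow> \<exists>\<beta>. \<beta> \<sqsubset> \<alpha> \<and> vd le \<beta> {y\<in>S. le x y}) \<Longrightarrow> vd le \<alpha> S"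

lemma vd_empty: "vd le \<alpha> {}"
  by (rule vd.left) simp

lemma vd_subset: "vd le \<alpha> S \<Longrightarrow> S' \<subseteq> S \<Longrightarrow> vd le \<alpha> S'"
proof (induction arbitrary: S' rule: vd.induct)
  case (single \<alpha> x)
  then have "S' = {} \<or> S' = {x}" by blast
  then show ?case using vd_empty vd.single by metis
next
  case (sum \<alpha> S1 S2)
  have "vd le \<alpha> (S' \<inter> S1 \<union> S' \<inter> S2)"
    by (rule vd.sum) (use sum in auto)
  moreover have "S' \<inter> S1 \<union> S' \<inter> S2 = S'" using sum.prems by blast
  ultimately show ?case by simp
next
  case (left S \<alpha>)
  show ?case
  proof (rule vd.left)
    fix x assume x: "x \<in> S'"
    then have "{y\<in>S'. le y x} \<subseteq> {y\<in>S. le y x}" using left.prems by blast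
    then show "\<exists>\<beta>. \<beta> \<sqsubset> \<alpha> \<and> vd le \<beta> {y\<in>S'. le y x}"
      using left.IH[of x] left.prems x by blast
  qed
next
  case (right S \<alpha>)
  show ?case
  proof (rule vd.right)
    fix x assume x: "x \<in> S'"
    then have "{y\<in>S'. le x y} \<subseteq> {y\<in>S. le x y}" using right.prems by blast
    then show "\<exists>\<beta>. \<beta> \<sqsubset> \<alpha> \<and> vd le \<beta> {y\<in>S'. le x y}"
      using right.IH[of x] right.prems x by blast
  qed
qed

lemma vd_mono: "vd le \<alpha> S \<Longrightarrow> \<alpha> \<sqsubseteq> \<alpha>' \<Longrightarrow> vd le \<alpha>' S"
proof (induction arbitrary: \<alpha>' rule: vd.induct)
  case (left S \<alpha>)
  show ?case by (rule vd.left) (use left in \<open>meson olt_ole_trans\<close>)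
next
  case (right S \<alpha>)
  show ?case by (rule vd.right) (use right in \<open>meson olt_ole_trans\<close>)
qed (auto intro: vd.intros)

lemma vd_image:
  "vd le \<alpha> S \<Longrightarrow> (\<And>x y. x \<in> S \<Longrightarrow> y \<in> S \<Longrightarrow> le' (f x) (f y) = le x y) \<Longrightarrow> vd le' \<alpha> (f ` S)"
proof (induction rule: vd.induct)
  case (single \<alpha> x)
  then show ?case by (simp add: vd.single)
next
  case (sum \<alpha> S S')
  show ?case unfolding image_Un
    by (rule vd.sum) (use sum in auto)
next
  case (left S \<alpha>)
  show ?case
  proof (rule vd.left)
    fix x assume "x \<in> f ` S"
    then obtain x0 where x0: "x0 \<in> S" "x = f x0" by blast
    have eq: "{y \<in> f ` S. le' y x} = f ` {y \<in> S. le y x0}"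
      using x0 left.prems by auto
    show "\<exists>\<beta>. \<beta> \<sqsubset> \<alpha> \<and> vd le' \<beta> {y \<in> f ` S. le' y x}"
      unfolding eq using left.IH[OF x0(1)] left.prems by auto
  qed
next
  case (right S \<alpha>)
  show ?case
  proof (rule vd.right)
    fix x assume "x \<in> f ` S"
    then obtain x0 where x0: "x0 \<in> S" "x = f x0" by blast
    have eq: "{y \<in> f ` S. le' x y} = f ` {y \<in> S. le x0 y}"
      using x0 right.prems by auto
    show "\<exists>\<beta>. \<beta> \<sqsubset> \<alpha> \<and> vd le' \<beta> {y \<in> f ` S. le' x y}"
      unfolding eq using right.IH[OF x0(1)] right.prems by auto
  qed
qed

lemma vd_dual: "vd le \<alpha> S \<Longrightarrow> vd (\<lambda>x y. le y x) \<alpha> S"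
proof (induction rule: vd.induct)
  case (sum \<alpha> S S')
  have "vd (\<lambda>x y. le y x) \<alpha> (S' \<union> S)"
    by (rule vd.sum) (use sum in auto)
  then show ?case by (simp add: Un_commute)
next
  case (left S \<alpha>)
  show ?case by (rule vd.right) (use left in blast)
next
  case (right S \<alpha>)
  show ?case by (rule vd.left) (use right in blast)
qed (rule vd.single)

text \<open>\<open>\<sqsubset>\<close> relates only lists of equal length, so ordinals below
  \<omega>^k and below \<omega>^(k+1) live on different lists. A leading zero is the inclusion
  between them.\<close>

lemma vd_Cons0: "vd le \<alpha> S \<Longrightarrow> vd le (0 # \<alpha>) S"
proof (induction rule: vd.induct)
  case (left S \<alpha>)
  show ?case by (rule vd.left) (use left in \<open>force\<close>)
next
  case (right S \<alpha>)
  show ?case by (rule vd.right) (use right in \<open>force\<close>)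
qed (auto intro: vd.intros)

section \<open>Cuts and unions of ranked sets\<close>

lemma vd_cut:
  assumes "lin le S" "p \<in> S" "vd le \<alpha> {y\<in>S. le y p}" "vd le \<alpha> {y\<in>S. le p y}"
  shows "vd le \<alpha> S"
proof -
  have "vd le \<alpha> ({y\<in>S. le y p} \<union> {y\<in>S. le p y})"
    by (rule vd.sum) (use assms lin_trans[OF assms(1)] in auto)
  moreover have "{y\<in>S. le y p} \<union> {y\<in>S. le p y} = S"
    using lin_total[OF assms(1)] assms(2) by blast
  ultimately show ?thesis by simp
qed

lemma vd_cut':
  assumes "lin le S" "p \<in> S" "vd le \<alpha> A" "vd le \<alpha> B"
    "\<And>y. y \<in> S \<Longrightarrow> le y p \<Longrightarrow> y \<in> A" "\<And>y. y \<in> S \<Longrightarrow> le p y \<Longrightarrow> y \<in> B"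
  shows "vd le \<alpha> S"
  using assms vd_cut[OF assms(1,2)] vd_subset[OF assms(3)] vd_subset[OF assms(4)]
  by (metis (no_types, lifting) mem_Collect_eq subsetI)

lemma vd_insert:
  assumes "lin le (insert a S)" "vd le \<alpha> S"
  shows "vd le \<alpha> (insert a S)"
proof -
  have 1: "vd le \<alpha> ({y\<in>S. le y a} \<union> {a})"
    by (rule vd.sum) (use assms vd_subset vd.single in \<open>force+\<close>)
  have 2: "vd le \<alpha> ({a} \<union> {y\<in>S. le a y})"
    by (rule vd.sum) (use assms vd_subset vd.single in \<open>force+\<close>)
  have "{y \<in> insert a S. le y a} \<subseteq> {y\<in>S. le y a} \<union> {a}" "{y \<in> insert a S. le a y} \<subseteq> {a} \<union> {y\<in>S. le a y}"
    by auto
  then show ?thesis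
    using vd_cut[OF assms(1), of a] 1 2 vd_subset by (meson insertI1)
qed

text \<open>The elements of S below some point of S1 go with S1, the remaining ones with S2. As S1
  lies below S2, the two halves form an ordered sum.\<close>

lemma vd_split:
  assumes "lin le (S \<union> S1 \<union> S2)" "vd le \<alpha> (S \<union> S1)" "vd le \<alpha> (S \<union> S2)"
    "\<And>x y. x \<in> S1 \<Longrightarrow> y \<in> S2 \<Longrightarrow> le x y"
  shows "vd le \<alpha> (S \<union> (S1 \<union> S2))"
proof -
  note tr = lin_trans[OF assms(1)] and tot = lin_total[OF assms(1)]
  let ?D = "{y \<in> S. \<exists>s\<in>S1. le y s}"
  have "vd le \<alpha> ((?D \<union> S1) \<union> ((S - ?D) \<union> S2))"
  proof (rule vd.sum)
    show "vd le \<alpha> (?D \<union> S1)" using assms(2) by (rule vd_subset) blast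
    show "vd le \<alpha> ((S - ?D) \<union> S2)" using assms(3) by (rule vd_subset) blast
    fix x y assume x: "x \<in> ?D \<union> S1" and y: "y \<in> (S - ?D) \<union> S2"
    then obtain s where s: "s \<in> S1" "le x s"
      using lin_refl[OF assms(1)] by blast
    have "le s y" using y s assms(4) tot by blast
    then show "le x y" using tr[OF s(2)] s(1) x y by blast
  qed
  moreover have "(?D \<union> S1) \<union> ((S - ?D) \<union> S2) = S \<union> (S1 \<union> S2)" by blast
  ultimately show ?thesis by simp
qed

text \<open>Here S is an \<omega>-sum whose initial segments can already be united with anything;
  the induction is on S'. Against another \<omega>-sum, either a point of one set bounds the other
  set, and the union is cut there, or the sets are cofinal in each other, and an initial segment of
  the union lies in the union of two initial segments. Against an
  \<open>\<omega>\<^sup>*\<close>-sum, either S lies entirely below S', or the union is cut at a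
  point of S above some point of S'. The bound \<gamma> is quantified separately because initial
  segments are united at smaller ordinals.\<close>

lemma vd_union_left_aux:
  assumes l: "\<And>x. x \<in> S \<Longrightarrow> \<exists>\<beta>. \<beta> \<sqsubset> \<alpha> \<and>
      (\<forall>\<gamma> S'. \<beta> \<sqsubseteq> \<gamma> \<longrightarrow> vd le \<gamma> S' \<longrightarrow> lin le ({y\<in>S. le y x} \<union> S') \<longrightarrow> vd le \<gamma> ({y\<in>S. le y x} \<union> S'))"
    and S: "vd le \<alpha> S"
  shows "vd le \<alpha>' S' \<Longrightarrow> \<alpha> \<sqsubseteq> \<gamma> \<Longrightarrow> \<alpha>' \<sqsubseteq> \<gamma> \<Longrightarrow> lin le (S \<union> S') \<Longrightarrow> vd le \<gamma> (S \<union> S')"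
proof (induction arbitrary: \<gamma> rule: vd.induct)
  case (single \<alpha>' x)
  then show ?case using vd_insert vd_mono[OF S] by fastforce
next
  case (sum \<alpha>' S1 S2)
  show ?case
    by (rule vd_split)
      (use sum in \<open>auto intro: lin_subset simp: Un_assoc\<close>, (metis lin_subset Un_upper1 Un_upper2 Un_mono sup.idem sup_assoc sup_commute)+)
next
  case (left S' \<alpha>')
  note lin = \<open>lin le (S \<union> S')\<close>
  note tr = lin_trans[OF lin] and tot = lin_total[OF lin]
  have S': "vd le \<gamma> S'"
    by (rule vd_mono[OF _ left.prems(2)], rule vd.left) (use left.IH in blast)
  consider (1) x where "x \<in> S'" "\<And>s. s \<in> S \<Longrightarrow> le s x"
    | (2) x where "x \<in> S" "\<And>s. s \<in> S' \<Longrightarrow> le s x"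
    | (3) "\<forall>x\<in>S'. \<exists>s\<in>S. \<not> le s x" "\<forall>x\<in>S. \<exists>s\<in>S'. \<not> le s x"
    by blast
  then show ?case
  proof cases
    case 1
    from left.IH[OF 1(1)] obtain \<beta> where b: "\<beta> \<sqsubset> \<alpha>'" and
      c: "\<And>\<gamma>. \<alpha> \<sqsubseteq> \<gamma> \<Longrightarrow> \<beta> \<sqsubseteq> \<gamma> \<Longrightarrow> lin le (S \<union> {y\<in>S'. le y x}) \<Longrightarrow> vd le \<gamma> (S \<union> {y\<in>S'. le y x})"
      by blast
    have "vd le \<gamma> (S \<union> {y\<in>S'. le y x})"
      by (rule c) (use left.prems b in \<open>auto intro: olt_imp_ole olt_ole_trans intro!: lin_subset[OF lin]\<close>)
    from vd_cut'[OF lin _ this S', of x] show ?thesis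
      using 1 lin_antisym[OF lin] by blast
  next
    case 2
    from l[OF 2(1)] obtain \<beta> where b: "\<beta> \<sqsubset> \<alpha>" and
      c: "\<And>\<gamma> S'. \<beta> \<sqsubseteq> \<gamma> \<Longrightarrow> vd le \<gamma> S' \<Longrightarrow> lin le ({y\<in>S. le y x} \<union> S') \<Longrightarrow> vd le \<gamma> ({y\<in>S. le y x} \<union> S')"
      by blast
    have "vd le \<gamma> ({y\<in>S. le y x} \<union> S')"
      by (rule c) (use left.prems b S' in \<open>auto intro: olt_imp_ole olt_ole_trans intro!: lin_subset[OF lin]\<close>)
    from vd_cut'[OF lin _ this vd_mono[OF S left.prems(1)], of x] show ?thesis
      using 2 lin_antisym[OF lin] by blast
  next
    case 3
    show ?thesis
    proof (rule vd.left)
      fix x assume x: "x \<in> S \<union> S'"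
      obtain s where s: "s \<in> S" "le x s" using 3(1) x tot lin_refl[OF lin] by blast
      obtain s' where s': "s' \<in> S'" "le x s'" using 3(2) x tot lin_refl[OF lin] by blast
      obtain \<beta> where b: "\<beta> \<sqsubset> \<alpha>" and
        c: "\<And>\<gamma> S'. \<beta> \<sqsubseteq> \<gamma> \<Longrightarrow> vd le \<gamma> S' \<Longrightarrow> lin le ({y\<in>S. le y s} \<union> S') \<Longrightarrow> vd le \<gamma> ({y\<in>S. le y s} \<union> S')"
        using l[OF s(1)] by blast
      obtain \<beta>' where b': "\<beta>' \<sqsubset> \<alpha>'" "vd le \<beta>' {y\<in>S'. le y s'}"
        using left.IH[OF s'(1)] by blast
      have lb: "length \<beta> = length \<beta>'"
        using olt_length b b' left.prems(1,2) ole_length by metis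
      \<comment> \<open>\<delta> is the larger of \<beta> and \<beta>'. Both are below \<gamma>,
        hence so is \<delta>, as the rule \<open>vd.left\<close> demands.\<close>
      obtain \<delta> where d: "\<beta> \<sqsubseteq> \<delta>" "\<beta>' \<sqsubseteq> \<delta>" "\<delta> \<sqsubset> \<gamma>"
        using ole_total[OF lb] b b' left.prems(1,2) by (meson ole_refl olt_ole_trans)
      have "vd le \<delta> ({y\<in>S. le y s} \<union> {y\<in>S'. le y s'})"
        by (rule c) (use d vd_mono[OF b'(2)] in \<open>auto intro!: lin_subset[OF lin]\<close>)
      moreover have "{y \<in> S \<union> S'. le y x} \<subseteq> {y\<in>S. le y s} \<union> {y\<in>S'. le y s'}"
        using tr x s s' by blast
      ultimately show "\<exists>\<beta>. \<beta> \<sqsubset> \<gamma> \<and> vd le \<beta> {y \<in> S \<union> S'. le y x}"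
        using d(3) vd_subset by blast
    qed
  qed
next
  case (right S' \<alpha>')
  note lin = \<open>lin le (S \<union> S')\<close>
  note tr = lin_trans[OF lin] and tot = lin_total[OF lin]
  have S': "vd le \<gamma> S'"
    by (rule vd_mono[OF _ right.prems(2)], rule vd.right) (use right.IH in blast)
  show ?case
  proof (cases "\<exists>s\<in>S. \<exists>s'\<in>S'. le s' s")
    case True
    then obtain s s' where s: "s \<in> S" "s' \<in> S'" "le s' s" by blast
    obtain \<beta> where b: "\<beta> \<sqsubset> \<alpha>" and
      c: "\<And>\<gamma> S'. \<beta> \<sqsubseteq> \<gamma> \<Longrightarrow> vd le \<gamma> S' \<Longrightarrow> lin le ({y\<in>S. le y s} \<union> S') \<Longrightarrow> vd le \<gamma> ({y\<in>S. le y s} \<union> S')"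
      using l[OF s(1)] by blast
    have 1: "vd le \<gamma> ({y\<in>S. le y s} \<union> S')"
      by (rule c) (use right.prems b S' in \<open>auto intro: olt_imp_ole olt_ole_trans intro!: lin_subset[OF lin]\<close>)
    from right.IH[OF s(2)] obtain \<beta>' where b': "\<beta>' \<sqsubset> \<alpha>'" and
      c': "\<And>\<gamma>. \<alpha> \<sqsubseteq> \<gamma> \<Longrightarrow> \<beta>' \<sqsubseteq> \<gamma> \<Longrightarrow> lin le (S \<union> {y\<in>S'. le s' y}) \<Longrightarrow> vd le \<gamma> (S \<union> {y\<in>S'. le s' y})"
      by blast
    have 2: "vd le \<gamma> (S \<union> {y\<in>S'. le s' y})"
      by (rule c') (use right.prems b' in \<open>auto intro: olt_imp_ole olt_ole_trans intro!: lin_subset[OF lin]\<close>)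
    show ?thesis
      by (rule vd_cut'[OF lin _ 1 2, of s]) (use s tr in blast)+
  next
    case False
    then show ?thesis
      by (intro vd.sum[OF vd_mono[OF S right.prems(1)] S']) (use tot in blast)
  qed
qed

lemma vd_union_aux:
  "vd le \<alpha> S \<Longrightarrow> \<forall>\<gamma> S'. \<alpha> \<sqsubseteq> \<gamma> \<longrightarrow> vd le \<gamma> S' \<longrightarrow> lin le (S \<union> S') \<longrightarrow> vd le \<gamma> (S \<union> S')"
proof (induction rule: vd.induct)
  case (single \<alpha> x)
  then show ?case using vd_insert by force
next
  case (sum \<alpha> S1 S2)
  show ?case
  proof (intro allI impI)
    fix \<gamma> S' assume a: "\<alpha> \<sqsubseteq> \<gamma>" "vd le \<gamma> S'" "lin le (S1 \<union> S2 \<union> S')"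
    have "vd le \<gamma> (S1 \<union> S')" "vd le \<gamma> (S2 \<union> S')"
      using sum.IH a lin_subset[OF a(3)] by (meson Un_upper1 Un_upper2 Un_mono order_refl)+
    then have "vd le \<gamma> (S' \<union> (S1 \<union> S2))"
      using vd_split[of le S' S1 S2 \<gamma>] a(3) sum.hyps(3) by (simp add: ac_simps)
    then show "vd le \<gamma> (S1 \<union> S2 \<union> S')" by (simp add: ac_simps)
  qed
next
  case (left S \<alpha>)
  have S: "vd le \<alpha> S" by (rule vd.left) (use left.IH in blast)
  show ?case
    using vd_union_left_aux[OF _ S] left.IH by (metis (no_types, lifting) ole_refl)
next
  case (right S \<alpha>)
  \<comment> \<open>An \<open>\<omega>\<^sup>*\<close>-sum is an \<omega>-sum for the reversed
    order, so this case is the previous one read backwards.\<close>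
  have S: "vd (\<lambda>x y. le y x) \<alpha> S" by (rule vd_dual, rule vd.right) (use right.IH in blast)
  have l: "\<exists>\<beta>. \<beta> \<sqsubset> \<alpha> \<and>
      (\<forall>\<gamma> S'. \<beta> \<sqsubseteq> \<gamma> \<longrightarrow> vd (\<lambda>x y. le y x) \<gamma> S' \<longrightarrow> lin (\<lambda>x y. le y x) ({y\<in>S. le x y} \<union> S')
         \<longrightarrow> vd (\<lambda>x y. le y x) \<gamma> ({y\<in>S. le x y} \<union> S'))" if x: "x \<in> S" for x
    using right.IH[OF x] vd_dual[of le] vd_dual[of "\<lambda>x y. le y x"] lin_dual[of "\<lambda>x y. le y x"] by meson
  show ?case
  proof (intro allI impI)
    fix \<gamma> S' assume a: "\<alpha> \<sqsubseteq> \<gamma>" "vd le \<gamma> S'" "lin le (S \<union> S')"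
    have "vd (\<lambda>x y. le y x) \<gamma> (S \<union> S')"
      using vd_union_left_aux[of S \<alpha> "\<lambda>x y. le y x", OF l S vd_dual[OF a(2)] a(1) ole_refl lin_dual[OF a(3)]] by blast
    then show "vd le \<gamma> (S \<union> S')" using vd_dual by fastforce
  qed
qed

lemma vd_union: "vd le \<alpha> S \<Longrightarrow> vd le \<alpha> S' \<Longrightarrow> lin le (S \<union> S') \<Longrightarrow> vd le \<alpha> (S \<union> S')"
  using vd_union_aux by fastforce

lemma vd_finite: "finite S \<Longrightarrow> lin le S \<Longrightarrow> vd le \<alpha> S"
  by (induction rule: finite_induct) (auto intro: vd_empty vd_insert lin_subset)

subsection \<open>Products\<close>

text \<open>The colours c0 and c1 stand for the states reached by pairs of components. Their finite
  range admits Ramsey's theorem, and countability provides cofinal sequences of type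
  \<omega>.\<close>

definition box :: "('x \<Rightarrow> 'x \<Rightarrow> bool) \<Rightarrow> ('y \<Rightarrow> 'y \<Rightarrow> bool) \<Rightarrow> ('x \<times> 'y \<Rightarrow> 'x \<times> 'y \<Rightarrow> bool)
    \<Rightarrow> ('x \<Rightarrow> 'x \<Rightarrow> 'c::finite) \<Rightarrow> ('y \<Rightarrow> 'y \<Rightarrow> 'd::finite) \<Rightarrow> 'x set \<Rightarrow> 'y set \<Rightarrow> bool" where
  "box le0 le1 le c0 c1 X Y \<longleftrightarrow> lin le0 X \<and> lin le1 Y \<and> lin le (X \<times> Y) \<and> countable X \<and> countable Y
     \<and> (\<forall>x\<in>X. \<forall>x'\<in>X. \<forall>y\<in>Y. \<forall>y'\<in>Y. le0 x x' \<and> le1 y y' \<longrightarrow> le (x, y) (x', y'))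
     \<and> (\<exists>f. \<forall>x\<in>X. \<forall>x'\<in>X. \<forall>y\<in>Y. \<forall>y'\<in>Y. le (x, y) (x', y') \<longleftrightarrow> f (c0 x x') (c1 y y'))"

lemma boxD:
  assumes "box le0 le1 le c0 c1 X Y"
  shows "lin le0 X" "lin le1 Y" "lin le (X \<times> Y)" "countable X" "countable Y"
    "\<And>x x' y y'. x \<in> X \<Longrightarrow> x' \<in> X \<Longrightarrow> y \<in> Y \<Longrightarrow> y' \<in> Y \<Longrightarrow> le0 x x' \<Longrightarrow> le1 y y' \<Longrightarrow> le (x, y) (x', y')"
  using assms by (simp_all add: box_def)

lemma box_colourE:
  assumes "box le0 le1 le c0 c1 X Y"
  obtains f where "\<And>x x' y y'. x \<in> X \<Longrightarrow> x' \<in> X \<Longrightarrow> y \<in> Y \<Longrightarrow> y' \<in> Y \<Longrightarrow>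
      le (x, y) (x', y') \<longleftrightarrow> f (c0 x x') (c1 y y')"
proof -
  have "\<exists>f. \<forall>x\<in>X. \<forall>x'\<in>X. \<forall>y\<in>Y. \<forall>y'\<in>Y. le (x, y) (x', y') \<longleftrightarrow> f (c0 x x') (c1 y y')"
    using assms by (simp add: box_def)
  then show thesis using that by (elim exE) simp
qed

lemma box_subset:
  assumes "box le0 le1 le c0 c1 X Y" "X' \<subseteq> X" "Y' \<subseteq> Y"
  shows "box le0 le1 le c0 c1 X' Y'"
proof -
  obtain f where f: "\<forall>x\<in>X. \<forall>x'\<in>X. \<forall>y\<in>Y. \<forall>y'\<in>Y. le (x, y) (x', y') \<longleftrightarrow> f (c0 x x') (c1 y y')"
    using assms(1) unfolding box_def by blast
  have "lin le0 X" "lin le1 Y" "lin le (X \<times> Y)" "countable X" "countable Y"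
    using assms(1) by (simp_all add: box_def)
  then have "lin le0 X'" "lin le1 Y'" "lin le (X' \<times> Y')" "countable X'" "countable Y'"
    using assms(2,3) by (auto intro: lin_subset[of le "X \<times> Y"] lin_subset[of le0 X] lin_subset[of le1 Y] countable_subset)
  moreover have "\<forall>x\<in>X'. \<forall>x'\<in>X'. \<forall>y\<in>Y'. \<forall>y'\<in>Y'. le0 x x' \<and> le1 y y' \<longrightarrow> le (x, y) (x', y')"
    using assms(1) unfolding box_def using assms(2,3) by (simp add: subset_eq)
  moreover have "\<forall>x\<in>X'. \<forall>x'\<in>X'. \<forall>y\<in>Y'. \<forall>y'\<in>Y'. le (x, y) (x', y') \<longleftrightarrow> f (c0 x x') (c1 y y')"
    using f assms(2,3) by (simp add: subset_eq)
  ultimately show ?thesis unfolding box_def by blast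
qed

lemma box_dual:
  assumes "box le0 le1 le c0 c1 X Y"
  shows "box (\<lambda>x y. le0 y x) (\<lambda>x y. le1 y x) (\<lambda>x y. le y x) (\<lambda>x y. c0 y x) (\<lambda>x y. c1 y x) X Y"
proof -
  obtain f where f: "\<forall>x\<in>X. \<forall>x'\<in>X. \<forall>y\<in>Y. \<forall>y'\<in>Y. le (x, y) (x', y') \<longleftrightarrow> f (c0 x x') (c1 y y')"
    using assms(1) unfolding box_def by blast
  have "\<forall>x\<in>X. \<forall>x'\<in>X. \<forall>y\<in>Y. \<forall>y'\<in>Y. le (x', y') (x, y) \<longleftrightarrow> f (c0 x' x) (c1 y' y)"
    using f by simp
  then show ?thesis using assms unfolding box_def by (simp add: lin_dual) blast
qed

text \<open>The n-th term is chosen above the n-th element of an enumeration of X, which makes the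
  sequence cofinal; the absence of a maximum allows each step to be strict.\<close>

lemma cofinal_sequence:
  assumes "lin le X" "countable X" "X \<noteq> {}" and nomax: "\<forall>x\<in>X. \<exists>y\<in>X. \<not> le y x"
  shows "\<exists>b :: nat \<Rightarrow> 'x. (\<forall>i. b i \<in> X) \<and> (\<forall>i j. i < j \<longrightarrow> le (b i) (b j) \<and> b i \<noteq> b j) \<and> (\<forall>x\<in>X. \<exists>i. le x (b i))"
proof -
  note tr = lin_trans[OF assms(1)] and tot = lin_total[OF assms(1)]
  define e where "e = from_nat_into X"
  have e: "e i \<in> X" for i using assms(3) by (simp add: e_def from_nat_into)
  have step: "\<exists>y\<in>X. le x y \<and> \<not> le y x \<and> le (e n) y" if x: "x \<in> X" for x n
  proof -
    obtain m where m: "m \<in> X" "le x m" "le (e n) m"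
      using tot[OF x e[of n]] lin_refl[OF assms(1)] x e by blast
    obtain y where y: "y \<in> X" "\<not> le y m" using nomax m(1) by blast
    with m x e have "le m y" using tot by blast
    with y m x e show ?thesis using tr by blast
  qed
  obtain b where b: "\<And>n. b n \<in> X \<and> le (e n) (b n)"
    and b': "\<And>n. le (b n) (b (Suc n)) \<and> \<not> le (b (Suc n)) (b n)"
  proof -
    have "\<exists>b. \<forall>n. (b n \<in> X \<and> le (e n) (b n)) \<and> le (b n) (b (Suc n)) \<and> \<not> le (b (Suc n)) (b n)"
    proof (rule dependent_nat_choice)
      show "\<exists>x. x \<in> X \<and> le (e 0) x" using step[OF e] by blast
      show "\<exists>y. (y \<in> X \<and> le (e (Suc n)) y) \<and> le x y \<and> \<not> le y x" if "x \<in> X \<and> le (e n) x" for x n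
        using step[of x "Suc n"] that by blast
    qed
    then show thesis using that by blast
  qed
  have lt: "le (b i) (b j) \<and> \<not> le (b j) (b i)" if "i < j" for i j
    using that
  proof (induction j)
    case (Suc j)
    then consider "i = j" | "i < j" by linarith
    then show ?case
    proof cases
      case 2
      then show ?thesis using Suc.IH b b' tr by blast
    qed (use b' in blast)
  qed simp
  have "\<exists>i. le x (b i)" if "x \<in> X" for x
    using from_nat_into_surj[OF assms(2) that] b unfolding e_def by metis
  moreover have "b i \<noteq> b j" if "i < j" for i j using lt[OF that] by auto
  ultimately show ?thesis using b lt by (intro exI[of _ b]) simp
qed

text \<open>Ramsey's theorem is applied to unordered pairs. Taking \<open>Min\<close> and
  \<open>Max\<close> restores their order, so that c need not be symmetric.\<close>

lemma ramsey_nat: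
  fixes c :: "nat \<Rightarrow> nat \<Rightarrow> 'c::finite"
  shows "\<exists>h :: nat \<Rightarrow> nat. strict_mono h \<and> (\<forall>i j k l. i < j \<longrightarrow> k < l \<longrightarrow> c (h i) (h j) = c (h k) (h l))"
proof -
  obtain g :: "'c \<Rightarrow> nat" and s where g: "bij_betw g UNIV {0..<s}"
    using ex_bij_betw_finite_nat[of "UNIV :: 'c set"] by auto
  define F where "F S = g (c (Min S) (Max S))" for S :: "nat set"
  have F: "\<forall>x\<in>(UNIV::nat set). \<forall>y\<in>UNIV. x \<noteq> y \<longrightarrow> F {x, y} < s"
    unfolding F_def using bij_betw_apply[OF g] by simp
  obtain Y t where "Y \<subseteq> UNIV \<and> infinite Y \<and> t < s \<and> (\<forall>x\<in>Y. \<forall>y\<in>Y. x \<noteq> y \<longrightarrow> F {x, y} = t)"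
    using Ramsey2[OF infinite_UNIV_nat F] by (elim exE)
  then have Y: "infinite Y" "\<And>x y. x \<in> Y \<Longrightarrow> y \<in> Y \<Longrightarrow> x \<noteq> y \<Longrightarrow> F {x, y} = t"
    by simp_all
  let ?h = "enumerate Y"
  have h: "strict_mono ?h" using strict_mono_enumerate[OF Y(1)] .
  have "g (c (?h i) (?h j)) = t" if "i < j" for i j
  proof -
    have lt: "?h i < ?h j" using h that by (simp add: strict_mono_def)
    have "F {?h i, ?h j} = t" using Y(2)[OF _ _ less_imp_neq[OF lt]] Y(1) by (simp add: enumerate_in_set)
    then show ?thesis using lt by (simp add: F_def)
  qed
  then have "c (?h i) (?h j) = inv g t" if "i < j" for i j
    using g that by (metis bij_betw_imp_inj_on inv_f_f)
  then show ?thesis using h by (intro exI[of _ ?h]) simp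
qed

text \<open>An increasing and a decreasing coordinate compete. Ramsey's theorem yields cofinal sequences on which one of them always wins.\<close>
lemma box_left_right:
  assumes box: "box le0 le1 le c0 c1 X Y" and ne: "X \<noteq> {}" "Y \<noteq> {}"
    and nomax: "\<forall>x\<in>X. \<exists>x'\<in>X. \<not> le0 x' x" and nomin: "\<forall>y\<in>Y. \<exists>y'\<in>Y. \<not> le1 y y'"
  shows "(\<exists>y0\<in>Y. \<forall>x\<in>X. \<exists>x'\<in>X. \<forall>u\<in>X. \<forall>v\<in>Y. le (u, v) (x, y0) \<longrightarrow> le0 u x') \<or>
    (\<exists>x0\<in>X. \<forall>y\<in>Y. \<exists>y'\<in>Y. \<forall>u\<in>X. \<forall>v\<in>Y. le (x0, y) (u, v) \<longrightarrow> le1 y' v)"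
proof -
  have lX: "lin le0 X" and lY: "lin le1 Y" and l: "lin le (X \<times> Y)" and cX: "countable X" and cY: "countable Y"
    and mono: "\<And>x x' y y'. x \<in> X \<Longrightarrow> x' \<in> X \<Longrightarrow> y \<in> Y \<Longrightarrow> y' \<in> Y \<Longrightarrow> le0 x x' \<Longrightarrow> le1 y y' \<Longrightarrow> le (x, y) (x', y')"
    using boxD[OF box] by simp_all
  obtain f where f: "\<And>x x' y y'. x \<in> X \<Longrightarrow> x' \<in> X \<Longrightarrow> y \<in> Y \<Longrightarrow> y' \<in> Y \<Longrightarrow>
      le (x, y) (x', y') \<longleftrightarrow> f (c0 x x') (c1 y y')"
    using box_colourE[OF box] by metis
  obtain p where p0: "(\<forall>i::nat. p i \<in> X) \<and> (\<forall>i j. i < j \<longrightarrow> le0 (p i) (p j) \<and> p i \<noteq> p j) \<and> (\<forall>x\<in>X. \<exists>i. le0 x (p i))"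
    using cofinal_sequence[OF lX cX ne(1) nomax] by (elim exE)
  then have p: "\<And>i. p i \<in> X" "\<And>i j. i < j \<Longrightarrow> le0 (p i) (p j)" "\<And>x. x \<in> X \<Longrightarrow> \<exists>i. le0 x (p i)"
      "\<And>i j. i < j \<Longrightarrow> p i \<noteq> p j"
    by simp_all
  obtain q where q0: "(\<forall>i::nat. q i \<in> Y) \<and> (\<forall>i j. i < j \<longrightarrow> le1 (q j) (q i) \<and> q i \<noteq> q j) \<and> (\<forall>y\<in>Y. \<exists>i. le1 (q i) y)"
    using cofinal_sequence[OF lin_dual[OF lY] cY ne(2) nomin] by (elim exE)
  then have q: "\<And>i. q i \<in> Y" "\<And>i j. i < j \<Longrightarrow> le1 (q j) (q i)" "\<And>y. y \<in> Y \<Longrightarrow> \<exists>i. le1 (q i) y"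
    by simp_all
  \<comment> \<open>Both orientations of a pair are coloured, since \<open>le\<close> will be read
    from smaller to larger indices as well as the other way round.\<close>
  define c where "c i j = (c0 (p i) (p j), c1 (q i) (q j), c0 (p j) (p i), c1 (q j) (q i))" for i j
  obtain h :: "nat \<Rightarrow> nat" where ht: "strict_mono h \<and> (\<forall>i j k l. i < j \<longrightarrow> k < l \<longrightarrow> c (h i) (h j) = c (h k) (h l))"
    using ramsey_nat[of c] by (elim exE)
  note h = conjunct1[OF ht] and t = conjunct2[OF ht, rule_format, unfolded c_def]
  define b where "b i = p (h i)" for i
  define d where "d i = q (h i)" for i
  note seq = strict_mono_imp_increasing[OF h]
  have b: "b i \<in> X" and d: "d i \<in> Y" for i by (simp_all add: b_def d_def p q)
  have bm: "le0 (b i) (b j)" if "i < j" for i j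
    using p(2) h that by (simp add: b_def strict_mono_def)
  have dm: "le1 (d j) (d i)" if "i < j" for i j
    using q(2) h that by (simp add: d_def strict_mono_def)
  have bc: "\<exists>n. le0 x (b n)" if x: "x \<in> X" for x
  proof -
    obtain i where "le0 x (p i)" using p(3) x by blast
    moreover have "le0 (p i) (b i)"
      using p(1,2) seq[of i] lin_refl[OF lX] unfolding b_def by (metis le_neq_implies_less)
    ultimately show ?thesis using lin_trans[OF lX] p(1) b x by blast
  qed
  have dc: "\<exists>n\<ge>1. le1 (d n) y" if y: "y \<in> Y" for y
  proof -
    obtain i where "le1 (q i) y" using q(3) y by blast
    moreover have "le1 (d (Suc i)) (q i)"
      using q(2) seq[of "Suc i"] unfolding d_def by simp
    ultimately show ?thesis using lin_trans[OF lY] q(1) d y by (metis le_add1 plus_1_eq_Suc)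
  qed
  have bc': "\<exists>n\<ge>1. le0 x (b n)" if x: "x \<in> X" for x
  proof -
    obtain i where i: "le0 x (b i)" using bc x by blast
    then have "le0 x (b (Suc i))" using lin_trans[OF lX] bm[of i "Suc i"] b x by blast
    then show ?thesis by force
  qed
  \<comment> \<open>Each coordinate is homogeneous on its own, so i < j and k < l may be chosen
    independently. This is what lets one step in one coordinate be weighed against arbitrarily many
    in the other.\<close>
  have col: "le (b i, d k) (b j, d l) = le (b 0, d 0) (b 1, d 1)"
      "le (b j, d l) (b i, d k) = le (b 1, d 1) (b 0, d 0)" if "i < j" "k < l" for i j k l
    using t[OF that(1), of 0 1] t[OF that(2), of 0 1] b d by (simp_all add: f b_def d_def)
  have ne: "(b i, d k) \<noteq> (b j, d l)" if "i < j" for i j k l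
    using p(4) h that by (simp add: b_def strict_mono_def)
  consider "le (b 0, d 0) (b 1, d 1)" | "le (b 1, d 1) (b 0, d 0)"
    using lin_total[OF l] b d by (meson SigmaI)
  then show ?thesis
  proof cases
    \<comment> \<open>The increasing coordinate wins: one step from \<open>b n\<close> to
      \<open>b (Suc n)\<close> outweighs any descent from \<open>d 0\<close> to \<open>d m\<close>
      with m at least 1. Hence whatever lies below (x, \<open>d 0\<close>) has its first component
      below \<open>b (Suc n)\<close>.\<close>
    case 1
    have "\<exists>x'\<in>X. \<forall>u\<in>X. \<forall>v\<in>Y. le (u, v) (x, d 0) \<longrightarrow> le0 u x'" if x: "x \<in> X" for x
    proof -
      obtain n where n: "le0 x (b n)" using bc x by blast
      have "le0 u (b (Suc n))" if uv: "u \<in> X" "v \<in> Y" "le (u, v) (x, d 0)" for u v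
      proof (rule ccontr)
        assume "\<not> le0 u (b (Suc n))"
        then have u: "le0 (b (Suc n)) u" using lin_total[OF lX] uv b by blast
        obtain m where m: "m \<ge> 1" "le1 (d m) v" using dc uv by blast
        have "le (b (Suc n), d m) (u, v)" using mono u m uv b d by blast
        moreover have "le (x, d 0) (b n, d 0)" using mono n x b d lin_refl[OF lY] by blast
        ultimately have "le (b (Suc n), d m) (b n, d 0)"
          using uv x b d lin_trans[OF l] by (meson SigmaI)
        moreover have "le (b n, d 0) (b (Suc n), d m)" using col(1)[of n "Suc n" 0 m] m 1 by simp
        ultimately show False
          using lin_antisym[OF l, of "(b n, d 0)" "(b (Suc n), d m)"] b d ne[of n "Suc n" 0 m] by simp
      qed
      then show ?thesis using b by blast
    qed
    then show ?thesis using d by blast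
  next
    \<comment> \<open>The decreasing coordinate wins: the step from \<open>d n\<close> down to
      \<open>d (Suc n)\<close> outweighs any ascent from \<open>b 0\<close> to \<open>b m\<close>
      with m at least 1. Hence whatever lies above (\<open>b 0\<close>, y) has its second component
      above \<open>d (Suc n)\<close>.\<close>
    case 2
    have "\<exists>y'\<in>Y. \<forall>u\<in>X. \<forall>v\<in>Y. le (b 0, y) (u, v) \<longrightarrow> le1 y' v" if y: "y \<in> Y" for y
    proof -
      obtain n where n: "le1 (d n) y" using dc y by blast
      have "le1 (d (Suc n)) v" if uv: "u \<in> X" "v \<in> Y" "le (b 0, y) (u, v)" for u v
      proof (rule ccontr)
        assume "\<not> le1 (d (Suc n)) v"
        then have v: "le1 v (d (Suc n))" using lin_total[OF lY] uv d by blast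
        obtain m where m: "m \<ge> 1" "le0 u (b m)" using bc' uv by blast
        have "le (u, v) (b m, d (Suc n))" using mono v m uv b d by blast
        moreover have "le (b 0, d n) (b 0, y)" using mono n y b d lin_refl[OF lX] by blast
        ultimately have "le (b 0, d n) (b m, d (Suc n))"
          using uv y b d lin_trans[OF l] by (meson SigmaI)
        moreover have "le (b m, d (Suc n)) (b 0, d n)" using col(2)[of 0 m n "Suc n"] m 2 by simp
        ultimately show False
          using lin_antisym[OF l, of "(b 0, d n)" "(b m, d (Suc n))"] b d ne[of 0 m n "Suc n"] m by simp
      qed
      then show ?thesis using d by blast
    qed
    then show ?thesis using b by blast
  qed
qed

text \<open>A point below (x, y) cannot exceed it in both coordinates, so it lies in the slab below
  x or in the slab below y. Both slabs have smaller rank, and a union has the larger of the two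
  ranks.\<close>

lemma vd_box_LL:
  assumes box: "box le0 le1 le c0 c1 X Y"
    and X: "\<And>x. x \<in> X \<Longrightarrow> \<exists>\<gamma>. \<gamma> \<sqsubset> \<delta> \<and> vd le \<gamma> ({u\<in>X. le0 u x} \<times> Y)"
    and Y: "\<And>y. y \<in> Y \<Longrightarrow> \<exists>\<gamma>. \<gamma> \<sqsubset> \<delta> \<and> vd le \<gamma> (X \<times> {v\<in>Y. le1 v y})"
  shows "vd le \<delta> (X \<times> Y)"
proof (rule vd.left)
  have lX: "lin le0 X" and lY: "lin le1 Y" and l: "lin le (X \<times> Y)"
    and mono: "\<And>x x' y y'. x \<in> X \<Longrightarrow> x' \<in> X \<Longrightarrow> y \<in> Y \<Longrightarrow> y' \<in> Y \<Longrightarrow> le0 x x' \<Longrightarrow> le1 y y' \<Longrightarrow> le (x, y) (x', y')"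
    using boxD[OF box] by simp_all
  fix z assume "z \<in> X \<times> Y"
  then obtain x y where z: "z = (x, y)" "x \<in> X" "y \<in> Y" by blast
  obtain \<gamma> where g: "\<gamma> \<sqsubset> \<delta>" "vd le \<gamma> ({u\<in>X. le0 u x} \<times> Y)" using X z by blast
  obtain \<gamma>' where g': "\<gamma>' \<sqsubset> \<delta>" "vd le \<gamma>' (X \<times> {v\<in>Y. le1 v y})" using Y z by blast
  have "length \<gamma> = length \<gamma>'" using g g' olt_length by metis
  then obtain \<epsilon> where e: "\<epsilon> \<sqsubset> \<delta>" "\<gamma> \<sqsubseteq> \<epsilon>" "\<gamma>' \<sqsubseteq> \<epsilon>" using ole_total g g' by (metis ole_refl)
  have "vd le \<epsilon> ({u\<in>X. le0 u x} \<times> Y \<union> X \<times> {v\<in>Y. le1 v y})"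
    by (rule vd_union[OF vd_mono[OF g(2) e(2)] vd_mono[OF g'(2) e(3)]], rule lin_subset[OF l]) blast
  moreover have "{w \<in> X \<times> Y. le w z} \<subseteq> {u\<in>X. le0 u x} \<times> Y \<union> X \<times> {v\<in>Y. le1 v y}"
  proof
    fix w assume "w \<in> {w \<in> X \<times> Y. le w z}"
    then obtain u v where w: "w = (u, v)" "u \<in> X" "v \<in> Y" "le (u, v) (x, y)" using z by blast
    show "w \<in> {u\<in>X. le0 u x} \<times> Y \<union> X \<times> {v\<in>Y. le1 v y}"
    proof (rule ccontr)
      assume "\<not> ?thesis"
      then have n: "\<not> le0 u x" "\<not> le1 v y" using w by auto
      then have "le0 x u" "le1 y v" using lin_total[OF lX] lin_total[OF lY] w z by blast+
      then have "le (x, y) (u, v)" using mono w z by blast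
      then have "u = x" using lin_antisym[OF l, of "(x, y)" "(u, v)"] w z by simp
      then show False using n lin_refl[OF lX] z by blast
    qed
  qed
  ultimately show "\<exists>\<beta>. \<beta> \<sqsubset> \<delta> \<and> vd le \<beta> {w \<in> X \<times> Y. le w z}"
    using e(1) vd_subset by blast
qed

text \<open>If X has a greatest or Y a least element, one slab is the whole box. Otherwise the box
  is cut at the point supplied by \<open>box_left_right\<close>: on one side the winning coordinate
  confines all initial (or all final) segments to slabs of smaller rank, and the other side is
  itself such a slab.\<close>

lemma vd_box_LR:
  assumes box: "box le0 le1 le c0 c1 X Y"
    and X: "\<And>x. x \<in> X \<Longrightarrow> \<exists>\<gamma>. \<gamma> \<sqsubset> \<delta> \<and> vd le \<gamma> ({u\<in>X. le0 u x} \<times> Y)"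
    and Y: "\<And>y. y \<in> Y \<Longrightarrow> \<exists>\<gamma>. \<gamma> \<sqsubset> \<delta> \<and> vd le \<gamma> (X \<times> {v\<in>Y. le1 y v})"
  shows "vd le \<delta> (X \<times> Y)"
proof -
  have lX: "lin le0 X" and lY: "lin le1 Y" and l: "lin le (X \<times> Y)"
    and mono: "\<And>x x' y y'. x \<in> X \<Longrightarrow> x' \<in> X \<Longrightarrow> y \<in> Y \<Longrightarrow> y' \<in> Y \<Longrightarrow> le0 x x' \<Longrightarrow> le1 y y' \<Longrightarrow> le (x, y) (x', y')"
    using boxD[OF box] by simp_all
  consider "X = {} \<or> Y = {}" | x where "x \<in> X" "\<And>x'. x' \<in> X \<Longrightarrow> le0 x' x"
    | y where "y \<in> Y" "\<And>y'. y' \<in> Y \<Longrightarrow> le1 y y'"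
    | "X \<noteq> {}" "Y \<noteq> {}" "\<forall>x\<in>X. \<exists>x'\<in>X. \<not> le0 x' x" "\<forall>y\<in>Y. \<exists>y'\<in>Y. \<not> le1 y y'"
    by blast
  then show ?thesis
  proof cases
    case 1
    then show ?thesis using vd_empty by auto
  next
    case 2
    then have "{u\<in>X. le0 u x} = X" by blast
    then show ?thesis using X[OF 2(1)] vd_mono olt_imp_ole by metis
  next
    case 3
    then have "{v\<in>Y. le1 y v} = Y" by blast
    then show ?thesis using Y[OF 3(1)] vd_mono olt_imp_ole by metis
  next
    case 4
    from box_left_right[OF box 4]
    consider y0 where "y0 \<in> Y" "\<forall>x\<in>X. \<exists>x'\<in>X. \<forall>u\<in>X. \<forall>v\<in>Y. le (u, v) (x, y0) \<longrightarrow> le0 u x'"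
      | x0 where "x0 \<in> X" "\<forall>y\<in>Y. \<exists>y'\<in>Y. \<forall>u\<in>X. \<forall>v\<in>Y. le (x0, y) (u, v) \<longrightarrow> le1 y' v"
      by blast
    then show ?thesis
    proof cases
      case 1
      let ?P = "X \<times> {v\<in>Y. le1 v y0}" and ?Q = "X \<times> {v\<in>Y. le1 y0 v}"
      have "vd le \<delta> ?P"
      proof (rule vd.left)
        fix z assume "z \<in> ?P"
        then obtain x y where z: "z = (x, y)" "x \<in> X" "y \<in> Y" "le1 y y0" by blast
        obtain x' where x': "x' \<in> X" "\<forall>u\<in>X. \<forall>v\<in>Y. le (u, v) (x, y0) \<longrightarrow> le0 u x'"
          using 1 z by blast
        have "le (x, y) (x, y0)" using mono z 1(1) lin_refl[OF lX] by blast
        then have "le (u, v) (x, y0)" if "u \<in> X" "v \<in> Y" "le (u, v) (x, y)" for u v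
          using lin_trans[OF l that(3)] that z 1(1) by blast
        then have "{w \<in> ?P. le w z} \<subseteq> {u\<in>X. le0 u x'} \<times> Y" using x' z by auto
        then show "\<exists>\<beta>. \<beta> \<sqsubset> \<delta> \<and> vd le \<beta> {w \<in> ?P. le w z}"
          using X[OF x'(1)] vd_subset by blast
      qed
      moreover have "vd le \<delta> ?Q" using Y[OF 1(1)] vd_mono olt_imp_ole by metis
      moreover have "?P \<union> ?Q = X \<times> Y" using lin_total[OF lY] 1(1) by blast
      ultimately show ?thesis using vd_union[of le \<delta> ?P ?Q] l by simp
    next
      case 2
      let ?P = "{u\<in>X. le0 x0 u} \<times> Y" and ?Q = "{u\<in>X. le0 u x0} \<times> Y"
      have "vd le \<delta> ?P"
      proof (rule vd.right)
        fix z assume "z \<in> ?P"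
        then obtain x y where z: "z = (x, y)" "x \<in> X" "y \<in> Y" "le0 x0 x" by blast
        obtain y' where y': "y' \<in> Y" "\<forall>u\<in>X. \<forall>v\<in>Y. le (x0, y) (u, v) \<longrightarrow> le1 y' v"
          using 2 z by blast
        have "le (x0, y) (x, y)" using mono z 2(1) lin_refl[OF lY] by blast
        then have "le (x0, y) (u, v)" if "u \<in> X" "v \<in> Y" "le (x, y) (u, v)" for u v
          using lin_trans[OF l _ that(3)] that z 2(1) by blast
        then have "{w \<in> ?P. le z w} \<subseteq> X \<times> {v\<in>Y. le1 y' v}" using y' z by auto
        then show "\<exists>\<beta>. \<beta> \<sqsubset> \<delta> \<and> vd le \<beta> {w \<in> ?P. le z w}"
          using Y[OF y'(1)] vd_subset by blast
      qed
      moreover have "vd le \<delta> ?Q" using X[OF 2(1)] vd_mono olt_imp_ole by metis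
      moreover have "?P \<union> ?Q = X \<times> Y" using lin_total[OF lX] 2(1) by blast
      ultimately show ?thesis using vd_union[of le \<delta> ?P ?Q] l by simp
    qed
  qed
qed

lemma vd_box_RR:
  assumes box: "box le0 le1 le c0 c1 X Y"
    and X: "\<And>x. x \<in> X \<Longrightarrow> \<exists>\<gamma>. \<gamma> \<sqsubset> \<delta> \<and> vd le \<gamma> ({u\<in>X. le0 x u} \<times> Y)"
    and Y: "\<And>y. y \<in> Y \<Longrightarrow> \<exists>\<gamma>. \<gamma> \<sqsubset> \<delta> \<and> vd le \<gamma> (X \<times> {v\<in>Y. le1 y v})"
  shows "vd le \<delta> (X \<times> Y)"
  using vd_dual[OF vd_box_LL[OF box_dual[OF box], of \<delta>]] X Y vd_dual[of le] by meson

lemma vd_box_RL: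
  assumes box: "box le0 le1 le c0 c1 X Y"
    and X: "\<And>x. x \<in> X \<Longrightarrow> \<exists>\<gamma>. \<gamma> \<sqsubset> \<delta> \<and> vd le \<gamma> ({u\<in>X. le0 x u} \<times> Y)"
    and Y: "\<And>y. y \<in> Y \<Longrightarrow> \<exists>\<gamma>. \<gamma> \<sqsubset> \<delta> \<and> vd le \<gamma> (X \<times> {v\<in>Y. le1 v y})"
  shows "vd le \<delta> (X \<times> Y)"
  using vd_dual[OF vd_box_LR[OF box_dual[OF box], of \<delta>]] X Y vd_dual[of le] by meson

lemma vd_box_single:
  assumes box: "box le0 le1 le c0 c1 {x} Y" and "vd le1 \<beta> Y"
  shows "vd le \<beta> ({x} \<times> Y)"
proof -
  have lY: "lin le1 Y" and l: "lin le ({x} \<times> Y)" and x: "le0 x x"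
    and mono: "\<And>y y'. y \<in> Y \<Longrightarrow> y' \<in> Y \<Longrightarrow> le0 x x \<Longrightarrow> le1 y y' \<Longrightarrow> le (x, y) (x, y')"
    using boxD[OF box] lin_refl[of le0 "{x}" x] by simp_all
  have "vd le \<beta> (Pair x ` Y)"
  proof (rule vd_image[OF assms(2)])
    fix y y' assume y: "y \<in> Y" "y' \<in> Y"
    show "le (x, y) (x, y') = le1 y y'"
      using mono[OF y x] mono[OF y(2,1) x] lin_total[OF lY y] lin_refl[OF lY] lin_antisym[OF l, of "(x, y)" "(x, y')"] y by auto
  qed
  moreover have "Pair x ` Y = {x} \<times> Y" by auto
  ultimately show ?thesis by simp
qed

lemma vd_box_single2:
  assumes box: "box le0 le1 le c0 c1 X {y}" and "vd le0 \<alpha> X"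
  shows "vd le \<alpha> (X \<times> {y})"
proof -
  have lX: "lin le0 X" and l: "lin le (X \<times> {y})" and y: "le1 y y"
    and mono: "\<And>x x'. x \<in> X \<Longrightarrow> x' \<in> X \<Longrightarrow> le1 y y \<Longrightarrow> le0 x x' \<Longrightarrow> le (x, y) (x', y)"
    using boxD[OF box] lin_refl[of le1 "{y}" y] by simp_all
  have "vd le \<alpha> ((\<lambda>x. (x, y)) ` X)"
  proof (rule vd_image[OF assms(2)])
    fix x x' assume x: "x \<in> X" "x' \<in> X"
    show "le (x, y) (x', y) = le0 x x'"
      using mono[OF x y] mono[OF x(2,1) y] lin_total[OF lX x] lin_refl[OF lX] lin_antisym[OF l, of "(x, y)" "(x', y)"] x by auto
  qed
  moreover have "(\<lambda>x. (x, y)) ` X = X \<times> {y}" by auto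
  ultimately show ?thesis by simp
qed

text \<open>The flag \<open>X_left\<close> tells whether \<open>X\<close> is an \<open>\<omega>\<close>-sum or an \<open>\<omega>\<^sup>*\<close>-sum of smaller sets.\<close>
lemma vd_box_aux:
  assumes X: "vd le0 \<alpha> X" and d: "X_left \<Longrightarrow> \<forall>x\<in>X. \<exists>\<alpha>'. \<alpha>' \<sqsubset> \<alpha> \<and>
      (\<forall>\<beta> Y. length \<beta> = length \<alpha>' \<longrightarrow> vd le1 \<beta> Y \<longrightarrow> box le0 le1 le c0 c1 {u\<in>X. le0 u x} Y
         \<longrightarrow> vd le (\<alpha>' \<oplus> \<beta>) ({u\<in>X. le0 u x} \<times> Y))"
    and e: "\<not> X_left \<Longrightarrow> \<forall>x\<in>X. \<exists>\<alpha>'. \<alpha>' \<sqsubset> \<alpha> \<and>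
      (\<forall>\<beta> Y. length \<beta> = length \<alpha>' \<longrightarrow> vd le1 \<beta> Y \<longrightarrow> box le0 le1 le c0 c1 {u\<in>X. le0 x u} Y
         \<longrightarrow> vd le (\<alpha>' \<oplus> \<beta>) ({u\<in>X. le0 x u} \<times> Y))"
  shows "vd le1 \<beta> Y \<Longrightarrow> length \<beta> = length \<alpha> \<Longrightarrow> box le0 le1 le c0 c1 X Y \<Longrightarrow> vd le (\<alpha> \<oplus> \<beta>) (X \<times> Y)"
proof (induction rule: vd.induct)
  case (single \<beta> y)
  show ?case using vd_mono[OF vd_box_single2[OF single(2) X] ole_nsum] single by metis
next
  case (sum \<beta> S S')
  have "vd le (\<alpha> \<oplus> \<beta>) (X \<times> S)" "vd le (\<alpha> \<oplus> \<beta>) (X \<times> S')"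
    using sum box_subset[OF sum.prems(2)] by auto
  moreover have "X \<times> (S \<union> S') = X \<times> S \<union> X \<times> S'" by blast
  ultimately show ?case using vd_union[of le _ "X \<times> S"] sum.prems(2) by (simp add: box_def)
next
  case (left Y \<beta>)
  have Y: "vd le1 \<beta> Y" by (rule vd.left) (use left.IH in blast)
  have y: "\<exists>\<gamma>. \<gamma> \<sqsubset> \<alpha> \<oplus> \<beta> \<and> vd le \<gamma> (X \<times> {v\<in>Y. le1 v y})" if yY: "y \<in> Y" for y
  proof -
    obtain \<beta>' where b: "\<beta>' \<sqsubset> \<beta>" and c: "length \<beta>' = length \<alpha> \<Longrightarrow> box le0 le1 le c0 c1 X {v\<in>Y. le1 v y} \<Longrightarrow> vd le (\<alpha> \<oplus> \<beta>') (X \<times> {v\<in>Y. le1 v y})"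
      using left.IH[OF yY] by blast
    have "vd le (\<alpha> \<oplus> \<beta>') (X \<times> {v\<in>Y. le1 v y})"
      by (rule c) (use left.prems olt_length[OF b] in \<open>auto intro: box_subset\<close>)
    then show ?thesis using nsum_mono2[OF b] left.prems(1) by auto
  qed
  show ?case
  proof (cases X_left)
    case True
    have x: "\<exists>\<gamma>. \<gamma> \<sqsubset> \<alpha> \<oplus> \<beta> \<and> vd le \<gamma> ({u\<in>X. le0 u x} \<times> Y)" if xX: "x \<in> X" for x
    proof -
      obtain \<alpha>' where a: "\<alpha>' \<sqsubset> \<alpha>" and c: "\<And>\<beta> Y. length \<beta> = length \<alpha>' \<Longrightarrow> vd le1 \<beta> Y \<Longrightarrow> box le0 le1 le c0 c1 {u\<in>X. le0 u x} Y
         \<Longrightarrow> vd le (\<alpha>' \<oplus> \<beta>) ({u\<in>X. le0 u x} \<times> Y)"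
        using d[OF True] xX by blast
      have "vd le (\<alpha>' \<oplus> \<beta>) ({u\<in>X. le0 u x} \<times> Y)"
        by (rule c) (use left.prems olt_length[OF a] Y in \<open>auto intro: box_subset\<close>)
      then show ?thesis using nsum_mono1[OF a] left.prems(1) by auto
    qed
    show ?thesis by (rule vd_box_LL[OF left.prems(2) x y])
  next
    case False
    have x: "\<exists>\<gamma>. \<gamma> \<sqsubset> \<alpha> \<oplus> \<beta> \<and> vd le \<gamma> ({u\<in>X. le0 x u} \<times> Y)" if xX: "x \<in> X" for x
    proof -
      obtain \<alpha>' where a: "\<alpha>' \<sqsubset> \<alpha>" and c: "\<And>\<beta> Y. length \<beta> = length \<alpha>' \<Longrightarrow> vd le1 \<beta> Y \<Longrightarrow> box le0 le1 le c0 c1 {u\<in>X. le0 x u} Y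
         \<Longrightarrow> vd le (\<alpha>' \<oplus> \<beta>) ({u\<in>X. le0 x u} \<times> Y)"
        using e[OF False] xX by blast
      have "vd le (\<alpha>' \<oplus> \<beta>) ({u\<in>X. le0 x u} \<times> Y)"
        by (rule c) (use left.prems olt_length[OF a] Y in \<open>auto intro: box_subset\<close>)
      then show ?thesis using nsum_mono1[OF a] left.prems(1) by auto
    qed
    show ?thesis by (rule vd_box_RL[OF left.prems(2) x y])
  qed
next
  case (right Y \<beta>)
  have Y: "vd le1 \<beta> Y" by (rule vd.right) (use right.IH in blast)
  have y: "\<exists>\<gamma>. \<gamma> \<sqsubset> \<alpha> \<oplus> \<beta> \<and> vd le \<gamma> (X \<times> {v\<in>Y. le1 y v})" if yY: "y \<in> Y" for y
  proof -
    obtain \<beta>' where b: "\<beta>' \<sqsubset> \<beta>" and c: "length \<beta>' = length \<alpha> \<Longrightarrow> box le0 le1 le c0 c1 X {v\<in>Y. le1 y v} \<Longrightarrow> vd le (\<alpha> \<oplus> \<beta>') (X \<times> {v\<in>Y. le1 y v})"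
      using right.IH[OF yY] by blast
    have "vd le (\<alpha> \<oplus> \<beta>') (X \<times> {v\<in>Y. le1 y v})"
      by (rule c) (use right.prems olt_length[OF b] in \<open>auto intro: box_subset\<close>)
    then show ?thesis using nsum_mono2[OF b] right.prems(1) by auto
  qed
  show ?case
  proof (cases X_left)
    case True
    have x: "\<exists>\<gamma>. \<gamma> \<sqsubset> \<alpha> \<oplus> \<beta> \<and> vd le \<gamma> ({u\<in>X. le0 u x} \<times> Y)" if xX: "x \<in> X" for x
    proof -
      obtain \<alpha>' where a: "\<alpha>' \<sqsubset> \<alpha>" and c: "\<And>\<beta> Y. length \<beta> = length \<alpha>' \<Longrightarrow> vd le1 \<beta> Y \<Longrightarrow> box le0 le1 le c0 c1 {u\<in>X. le0 u x} Y
         \<Longrightarrow> vd le (\<alpha>' \<oplus> \<beta>) ({u\<in>X. le0 u x} \<times> Y)"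
        using d[OF True] xX by blast
      have "vd le (\<alpha>' \<oplus> \<beta>) ({u\<in>X. le0 u x} \<times> Y)"
        by (rule c) (use right.prems olt_length[OF a] Y in \<open>auto intro: box_subset\<close>)
      then show ?thesis using nsum_mono1[OF a] right.prems(1) by auto
    qed
    show ?thesis by (rule vd_box_LR[OF right.prems(2) x y])
  next
    case False
    have x: "\<exists>\<gamma>. \<gamma> \<sqsubset> \<alpha> \<oplus> \<beta> \<and> vd le \<gamma> ({u\<in>X. le0 x u} \<times> Y)" if xX: "x \<in> X" for x
    proof -
      obtain \<alpha>' where a: "\<alpha>' \<sqsubset> \<alpha>" and c: "\<And>\<beta> Y. length \<beta> = length \<alpha>' \<Longrightarrow> vd le1 \<beta> Y \<Longrightarrow> box le0 le1 le c0 c1 {u\<in>X. le0 x u} Y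
         \<Longrightarrow> vd le (\<alpha>' \<oplus> \<beta>) ({u\<in>X. le0 x u} \<times> Y)"
        using e[OF False] xX by blast
      have "vd le (\<alpha>' \<oplus> \<beta>) ({u\<in>X. le0 x u} \<times> Y)"
        by (rule c) (use right.prems olt_length[OF a] Y in \<open>auto intro: box_subset\<close>)
      then show ?thesis using nsum_mono1[OF a] right.prems(1) by auto
    qed
    show ?thesis by (rule vd_box_RR[OF right.prems(2) x y])
  qed
qed

text \<open>Both factors are taken apart, X outside and Y inside. A finite sum in either factor
  splits the box. If both are sums of type \<omega> or \<open>\<omega>\<^sup>*\<close>, replacing
  one factor by a segment lowers the natural sum, and the four combinations of directions
  apply.\<close>

lemma vd_box:
  "vd le0 \<alpha> X \<Longrightarrow> vd le1 \<beta> Y \<Longrightarrow> length \<beta> = length \<alpha> \<Longrightarrow> box le0 le1 le c0 c1 X Y \<Longrightarrow> vd le (\<alpha> \<oplus> \<beta>) (X \<times> Y)"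
proof (induction arbitrary: \<beta> Y rule: vd.induct)
  case (single \<alpha> x)
  show ?case using vd_mono[OF vd_box_single[OF single(3,1)] ole_nsum] single(2) by (metis nsum_commute)
next
  case (sum \<alpha> S S')
  have "vd le (\<alpha> \<oplus> \<beta>) (S \<times> Y)" "vd le (\<alpha> \<oplus> \<beta>) (S' \<times> Y)"
    using sum box_subset[OF sum.prems(3)] by auto
  moreover have "(S \<union> S') \<times> Y = S \<times> Y \<union> S' \<times> Y" by blast
  ultimately show ?case using vd_union[of le _ "S \<times> Y"] sum.prems(3) by (simp add: box_def)
next
  case (left X \<alpha>)
  have X: "vd le0 \<alpha> X" by (rule vd.left) (use left.IH in blast)
  show ?case by (rule vd_box_aux[OF X, where X_left = True]) (use left in blast)+
next
  case (right X \<alpha>)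
  have X: "vd le0 \<alpha> X" by (rule vd.right) (use right.IH in blast)
  show ?case by (rule vd_box_aux[OF X, where X_left = False]) (use right in blast)+
qed

section \<open>Finite condensations\<close>

definition convex_equiv :: "'a::linorder rel \<Rightarrow> bool" where
  "convex_equiv R \<longleftrightarrow> equiv UNIV R \<and> (\<forall>x y z. (x, y) \<in> R \<and> x \<le> z \<and> z \<le> y \<longrightarrow> (x, z) \<in> R)"

lemma convex_equivD:
  assumes "convex_equiv R"
  shows "(x, x) \<in> R" "(x, y) \<in> R \<Longrightarrow> (y, x) \<in> R" "(x, y) \<in> R \<Longrightarrow> (y, z) \<in> R \<Longrightarrow> (x, z) \<in> R"
    "(x, y) \<in> R \<Longrightarrow> x \<le> z \<Longrightarrow> z \<le> y \<Longrightarrow> (x, z) \<in> R" "R `` {x} = R `` {y} \<longleftrightarrow> (x, y) \<in> R"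
  using assms unfolding convex_equiv_def equiv_def
  by (auto dest: refl_onD symD transD)

text \<open>A class between those of x and y with a representative outside [x, y] must, by
  convexity, be the class of x or of y. Condensation thus becomes a statement about intervals of the
  ordering itself, without any quotient.\<close>

lemma class_between:
  assumes R: "convex_equiv R" and "x \<le> y"
  shows "{c \<in> UNIV // R. (cls_le (R `` {x}) c \<and> cls_le c (R `` {y})) \<or> (cls_le (R `` {y}) c \<and> cls_le c (R `` {x}))}
      = (\<lambda>z. R `` {z}) ` {x..y}" (is "?L = ?R")
proof
  note d = convex_equivD[OF R]
  show "?R \<subseteq> ?L"
    using d(1) by (fastforce simp: cls_le_def quotient_def)
  show "?L \<subseteq> ?R"
  proof
    fix c assume c: "c \<in> ?L"
    then obtain w where w: "c = R `` {w}" by (auto elim: quotientE)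
    obtain a b a' b' where ab: "a \<le> b" "(w, b) \<in> R" "a' \<le> b'" "(w, a') \<in> R"
      "(x, a) \<in> R \<and> (y, b') \<in> R \<or> (y, a) \<in> R \<and> (x, b') \<in> R"
      using c unfolding w cls_le_def by blast
    consider "x \<le> w" "w \<le> y" | "w < x" | "y < w" by force
    then have "(x, w) \<in> R \<or> (y, w) \<in> R \<or> w \<in> {x..y}"
    proof cases
      case 2
      show ?thesis
      proof (cases "x \<le> b")
        case True
        then have "(w, x) \<in> R" using d(4)[OF ab(2)] 2 by simp
        then show ?thesis using d(2) by blast
      next
        case False
        have "(x, a) \<in> R \<Longrightarrow> (x, b) \<in> R" using d(2,3,4) ab(1) False by (meson linear)
        moreover have "(y, a) \<in> R \<Longrightarrow> (y, b) \<in> R" using d(2,3,4) ab(1) False assms(2) by (meson linear order_trans)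
        ultimately show ?thesis using ab(2,5) d(2,3) by blast
      qed
    next
      case 3
      show ?thesis
      proof (cases "a' \<le> y")
        case True
        then have "(a', y) \<in> R" using d(4)[of a' w y] d(2) ab(4) 3 by simp
        then show ?thesis using d(2,3) ab(4) by blast
      next
        case False
        have "(y, b') \<in> R \<Longrightarrow> (y, a') \<in> R" using d(4)[of y b' a'] ab(3) False by simp
        moreover have "(x, b') \<in> R \<Longrightarrow> (x, a') \<in> R" using d(4)[of x b' a'] ab(3) False assms(2) by simp
        ultimately show ?thesis using ab(4,5) d(2,3) by blast
      qed
    qed simp
    then show "c \<in> ?R"
    proof (elim disjE)
      assume "(x, w) \<in> R"
      then have "c = R `` {x}" using d(5)[of x w] w by blast
      then show ?thesis using assms(2) by auto
    next
      assume "(y, w) \<in> R"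
      then have "c = R `` {y}" using d(5)[of y w] w by blast
      then show ?thesis using assms(2) by auto
    qed (use w in blast)
  qed
qed

lemma fc_step_iff:
  assumes "convex_equiv R"
  shows "(x, y) \<in> fc_step R \<longleftrightarrow> finite ((\<lambda>z. R `` {z}) ` {min x y..max x y})"
proof (cases "x \<le> y")
  case True
  then show ?thesis using class_between[OF assms True] by (simp add: fc_step_def min_def max_def)
next
  case False
  then have "y \<le> x" by simp
  from class_between[OF assms this] show ?thesis using False
    by (simp add: fc_step_def min_def max_def disj_commute)
qed

lemma fc_step_extends: "convex_equiv R \<Longrightarrow> R \<subseteq> fc_step R"
proof safe
  fix x y assume R: "convex_equiv R" and xy: "(x, y) \<in> R"
  note d = convex_equivD[OF R]
  have "(x, z) \<in> R" if "z \<in> {min x y..max x y}" for z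
    using that d(4)[OF xy, of z] d(4)[OF d(2)[OF xy], of z] d(3)[OF xy] by (auto simp: min_def max_def split: if_splits)
  then have "(\<lambda>z. R `` {z}) ` {min x y..max x y} \<subseteq> {R `` {x}}" using d(5) by blast
  then show "(x, y) \<in> fc_step R" unfolding fc_step_iff[OF R] by (rule finite_subset) simp
qed

lemma convex_equiv_fc_step:
  assumes R: "convex_equiv R"
  shows "convex_equiv (fc_step R)"
proof -
  let ?C = "\<lambda>z. R `` {z}"
  have sub: "(x, z) \<in> fc_step R"
    if "(x, y) \<in> fc_step R" "(y, z) \<in> fc_step R" "{min x z..max x z} \<subseteq> {min x y..max x y} \<union> {min y z..max y z}" for x y z
  proof -
    have "?C ` {min x z..max x z} \<subseteq> ?C ` {min x y..max x y} \<union> ?C ` {min y z..max y z}"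
      using that(3) by blast
    then show ?thesis using that(1,2) unfolding fc_step_iff[OF R] by (meson finite_UnI finite_subset)
  qed
  have "refl (fc_step R)" using fc_step_extends[OF R] convex_equivD(1)[OF R] by (auto simp: refl_on_def)
  moreover have "sym (fc_step R)" by (auto simp: sym_def fc_step_iff[OF R] min.commute max.commute)
  moreover have "trans (fc_step R)"
  proof (rule transI)
    fix x y z assume xyz: "(x, y) \<in> fc_step R" "(y, z) \<in> fc_step R"
    show "(x, z) \<in> fc_step R"
      by (rule sub[OF xyz]) (auto simp: min_def max_def split: if_splits)
  qed
  moreover have "(x, z) \<in> fc_step R" if "(x, y) \<in> fc_step R" "x \<le> z" "z \<le> y" for x y z
  proof -
    have "?C ` {min x z..max x z} \<subseteq> ?C ` {min x y..max x y}"
      using that(2,3) by (auto simp: min_def max_def)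
    then show ?thesis using that(1) unfolding fc_step_iff[OF R] by (rule finite_subset)
  qed
  ultimately show ?thesis unfolding convex_equiv_def equiv_def by simp blast
qed

section \<open>The iterated condensation relations\<close>

lemma last_olt: "\<alpha> \<noteq> [] \<Longrightarrow> last \<alpha> \<noteq> 0 \<Longrightarrow> butlast \<alpha> @ [last \<alpha> - 1] \<sqsubset> \<alpha>"
  by (induction \<alpha>) auto

lemma fc_sim_unfold:
  "fc_sim \<alpha> = (if (\<forall>i\<in>set \<alpha>. i = 0) then Id
     else if last \<alpha> \<noteq> 0 then fc_step (fc_sim (butlast \<alpha> @ [last \<alpha> - 1]))
     else (\<Union>\<beta>\<in>{\<beta>. \<beta> \<sqsubset> \<alpha>}. fc_sim \<beta>))"
proof -
  have "\<not> (\<forall>i\<in>set \<alpha>. i = 0) \<Longrightarrow> \<alpha> \<noteq> []" by auto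
  then show ?thesis
    unfolding fc_sim_def
    by (subst wfrec[OF wf_lex[OF wf_less_than]]) (use last_olt[of \<alpha>] in \<open>auto simp: cut_apply\<close>)
qed

text \<open>This is the ordinal successor on nonempty lists. The list [] stands for the only ordinal
  below \<omega>^0, which has no successor there; hence the conditions \<alpha> \<noteq> []
  below.\<close>

definition osuc :: "nat list \<Rightarrow> nat list" where
  "osuc \<alpha> = butlast \<alpha> @ [Suc (last \<alpha>)]"

lemma fc_sim_osuc: "\<alpha> \<noteq> [] \<Longrightarrow> fc_sim (osuc \<alpha>) = fc_step (fc_sim \<alpha>)"
  by (subst fc_sim_unfold) (simp add: osuc_def)

lemma olt_osuc: "\<beta> \<noteq> [] \<Longrightarrow> \<beta> \<sqsubset> osuc \<beta>"
  unfolding osuc_def by (induction \<beta>) auto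

lemma osuc_ole: "\<beta> \<sqsubset> \<alpha> \<Longrightarrow> osuc \<beta> \<sqsubseteq> \<alpha>"
proof (induction \<alpha> arbitrary: \<beta>)
  case (Cons a \<alpha>)
  then obtain b \<beta>' where b: "\<beta> = b # \<beta>'" by (cases \<beta>) auto
  show ?case
  proof (cases \<beta>')
    case Nil
    then show ?thesis using Cons.prems b by (auto simp: osuc_def ole_def)
  next
    case (Cons c \<gamma>)
    then have "osuc \<beta> = b # osuc \<beta>'" "length (osuc \<beta>') = length \<beta>'" by (simp_all add: osuc_def b)
    then show ?thesis using Cons.IH[of \<beta>'] Cons.prems b by (auto simp: ole_def)
  qed
qed simp

lemma length_osuc: "\<alpha> \<noteq> [] \<Longrightarrow> length (osuc \<alpha>) = length \<alpha>"
  by (simp add: osuc_def)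

lemma olt_cases:
  obtains (zero) "\<forall>i\<in>set \<alpha>. i = 0"
  | (suc) \<gamma> where "\<gamma> \<noteq> []" "\<alpha> = osuc \<gamma>"
  | (limit) "\<alpha> \<noteq> []" "\<not> (\<forall>i\<in>set \<alpha>. i = 0)" "last \<alpha> = 0"
proof -
  consider "\<forall>i\<in>set \<alpha>. i = 0" | "\<not> (\<forall>i\<in>set \<alpha>. i = 0)" "last \<alpha> = 0" | "\<not> (\<forall>i\<in>set \<alpha>. i = 0)" "last \<alpha> \<noteq> 0" by blast
  then show thesis
  proof cases
    case 2
    then show ?thesis using limit by (cases "\<alpha> = []") auto
  next
    case 3
    then have "\<alpha> \<noteq> []" by auto
    then have "\<alpha> = osuc (butlast \<alpha> @ [last \<alpha> - 1])" using 3 by (simp add: osuc_def)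
    then show ?thesis using suc by blast
  qed (rule zero)
qed

lemma olt_osuc_iff: "\<gamma> \<noteq> [] \<Longrightarrow> \<beta> \<sqsubset> osuc \<gamma> \<Longrightarrow> \<beta> \<sqsubseteq> \<gamma>"
proof (rule ccontr)
  assume a: "\<gamma> \<noteq> []" "\<beta> \<sqsubset> osuc \<gamma>" "\<not> \<beta> \<sqsubseteq> \<gamma>"
  have "length \<beta> = length \<gamma>" using olt_length[OF a(2)] length_osuc[OF a(1)] by simp
  then have "\<gamma> \<sqsubset> \<beta>" using a(3) olt_total[of \<beta> \<gamma>] by (auto simp: ole_def)
  then have "osuc \<gamma> \<sqsubset> osuc \<gamma>" using osuc_ole a(2) ole_olt_trans by blast
  then show False using wf_lex[OF wf_less_than] by (meson wf_not_refl)
qed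

lemma olt_zero: "\<forall>i\<in>set \<alpha>. i = 0 \<Longrightarrow> \<not> \<beta> \<sqsubset> \<alpha>"
proof (induction \<alpha> arbitrary: \<beta>)
  case (Cons a \<alpha>)
  then show ?case by (cases \<beta>) auto
qed simp

text \<open>The two claims depend on each other: a condensation step extends a relation if that
  relation is a convex equivalence, and the union at a limit is transitive because the relations
  below it form a chain.\<close>

lemma fc_sim_props: "convex_equiv (fc_sim \<alpha> :: 'a::linorder rel) \<and> (\<forall>\<beta>. \<beta> \<sqsubset> \<alpha> \<longrightarrow> (fc_sim \<beta> :: 'a rel) \<subseteq> fc_sim \<alpha>)"
proof (induction \<alpha> rule: wf_induct_rule[OF wf_lex[OF wf_less_than]])
  case (1 \<alpha>)
  show ?case
  proof (cases \<alpha> rule: olt_cases)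
    case zero
    then have "(fc_sim \<alpha> :: 'a rel) = Id" using fc_sim_unfold[of \<alpha>] by simp
    then show ?thesis using olt_zero[OF zero] by (auto simp: convex_equiv_def equiv_def refl_on_def sym_def trans_def)
  next
    case (suc \<gamma>)
    have s: "(fc_sim \<alpha> :: 'a rel) = fc_step (fc_sim \<gamma>)" using fc_sim_osuc suc by blast
    have g: "\<gamma> \<sqsubset> \<alpha>" using olt_osuc suc by blast
    have "convex_equiv (fc_sim \<gamma> :: 'a rel)" using 1[OF g] by blast
    moreover have "\<beta> \<sqsubset> \<alpha> \<Longrightarrow> (fc_sim \<beta> :: 'a rel) \<subseteq> fc_sim \<gamma>" for \<beta>
      using olt_osuc_iff[OF suc(1)] suc(2) 1[OF g] by (auto simp: ole_def)
    ultimately show ?thesis unfolding s using convex_equiv_fc_step fc_step_extends by blast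
  next
    case limit
    have s: "(fc_sim \<alpha> :: 'a rel) = (\<Union>\<beta>\<in>{\<beta>. \<beta> \<sqsubset> \<alpha>}. fc_sim \<beta>)"
      using fc_sim_unfold[of \<alpha>] limit by (simp only: if_False) simp
    have "\<exists>\<beta>. \<beta> \<sqsubset> \<alpha>"
    proof -
      have "replicate (length \<alpha>) 0 \<noteq> \<alpha>" using limit(2) by (metis in_set_replicate)
      moreover have "\<not> \<alpha> \<sqsubset> replicate (length \<alpha>) 0" by (rule olt_zero) simp
      ultimately show ?thesis using olt_total[of \<alpha> "replicate (length \<alpha>) 0"] by auto
    qed
    then obtain \<beta>0 where b0: "\<beta>0 \<sqsubset> \<alpha>" by blast
    have chain: "\<exists>\<delta>. \<delta> \<sqsubset> \<alpha> \<and> (fc_sim \<beta> :: 'a rel) \<subseteq> fc_sim \<delta> \<and> (fc_sim \<gamma> :: 'a rel) \<subseteq> fc_sim \<delta>"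
      if "\<beta> \<sqsubset> \<alpha>" "\<gamma> \<sqsubset> \<alpha>" for \<beta> \<gamma>
    proof -
      have "\<beta> \<sqsubset> \<gamma> \<or> \<beta> = \<gamma> \<or> \<gamma> \<sqsubset> \<beta>" using olt_total olt_length that by metis
      then show ?thesis using 1 that by (metis order_refl)
    qed
    have d: "(x, y) \<in> fc_sim \<alpha> \<longleftrightarrow> (\<exists>\<beta>. \<beta> \<sqsubset> \<alpha> \<and> (x, y) \<in> fc_sim \<beta>)" for x y :: 'a
      unfolding s by blast
    have c: "convex_equiv (fc_sim \<beta> :: 'a rel)" if "\<beta> \<sqsubset> \<alpha>" for \<beta> using 1[OF that] by blast
    have "convex_equiv (fc_sim \<alpha> :: 'a rel)"
      unfolding convex_equiv_def equiv_def
    proof (intro conjI allI impI)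
      show "fc_sim \<alpha> \<subseteq> UNIV \<times> (UNIV :: 'a set)" by simp
      show "refl (fc_sim \<alpha> :: 'a rel)"
        using b0 convex_equivD(1)[OF c] by (auto simp: refl_on_def d)
      show "sym (fc_sim \<alpha> :: 'a rel)"
        using convex_equivD(2)[OF c] unfolding sym_def d by blast
      show "trans (fc_sim \<alpha> :: 'a rel)"
      proof (rule transI)
        fix x y z :: 'a assume "(x, y) \<in> fc_sim \<alpha>" "(y, z) \<in> fc_sim \<alpha>"
        then obtain \<beta> \<gamma> where bg: "\<beta> \<sqsubset> \<alpha>" "\<gamma> \<sqsubset> \<alpha>" "(x, y) \<in> fc_sim \<beta>" "(y, z) \<in> fc_sim \<gamma>" unfolding d by blast
        obtain \<delta> where "\<delta> \<sqsubset> \<alpha>" "(x, y) \<in> fc_sim \<delta>" "(y, z) \<in> fc_sim \<delta>" using chain[OF bg(1,2)] bg(3,4) by blast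
        then show "(x, z) \<in> fc_sim \<alpha>" unfolding d using convex_equivD(3)[OF c] by blast
      qed
      show "(x, z) \<in> fc_sim \<alpha>" if "(x, y) \<in> fc_sim \<alpha> \<and> x \<le> z \<and> z \<le> y" for x y z :: 'a
        using that convex_equivD(4)[OF c] unfolding d by blast
    qed
    then show ?thesis unfolding s by blast
  qed
qed

lemma convex_equiv_fc_sim: "convex_equiv (fc_sim \<alpha>)"
  using fc_sim_props by blast

lemma fc_sim_mono: "\<alpha> \<sqsubseteq> \<beta> \<Longrightarrow> fc_sim \<alpha> \<subseteq> fc_sim \<beta>"
  using fc_sim_props[of \<beta>] by (auto simp: ole_def)

section \<open>Comparison of ranks with condensations\<close>

lemma lin_le: "lin (\<le>) (S :: 'a::linorder set)"
  by (auto simp: lin_def)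

text \<open>At a successor, every interval inside one class has the smaller rank. So the part of the
  class above a point p is an \<omega>-sum and the part below p is an
  \<open>\<omega>\<^sup>*\<close>-sum of sets of smaller rank. Finitely many classes cover [x, y],
  and unions do not raise the rank.\<close>

lemma fc_sim_imp_vd: "(x, y) \<in> fc_sim \<alpha> \<Longrightarrow> vd (\<le>) \<alpha> {x..y :: 'a::linorder}"
proof (induction \<alpha> arbitrary: x y rule: wf_induct_rule[OF wf_lex[OF wf_less_than]])
  case (1 \<alpha>)
  show ?case
  proof (cases \<alpha> rule: olt_cases)
    case zero
    then have "(fc_sim \<alpha> :: 'a rel) = Id" using fc_sim_unfold[of \<alpha>] by simp
    then have "x = y" using 1(2) by simp
    then show ?thesis by (simp add: vd.single)
  next
    case (suc \<gamma>)
    let ?R = "fc_sim \<gamma> :: 'a rel"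
    note d = convex_equivD[OF convex_equiv_fc_sim[of \<gamma>]]
    have s: "(fc_sim \<alpha> :: 'a rel) = fc_step ?R" using fc_sim_osuc suc by blast
    have g: "\<gamma> \<sqsubset> \<alpha>" using olt_osuc suc by blast
    have cls: "vd (\<le>) \<alpha> (?R `` {p})" for p
    proof (rule vd_cut'[OF lin_le, where p = p and A = "{z \<in> ?R `` {p}. z \<le> p}" and B = "{z \<in> ?R `` {p}. p \<le> z}"])
      show "vd (\<le>) \<alpha> {z \<in> ?R `` {p}. p \<le> z}"
      proof (rule vd.left)
        fix z assume z: "z \<in> {z \<in> ?R `` {p}. p \<le> z}"
        then have "vd (\<le>) \<gamma> {p..z}" using 1(1)[OF g] by blast
        then have "vd (\<le>) \<gamma> {w \<in> {z \<in> ?R `` {p}. p \<le> z}. w \<le> z}" by (rule vd_subset) auto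
        then show "\<exists>\<beta>. \<beta> \<sqsubset> \<alpha> \<and> vd (\<le>) \<beta> {w \<in> {z \<in> ?R `` {p}. p \<le> z}. w \<le> z}" using g by blast
      qed
      show "vd (\<le>) \<alpha> {z \<in> ?R `` {p}. z \<le> p}"
      proof (rule vd.right)
        fix z assume z: "z \<in> {z \<in> ?R `` {p}. z \<le> p}"
        then have "vd (\<le>) \<gamma> {z..p}" using 1(1)[OF g] d(2) by blast
        then have "vd (\<le>) \<gamma> {w \<in> {z \<in> ?R `` {p}. z \<le> p}. z \<le> w}" by (rule vd_subset) auto
        then show "\<exists>\<beta>. \<beta> \<sqsubset> \<alpha> \<and> vd (\<le>) \<beta> {w \<in> {z \<in> ?R `` {p}. z \<le> p}. z \<le> w}" using g by blast
      qed
    qed (use d(1) in auto)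
    have fin: "finite ((\<lambda>z. ?R `` {z}) ` {x..y})"
    proof (cases "x \<le> y")
      case True
      then show ?thesis using 1(2) unfolding s fc_step_iff[OF convex_equiv_fc_sim] by (simp add: min_def max_def)
    qed simp
    have un: "finite F \<Longrightarrow> F \<subseteq> range (\<lambda>z. ?R `` {z}) \<Longrightarrow> vd (\<le>) \<alpha> (\<Union>F)" for F
      by (induction rule: finite_induct) (use vd_union[OF cls _ lin_le] in \<open>auto simp: vd_empty\<close>)
    have "vd (\<le>) \<alpha> (\<Union>((\<lambda>z. ?R `` {z}) ` {x..y}))" using un[OF fin] by blast
    then show ?thesis by (rule vd_subset) (use d(1) in auto)
  next
    case limit
    have "(fc_sim \<alpha> :: 'a rel) = (\<Union>\<beta>\<in>{\<beta>. \<beta> \<sqsubset> \<alpha>}. fc_sim \<beta>)"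
      using fc_sim_unfold[of \<alpha>] limit by (simp only: if_False) simp
    then obtain \<beta> where "\<beta> \<sqsubset> \<alpha>" "(x, y) \<in> fc_sim \<beta>" using 1(2) by blast
    then show ?thesis using 1(1) vd_mono olt_imp_ole by blast
  qed
qed

definition order_convex :: "'a::linorder set \<Rightarrow> bool" where
  "order_convex S \<longleftrightarrow> (\<forall>x\<in>S. \<forall>y\<in>S. \<forall>w. x \<le> w \<and> w \<le> y \<longrightarrow> w \<in> S)"

lemma finite_classes_if_one:
  assumes "\<And>x y. x \<in> S \<Longrightarrow> y \<in> S \<Longrightarrow> x \<le> y \<Longrightarrow> (x, y) \<in> fc_sim \<alpha>"
  shows "finite ((\<lambda>z. fc_sim \<alpha> `` {z}) ` S)"
proof (cases "S = {}")
  case False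
  then obtain x where x: "x \<in> S" by blast
  have "fc_sim \<alpha> `` {x} = fc_sim \<alpha> `` {y}" if y: "y \<in> S" for y
  proof (cases "x \<le> y")
    case True
    then show ?thesis using convex_equivD(5)[OF convex_equiv_fc_sim] assms[OF x y] by blast
  next
    case False
    then have "(y, x) \<in> fc_sim \<alpha>" using assms[OF y x] by simp
    then show ?thesis using convex_equivD(5)[OF convex_equiv_fc_sim] by blast
  qed
  then have "(\<lambda>z. fc_sim \<alpha> `` {z}) ` S \<subseteq> {fc_sim \<alpha> `` {x}}" by blast
  then show ?thesis by (rule finite_subset) simp
qed simp

text \<open>An \<omega>-sum even lies in a single class. The initial segment up to y has a smaller
  rank \<beta>, so [x, y] meets finitely many classes of \<open>\<sim>\<^sub>\<beta>\<close>, and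
  the next step, still at most \<alpha>, identifies x with y. Several classes arise only from finite
  sums.\<close>

lemma vd_imp_finite_classes:
  fixes S :: "'a::linorder set"
  shows "vd (\<le>) \<alpha> S \<Longrightarrow> order_convex S \<Longrightarrow> finite ((\<lambda>z. fc_sim \<alpha> `` {z}) ` S)"
proof (induction rule: vd.induct)
  case (sum \<alpha> S S')
  have "order_convex S" unfolding order_convex_def
  proof (intro ballI allI impI)
    fix x y w assume a: "x \<in> S" "y \<in> S" "x \<le> w \<and> w \<le> y"
    then have "w \<in> S \<union> S'" using sum.prems unfolding order_convex_def by blast
    then show "w \<in> S" using sum.hyps(3)[of y w] a by force
  qed
  moreover have "order_convex S'" unfolding order_convex_def
  proof (intro ballI allI impI)
    fix x y w assume a: "x \<in> S'" "y \<in> S'" "x \<le> w \<and> w \<le> y"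
    then have "w \<in> S \<union> S'" using sum.prems unfolding order_convex_def by blast
    then show "w \<in> S'" using sum.hyps(3)[of w x] a by force
  qed
  ultimately show ?case using sum.IH by (simp add: image_Un)
next
  case (left S \<alpha>)
  have one: "(x, y) \<in> fc_sim \<alpha>" if xy: "x \<in> S" "y \<in> S" "x \<le> y" for x y
  proof -
    have c: "order_convex {z \<in> S. z \<le> y}" using left.prems by (auto simp: order_convex_def)
    obtain \<beta> where "\<beta> \<sqsubset> \<alpha> \<and> vd (\<le>) \<beta> {z \<in> S. z \<le> y} \<and> (order_convex {z \<in> S. z \<le> y} \<longrightarrow> finite ((\<lambda>z. fc_sim \<beta> `` {z}) ` {z \<in> S. z \<le> y}))"
      using left.IH[OF xy(2)] by (elim exE)
    with c have b: "\<beta> \<sqsubset> \<alpha>" and f: "finite ((\<lambda>z. fc_sim \<beta> `` {z}) ` {z \<in> S. z \<le> y})"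
      by blast+
    have "(\<lambda>z. fc_sim \<beta> `` {z}) ` {min x y..max x y} \<subseteq> (\<lambda>z. fc_sim \<beta> `` {z}) ` {z \<in> S. z \<le> y}"
    proof (intro image_mono subsetI)
      fix w assume "w \<in> {min x y..max x y}"
      then have w: "x \<le> w" "w \<le> y" using xy(3) by (simp_all add: min_def max_def)
      then have "w \<in> S" using left.prems xy(1,2) unfolding order_convex_def by blast
      then show "w \<in> {z \<in> S. z \<le> y}" using w by simp
    qed
    then have "(x, y) \<in> fc_step (fc_sim \<beta>)" unfolding fc_step_iff[OF convex_equiv_fc_sim] using f by (rule finite_subset)
    moreover have "\<beta> \<noteq> []" using b by auto
    ultimately have "(x, y) \<in> fc_sim (osuc \<beta>)" using fc_sim_osuc by blast
    then show ?thesis using fc_sim_mono[OF osuc_ole[OF b]] by blast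
  qed
  show ?case by (rule finite_classes_if_one[OF one])
next
  case (right S \<alpha>)
  have one: "(x, y) \<in> fc_sim \<alpha>" if xy: "x \<in> S" "y \<in> S" "x \<le> y" for x y
  proof -
    have c: "order_convex {z \<in> S. x \<le> z}" using right.prems by (auto simp: order_convex_def)
    obtain \<beta> where "\<beta> \<sqsubset> \<alpha> \<and> vd (\<le>) \<beta> {z \<in> S. x \<le> z} \<and> (order_convex {z \<in> S. x \<le> z} \<longrightarrow> finite ((\<lambda>z. fc_sim \<beta> `` {z}) ` {z \<in> S. x \<le> z}))"
      using right.IH[OF xy(1)] by (elim exE)
    with c have b: "\<beta> \<sqsubset> \<alpha>" and f: "finite ((\<lambda>z. fc_sim \<beta> `` {z}) ` {z \<in> S. x \<le> z})"
      by blast+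
    have "(\<lambda>z. fc_sim \<beta> `` {z}) ` {min x y..max x y} \<subseteq> (\<lambda>z. fc_sim \<beta> `` {z}) ` {z \<in> S. x \<le> z}"
    proof (intro image_mono subsetI)
      fix w assume "w \<in> {min x y..max x y}"
      then have w: "x \<le> w" "w \<le> y" using xy(3) by (simp_all add: min_def max_def)
      then have "w \<in> S" using right.prems xy(1,2) unfolding order_convex_def by blast
      then show "w \<in> {z \<in> S. x \<le> z}" using w by simp
    qed
    then have "(x, y) \<in> fc_step (fc_sim \<beta>)" unfolding fc_step_iff[OF convex_equiv_fc_sim] using f by (rule finite_subset)
    moreover have "\<beta> \<noteq> []" using b by auto
    ultimately have "(x, y) \<in> fc_sim (osuc \<beta>)" using fc_sim_osuc by blast
    then show ?thesis using fc_sim_mono[OF osuc_ole[OF b]] by blast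
  qed
  show ?case by (rule finite_classes_if_one[OF one])
qed simp

text \<open>Rank \<alpha> only makes the number of \<open>\<sim>\<^sub>\<alpha>\<close>-classes in
  the interval finite; one more condensation merges them. This direction therefore costs a
  successor.\<close>

lemma vd_imp_fc_sim:
  assumes "vd (\<le>) \<alpha> {x..y :: 'a::linorder}" "\<alpha> \<noteq> []" "x \<le> y"
  shows "(x, y) \<in> fc_sim (osuc \<alpha>)"
proof -
  have "order_convex {x..y}" by (auto simp: order_convex_def)
  from vd_imp_finite_classes[OF assms(1) this] have "(x, y) \<in> fc_step (fc_sim \<alpha>)"
    unfolding fc_step_iff[OF convex_equiv_fc_sim] using assms(3) by (simp add: min_def max_def)
  then show ?thesis using fc_sim_osuc assms(2) by blast
qed

text \<open>Only pairs that become equivalent at some stage have to be considered, and their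
  intervals have a rank. The strict bound \<gamma> \<sqsubset> \<alpha> leaves room for the
  successor lost in passing from ranks back to condensations.\<close>

lemma FC_less_omega_powI:
  assumes k: "length \<alpha> = k"
    and small: "\<And>(x :: 'a::linorder) y \<beta>. x \<le> y \<Longrightarrow> length \<beta> = k \<Longrightarrow> vd (\<le>) \<beta> {x..y} \<Longrightarrow> \<exists>\<gamma>. \<gamma> \<sqsubset> \<alpha> \<and> vd (\<le>) \<gamma> {x..y}"
  shows "FC_less_omega_pow TYPE('a) k"
  unfolding FC_less_omega_pow_def
proof (intro exI[of _ \<alpha>] conjI allI impI k)
  fix \<beta> assume b: "length \<beta> = k \<and> \<alpha> \<sqsubset> \<beta>"
  have *: "(x, y) \<in> fc_sim \<alpha>" if xy: "(x, y) \<in> fc_sim \<beta>" "x \<le> y" for x y :: 'a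
  proof -
    obtain \<gamma> where g: "\<gamma> \<sqsubset> \<alpha>" "vd (\<le>) \<gamma> {x..y}"
      using small[OF xy(2) _ fc_sim_imp_vd[OF xy(1)]] b by blast
    then have "\<gamma> \<noteq> []" by auto
    then show ?thesis using vd_imp_fc_sim[OF g(2) _ xy(2)] fc_sim_mono[OF osuc_ole[OF g(1)]] by blast
  qed
  have "(x, y) \<in> fc_sim \<alpha>" if xy: "(x, y) \<in> fc_sim \<beta>" for x y :: 'a
    using *[of x y] *[of y x] xy convex_equivD(2)[OF convex_equiv_fc_sim] linear by blast
  moreover have "fc_sim \<alpha> \<subseteq> (fc_sim \<beta> :: 'a rel)" using b by (intro fc_sim_mono) (simp add: ole_def)
  ultimately show "(fc_sim \<beta> :: 'a rel) = fc_sim \<alpha>" by auto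
qed

section \<open>Branches and derivatives\<close>

definition prefix_closed :: "bool list set \<Rightarrow> bool" where
  "prefix_closed X \<longleftrightarrow> (\<forall>u\<in>X. \<forall>v. prefix v u \<longrightarrow> v \<in> X)"

definition branches :: "bool list set \<Rightarrow> bool list set set" where
  "branches X = {B. is_branch X B}"

definition residual :: "bool list \<Rightarrow> bool list set \<Rightarrow> bool list set" where
  "residual u X = {v. u @ v \<in> X}"

lemma prefix_closedD: "prefix_closed X \<Longrightarrow> u \<in> X \<Longrightarrow> prefix v u \<Longrightarrow> v \<in> X"
  by (auto simp: prefix_closed_def)

lemma prefix_closed_res: "prefix_closed X \<Longrightarrow> prefix_closed (residual u X)"
  by (auto simp: prefix_closed_def residual_def)

lemma residual_Nil [simp]: "residual [] X = X"
  by (simp add: residual_def)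

lemma residual_append: "residual (u @ v) X = residual v (residual u X)"
  by (simp add: residual_def)

lemma branchD:
  assumes "is_branch X B"
  shows "B \<subseteq> X" "infinite B" "u \<in> B \<Longrightarrow> prefix v u \<Longrightarrow> v \<in> B" "u \<in> B \<Longrightarrow> v \<in> B \<Longrightarrow> prefix u v \<or> prefix v u"
  using assms by (auto simp: is_branch_def)

lemma branch_length:
  assumes "is_branch X B"
  shows "\<exists>w\<in>B. length w = n"
proof -
  have "finite {w :: bool list. length w \<le> n}" using finite_lists_length_le[of "UNIV :: bool set"] by simp
  then obtain w where w: "w \<in> B" "n < length w"
    using branchD(2)[OF assms] by (metis (mono_tags, lifting) finite_subset linorder_not_le mem_Collect_eq subsetI)
  then have "take n w \<in> B" using branchD(3)[OF assms, of w "take n w"] by (simp add: take_is_prefix)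
  then show ?thesis using w by (intro bexI[of _ "take n w"]) auto
qed

lemma branch_Nil: "is_branch X B \<Longrightarrow> [] \<in> B"
  using branch_length[of X B 0] by auto

lemma branch_mono: "X \<subseteq> Y \<Longrightarrow> is_branch X B \<Longrightarrow> is_branch Y B"
  by (auto simp: is_branch_def)

lemma deriv_mono: "X \<subseteq> Y \<Longrightarrow> tree_deriv X \<subseteq> tree_deriv Y"
  unfolding tree_deriv_def using branch_mono by blast

lemma deriv_subset: "tree_deriv X \<subseteq> X"
  by (auto simp: tree_deriv_def)

lemma derivn_mono: "X \<subseteq> Y \<Longrightarrow> (tree_deriv ^^ n) X \<subseteq> (tree_deriv ^^ n) Y"
  by (induction n) (auto dest: deriv_mono)

lemma derivn_finite_le:
  assumes "finite ((tree_deriv ^^ m) X)" "m \<le> n"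
  shows "finite ((tree_deriv ^^ n) X)"
  using assms(2) by (induction rule: dec_induct) (auto simp: assms(1) intro: finite_subset[OF deriv_subset])

lemma prefix_closed_deriv: "prefix_closed X \<Longrightarrow> prefix_closed (tree_deriv X)"
  unfolding prefix_closed_def tree_deriv_def using branchD(3) by blast

lemma prefix_closed_derivn: "prefix_closed X \<Longrightarrow> prefix_closed ((tree_deriv ^^ n) X)"
  by (induction n) (auto intro: prefix_closed_deriv)

text \<open>On a level that avoids the finite derivative, every node lies on at most one branch.\<close>
lemma finite_branches:
  assumes "finite (tree_deriv X)"
  shows "finite (branches X)"
proof -
  obtain n where n: "\<forall>w\<in>tree_deriv X. length w < n"
    using finite_maxlen[OF assms] by (elim exE)
  define f where "f B = (SOME w. w \<in> B \<and> length w = n)" for B :: "bool list set"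
  have f: "f B \<in> B \<and> length (f B) = n" if "is_branch X B" for B
    unfolding f_def using branch_length[OF that, of n] by (rule_tac someI_ex[of "\<lambda>w. w \<in> B \<and> length w = n"]) blast
  have "inj_on f (branches X)"
  proof (rule inj_onI, rule ccontr)
    fix B B' assume a: "B \<in> branches X" "B' \<in> branches X" "f B = f B'" "B \<noteq> B'"
    then have "f B \<in> tree_deriv X"
      using f[of B] f[of B'] branchD(1)[of X B] by (auto simp: branches_def tree_deriv_def)
    then show False using n f a by (auto simp: branches_def)
  qed
  moreover have "f ` branches X \<subseteq> {w. length w = n}" using f by (auto simp: branches_def)
  moreover have "finite {w :: bool list. length w = n}" using finite_lists_length_eq[of "UNIV :: bool set"] by simp
  ultimately show ?thesis by (meson finite_imageD finite_subset)
qed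

lemma koenig:
  assumes X: "prefix_closed X" and "infinite X"
  shows "branches X \<noteq> {}"
proof -
  define P where "P u \<longleftrightarrow> infinite {v \<in> X. prefix u v}" for u
  have step: "\<exists>b. P (u @ [b])" if "P u" for u
  proof (rule ccontr)
    assume "\<not> ?thesis"
    then have "finite ({u} \<union> {v \<in> X. prefix (u @ [False]) v} \<union> {v \<in> X. prefix (u @ [True]) v})"
      by (auto simp: P_def)
    moreover have "{v \<in> X. prefix u v} \<subseteq> {u} \<union> {v \<in> X. prefix (u @ [False]) v} \<union> {v \<in> X. prefix (u @ [True]) v}"
    proof
      fix v assume v: "v \<in> {v \<in> X. prefix u v}"
      then obtain w where w: "v = u @ w" by (auto simp: prefix_def)
      show "v \<in> {u} \<union> {v \<in> X. prefix (u @ [False]) v} \<union> {v \<in> X. prefix (u @ [True]) v}"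
      proof (cases w)
        case (Cons b w')
        then show ?thesis using v w by (cases b) auto
      qed (use w in simp)
    qed
    ultimately show False using that finite_subset by (auto simp: P_def)
  qed
  have "\<exists>g. \<forall>n. (P (g n) \<and> length (g n) = n) \<and> prefix (g n) (g (Suc n))"
  proof (rule dependent_nat_choice)
    show "\<exists>u. P u \<and> length u = 0" using assms(2) by (intro exI[of _ "[]"]) (simp add: P_def)
    show "\<exists>v. (P v \<and> length v = Suc n) \<and> prefix u v" if u: "P u \<and> length u = n" for u n
    proof -
      obtain b where "P (u @ [b])" using step u by blast
      then show ?thesis using u by (intro exI[of _ "u @ [b]"]) simp
    qed
  qed
  then obtain g where g: "\<And>n. P (g n)" "\<And>n. length (g n) = n" "\<And>n. prefix (g n) (g (Suc n))"
    by blast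
  have gm: "prefix (g m) (g n)" if "m \<le> n" for m n
    using that by (induction rule: dec_induct) (auto intro: prefix_order.trans g(3))
  have gX: "g n \<in> X" for n
  proof -
    have "{v \<in> X. prefix (g n) v} \<noteq> {}" using g(1)[of n] unfolding P_def by (metis finite.emptyI)
    then show ?thesis using prefix_closedD[OF X] by blast
  qed
  have "is_branch X (range g)"
    unfolding is_branch_def
  proof (intro conjI ballI allI impI)
    show "range g \<subseteq> X" using gX by blast
    have "inj g" by (rule injI) (metis g(2))
    then show "infinite (range g)" using finite_imageD infinite_UNIV_nat by blast
    show "v \<in> range g" if u: "u \<in> range g" "prefix v u" for u v
    proof -
      obtain n where n: "u = g n" using u by blast
      have "length v \<le> n" using prefix_length_le[OF u(2)] n g(2) by simp
      then have "prefix (g (length v)) u" using gm n by blast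
      then have "v = g (length v)" using u(2) g(2) by (metis prefix_length_prefix prefix_order.antisym order_refl)
      then show ?thesis by blast
    qed
    show "prefix u v \<or> prefix v u" if "u \<in> range g" "v \<in> range g" for u v
      using that gm nat_le_linear by blast
  qed
  then show ?thesis by (auto simp: branches_def)
qed

section \<open>Branches and derivatives of residuals\<close>

definition lift_branch :: "bool \<Rightarrow> bool list set \<Rightarrow> bool list set" where
  "lift_branch b B = insert [] ((#) b ` B)"

lemma residual_lift: "residual [b] (lift_branch b B) = B"
  by (auto simp: residual_def lift_branch_def)

lemma branch_lift:
  assumes X: "prefix_closed X" and B: "is_branch (residual [b] X) B"
  shows "is_branch X (lift_branch b B)"
  unfolding is_branch_def
proof (intro conjI ballI allI impI)
  have "[b] \<in> X" using branch_Nil[OF B] branchD(1)[OF B] by (auto simp: residual_def)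
  then have "[] \<in> X" using prefix_closedD[OF X] by simp
  then show "lift_branch b B \<subseteq> X" using branchD(1)[OF B] by (auto simp: lift_branch_def residual_def)
  show "infinite (lift_branch b B)" using branchD(2)[OF B] by (auto simp: lift_branch_def dest: finite_imageD)
  show "v \<in> lift_branch b B" if "u \<in> lift_branch b B" "prefix v u" for u v
    using that branchD(3)[OF B] by (cases v) (auto simp: lift_branch_def)
  show "prefix u v \<or> prefix v u" if "u \<in> lift_branch b B" "v \<in> lift_branch b B" for u v
    using that unfolding lift_branch_def
    by (elim insertE imageE) (use branchD(4)[OF B] in \<open>(simp; fail | simp, blast)+\<close>)
qed

lemma branch_res:
  assumes B: "is_branch X B" "b # v \<in> B"
  shows "is_branch (residual [b] X) (residual [b] B)"
proof -
  have b: "[b] \<in> B" using branchD(3)[OF B(1,2), of "[b]"] by simp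
  have "B \<subseteq> lift_branch b (residual [b] B)"
  proof
    fix u assume u: "u \<in> B"
    show "u \<in> lift_branch b (residual [b] B)"
    proof (cases u)
      case (Cons c w)
      then show ?thesis using branchD(4)[OF B(1) u b] u by (auto simp: lift_branch_def residual_def)
    qed (simp add: lift_branch_def)
  qed
  then have "infinite (lift_branch b (residual [b] B))" using branchD(2)[OF B(1)] finite_subset by blast
  then have "infinite (residual [b] B)" by (auto simp: lift_branch_def)
  then show ?thesis
    using branchD(1,3,4)[OF B(1)] unfolding is_branch_def residual_def by fastforce
qed

text \<open>Adding and removing the first letter b are inverse bijections between the branches of X
  through b # w and the branches of the residual through w.\<close>

lemma deriv_res:
  assumes X: "prefix_closed X"
  shows "tree_deriv (residual [b] X) = residual [b] (tree_deriv X)"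
proof
  show "tree_deriv (residual [b] X) \<subseteq> residual [b] (tree_deriv X)"
  proof
    fix w assume "w \<in> tree_deriv (residual [b] X)"
    then obtain B1 B2 where B: "is_branch (residual [b] X) B1" "is_branch (residual [b] X) B2" "B1 \<noteq> B2" "w \<in> B1" "w \<in> B2" "b # w \<in> X"
      by (auto simp: tree_deriv_def residual_def)
    have "lift_branch b B1 \<noteq> lift_branch b B2" using B(3) residual_lift by metis
    moreover have "b # w \<in> lift_branch b B1" "b # w \<in> lift_branch b B2" using B by (auto simp: lift_branch_def)
    ultimately show "w \<in> residual [b] (tree_deriv X)"
      using branch_lift[OF X B(1)] branch_lift[OF X B(2)] B(6) by (auto simp: tree_deriv_def residual_def)
  qed
  show "residual [b] (tree_deriv X) \<subseteq> tree_deriv (residual [b] X)"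
  proof
    fix w assume "w \<in> residual [b] (tree_deriv X)"
    then obtain B1 B2 where B: "is_branch X B1" "is_branch X B2" "B1 \<noteq> B2" "b # w \<in> B1" "b # w \<in> B2" "b # w \<in> X"
      by (auto simp: tree_deriv_def residual_def)
    have eq: "B = lift_branch b (residual [b] B)" if Bx: "is_branch X B" "b # w \<in> B" for B
    proof (rule set_eqI)
      fix u
      have b: "[b] \<in> B" using branchD(3)[OF Bx, of "[b]"] by simp
      show "u \<in> B \<longleftrightarrow> u \<in> lift_branch b (residual [b] B)"
      proof (cases u)
        case (Cons c v)
        then show ?thesis using branchD(4)[OF Bx(1) _ b, of u] by (auto simp: lift_branch_def residual_def)
      qed (use branch_Nil[OF Bx(1)] in \<open>simp add: lift_branch_def\<close>)
    qed
    have "residual [b] B1 \<noteq> residual [b] B2" using eq[OF B(1,4)] eq[OF B(2,5)] B(3) by metis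
    moreover have "w \<in> residual [b] B1" "w \<in> residual [b] B2" "w \<in> residual [b] X" using B by (auto simp: residual_def)
    ultimately show "w \<in> tree_deriv (residual [b] X)"
      using branch_res[OF B(1,4)] branch_res[OF B(2,5)] unfolding tree_deriv_def by blast
  qed
qed

lemma derivn_res1: "prefix_closed X \<Longrightarrow> (tree_deriv ^^ n) (residual [b] X) = residual [b] ((tree_deriv ^^ n) X)"
  by (induction n) (auto simp: deriv_res[OF prefix_closed_derivn])

lemma derivn_res: "prefix_closed X \<Longrightarrow> (tree_deriv ^^ n) (residual u X) = residual u ((tree_deriv ^^ n) X)"
proof (induction u arbitrary: X)
  case (Cons b u)
  have "residual (b # u) Y = residual u (residual [b] Y)" for Y using residual_append[of "[b]" u Y] by simp
  then show ?case using Cons.IH[OF prefix_closed_res[OF Cons.prems]] derivn_res1[OF Cons.prems] by simp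
qed simp

text \<open>Branches of the two residuals lift to branches through [False] and through [True], which
  never coincide. This additivity keeps the total cost of all boxes proportional to the number of
  branches at the root.\<close>

lemma card_branches_res:
  assumes X: "prefix_closed X" and fin: "finite (branches X)"
  shows "finite (branches (residual [b] X))"
    and "card (branches (residual [False] X)) + card (branches (residual [True] X)) \<le> card (branches X)"
proof -
  have sub: "lift_branch b ` branches (residual [b] X) \<subseteq> branches X" for b
    using branch_lift[OF X] by (auto simp: branches_def)
  have inj: "inj_on (lift_branch b) (branches (residual [b] X))" for b
    by (rule inj_onI) (metis residual_lift)
  have fin': "finite (branches (residual [b] X))" for b
    using finite_imageD[OF finite_subset[OF sub fin] inj] .
  then show "finite (branches (residual [b] X))" .
  have disj: "lift_branch False ` branches (residual [False] X) \<inter> lift_branch True ` branches (residual [True] X) = {}"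
  proof (rule equals0I)
    fix C assume "C \<in> lift_branch False ` branches (residual [False] X) \<inter> lift_branch True ` branches (residual [True] X)"
    then obtain B B' where C: "C = lift_branch False B" "B \<in> branches (residual [False] X)" "C = lift_branch True B'" by blast
    have "[] \<in> B" using C(2) branch_Nil by (auto simp: branches_def)
    then have "[False] \<in> C" by (simp add: C(1) lift_branch_def)
    then show False by (auto simp: C(3) lift_branch_def)
  qed
  have "card (branches (residual [False] X)) + card (branches (residual [True] X))
      = card (lift_branch False ` branches (residual [False] X) \<union> lift_branch True ` branches (residual [True] X))"
    using disj fin' by (subst card_Un_disjoint) (auto simp: card_image[OF inj])
  also have "\<dots> \<le> card (branches X)" using sub by (intro card_mono fin) blast
  finally show "card (branches (residual [False] X)) + card (branches (residual [True] X)) \<le> card (branches X)" .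
qed

text \<open>If all derivatives are infinite then, as there are finitely many residuals, the nodes whose
  residual never becomes finite form a set in which every node has two incomparable extensions.\<close>
lemma Tbin_free_deriv_finite:
  assumes T: "prefix_closed T" and reg: "finite (range (\<lambda>u. residual u T))" and free: "Tbin_free T"
  shows "\<exists>n. finite ((tree_deriv ^^ n) T)"
proof (rule ccontr)
  assume never: "\<nexists>n. finite ((tree_deriv ^^ n) T)"
  have "\<exists>n0. \<forall>Y\<in>F. (\<exists>n. finite ((tree_deriv ^^ n) Y)) \<longrightarrow> finite ((tree_deriv ^^ n0) Y)"
    if "finite F" for F
    using that
  proof (induction rule: finite_induct)
    case (insert Y F)
    then obtain n0 where n0: "\<forall>Y\<in>F. (\<exists>n. finite ((tree_deriv ^^ n) Y)) \<longrightarrow> finite ((tree_deriv ^^ n0) Y)" by blast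
    show ?case
    proof (cases "\<exists>n. finite ((tree_deriv ^^ n) Y)")
      case True
      then obtain n where "finite ((tree_deriv ^^ n) Y)" by blast
      then have "finite ((tree_deriv ^^ max n n0) Y)" by (rule derivn_finite_le) simp
      moreover have "finite ((tree_deriv ^^ max n n0) Z)" if "finite ((tree_deriv ^^ n0) Z)" for Z
        using that by (rule derivn_finite_le) simp
      ultimately show ?thesis using n0 by (intro exI[of _ "max n n0"]) blast
    qed (use n0 in blast)
  qed simp
  from this[OF reg] obtain n0 where
    n0: "\<And>u n. finite ((tree_deriv ^^ n) (residual u T)) \<Longrightarrow> finite ((tree_deriv ^^ n0) (residual u T))" by blast
  define good where "good u \<longleftrightarrow> infinite ((tree_deriv ^^ n0) (residual u T))" for u
  have split: "\<exists>v w. \<not> prefix v w \<and> \<not> prefix w v \<and> good (u @ v) \<and> good (u @ w)" if u: "good u" for u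
  proof -
    let ?X = "(tree_deriv ^^ n0) (residual u T)"
    \<comment> \<open>The stage n0 is one by which every residual that ever becomes finite has done
      so. A residual still infinite there stays infinite, so a further derivative is nonempty and
      provides two branches.\<close>
    have "infinite ((tree_deriv ^^ Suc n0) (residual u T))" using u n0 unfolding good_def by blast
    then obtain x where "x \<in> tree_deriv ?X" by (metis finite.emptyI all_not_in_conv funpow.simps(2) comp_apply)
    then obtain B1 B2 where B: "is_branch ?X B1" "is_branch ?X B2" "B1 \<noteq> B2" by (auto simp: tree_deriv_def)
    have gd: "good (u @ v)" if Bv: "is_branch ?X B" "v \<in> B" for B v
    proof -
      have eq: "(tree_deriv ^^ n0) (residual (u @ v) T) = residual v ?X"
        using derivn_res[OF prefix_closed_res[OF T]] by (simp add: residual_append)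
      have "B \<subseteq> {w. length w \<le> length v} \<union> (@) v ` residual v ?X"
      proof
        fix w assume w: "w \<in> B"
        show "w \<in> {w. length w \<le> length v} \<union> (@) v ` residual v ?X"
        proof (cases "prefix v w")
          case True
          then show ?thesis using w branchD(1)[OF Bv(1)] by (auto simp: prefix_def residual_def)
        next
          case False
          then show ?thesis using branchD(4)[OF Bv(1) w Bv(2)] prefix_length_le by auto
        qed
      qed
      moreover have "finite {w :: bool list. length w \<le> length v}" using finite_lists_length_le[of "UNIV :: bool set"] by simp
      ultimately have "infinite (residual v ?X)" using branchD(2)[OF Bv(1)] by (metis finite_UnI finite_imageI finite_subset)
      then show ?thesis unfolding good_def eq .
    qed
    \<comment> \<open>Two branches whose nodes are pairwise comparable have the same node on each
      level. Distinct branches thus contain incomparable nodes, both good by the previous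
      step.\<close>
    have incl: "B = B'" if "is_branch ?X B" "is_branch ?X B'" "\<forall>v\<in>B. \<forall>w\<in>B'. prefix v w \<or> prefix w v" for B B'
    proof -
      have "v \<in> B'" if v: "v \<in> B" and BB: "is_branch ?X B'" "\<forall>w\<in>B'. prefix v w \<or> prefix w v" for v B'
      proof -
        obtain w where w: "w \<in> B'" "length w = length v" using branch_length[OF BB(1)] by blast
        then have "v = w" using BB(2) by (metis prefix_order.eq_iff not_equal_is_parallel parallel_def)
        then show ?thesis using w by simp
      qed
      moreover have "v \<in> B" if v: "v \<in> B'" for v
      proof -
        obtain w where w: "w \<in> B" "length w = length v" using branch_length[OF \<open>is_branch ?X B\<close>] by blast
        then have "v = w" using \<open>\<forall>v\<in>B. \<forall>w\<in>B'. prefix v w \<or> prefix w v\<close> v by (metis not_equal_is_parallel parallel_def)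
        then show ?thesis using w by simp
      qed
      ultimately show ?thesis using that by blast
    qed
    then show ?thesis using B gd by metis
  qed
  then obtain f0 f1 where f: "\<And>u. good u \<Longrightarrow> \<not> prefix (f0 u) (f1 u) \<and> \<not> prefix (f1 u) (f0 u) \<and> good (u @ f0 u) \<and> good (u @ f1 u)"
    by metis
  define st where "st u b = u @ (if b then f1 u else f0 u)" for u :: "bool list" and b
  \<comment> \<open>The word w is followed letter by letter, each time extending the node reached so
    far by one of its two incomparable good extensions.\<close>
  define F where "F w = foldl st [] w" for w
  have Fsnoc: "F (w @ [b]) = F w @ (if b then f1 (F w) else f0 (F w))" for w b by (simp add: F_def st_def)
  have gF: "good (F w)" for w
  proof (induction w rule: rev_induct)
    case Nil
    then show ?case using never by (simp add: F_def good_def)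
  next
    case (snoc b w)
    then show ?case using f[OF snoc] by (simp add: Fsnoc)
  qed
  have FT: "F w \<in> T" for w
  proof -
    have "(tree_deriv ^^ n0) (residual (F w) T) \<subseteq> residual (F w) T"
      by (induction n0) (use deriv_subset in auto)
    then have "residual (F w) T \<noteq> {}" using gF[of w] unfolding good_def by auto
    then show ?thesis using prefix_closedD[OF T] by (auto simp: residual_def)
  qed
  have Fmono: "prefix (F u) (F (u @ v))" for u v
    by (induction v rule: rev_induct) (auto simp: Fsnoc simp flip: append_assoc intro: prefix_order.trans)
  have ne: "f0 (F w) \<noteq> []" "f1 (F w) \<noteq> []" for w using f[OF gF[of w]] by auto
  have Fstrict: "length (F u) < length (F (u @ b # v))" for u b v
  proof -
    have "prefix (F (u @ [b])) (F (u @ b # v))" using Fmono[of "u @ [b]" v] by simp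
    then have "length (F (u @ [b])) \<le> length (F (u @ b # v))" by (rule prefix_length_le)
    moreover have "0 < length (f0 (F u))" "0 < length (f1 (F u))" using ne by simp_all
    ultimately show ?thesis by (cases b) (simp_all add: Fsnoc del: length_greater_0_conv)
  qed
  have "prefix u v \<longleftrightarrow> prefix (F u) (F v)" for u v
  proof
    assume "prefix u v"
    then show "prefix (F u) (F v)" using Fmono by (auto simp: prefix_def)
  next
    assume p: "prefix (F u) (F v)"
    show "prefix u v"
    proof (rule ccontr)
      assume n: "\<not> prefix u v"
      show False
      proof (cases "prefix v u")
        case True
        then obtain w where w: "u = v @ w" by (auto simp: prefix_def)
        with n obtain b w' where "w = b # w'" by (cases w) auto
        then show False using Fstrict[of v b w'] w prefix_length_le[OF p] by simp
      next
        case False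
        then have "u \<parallel> v" using n by (intro parallelI)
        from parallel_decomp[OF this] obtain c b us b' vs where d: "b \<noteq> b'" "u = c @ b # us" "v = c @ b' # vs"
          by (elim exE conjE) (rule that)
        have "prefix (F (c @ [b])) (F u)" "prefix (F (c @ [b'])) (F v)"
          using Fmono[of "c @ [b]" us] Fmono[of "c @ [b']" vs] d by auto
        then have "prefix (F (c @ [b])) (F (c @ [b'])) \<or> prefix (F (c @ [b'])) (F (c @ [b]))"
          using p by (meson prefix_order.trans prefix_same_cases)
        then show False using d(1) f[OF gF[of c]] by (auto simp: Fsnoc split: if_splits)
      qed
    qed
  qed
  then show False using free FT unfolding Tbin_free_def by blast
qed

section \<open>Trees as a datatype\<close>

text \<open>\<open>Tip\<close> is the empty tree and also stands for an absent child, which makes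
  structural recursion on trees and on pairs of trees possible. Countability of the type is what
  boxes of subtrees require.\<close>

datatype 's btree = Tip | Node 's "'s btree" "'s btree"

instance btree :: (countable) countable
  by countable_datatype

primrec stree_of :: "'s btree \<Rightarrow> 's stree" where
  "stree_of Tip = (\<lambda>_. None)"
| "stree_of (Node a l r) = (\<lambda>w. case w of [] \<Rightarrow> Some a | b # v \<Rightarrow> if b then stree_of r v else stree_of l v)"

primrec nodes :: "'s btree \<Rightarrow> bool list set" where
  "nodes Tip = {}"
| "nodes (Node a l r) = insert [] ((#) False ` nodes l \<union> (#) True ` nodes r)"

lemma dom_stree_of: "dom (stree_of t) = nodes t"
proof (induction t)
  case (Node a l r)
  show ?case
  proof (rule set_eqI)
    fix w show "w \<in> dom (stree_of (Node a l r)) \<longleftrightarrow> w \<in> nodes (Node a l r)"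
      using Node by (cases w) (auto simp: domIff set_eq_iff)
  qed
qed simp

lemma stree_of_Node_eq:
  "stree_of (Node a l r) [] = Some a" "stree_of (Node a l r) (False # v) = stree_of l v"
  "stree_of (Node a l r) (True # v) = stree_of r v"
  by simp_all

lemma stree_of_inject: "stree_of s = stree_of t \<Longrightarrow> s = t"
proof (induction s arbitrary: t)
  case Tip
  show ?case
  proof (cases t)
    case (Node a l r)
    then show ?thesis using fun_cong[OF Tip, of "[]"] by simp
  qed simp
next
  case (Node a l r)
  show ?case
  proof (cases t)
    case Tip
    then show ?thesis using fun_cong[OF Node.prems, of "[]"] by simp
  next
    case t: (Node a' l' r')
    have "stree_of l = stree_of l'"
    proof
      fix v show "stree_of l v = stree_of l' v" using fun_cong[OF Node.prems, of "False # v"] t by simp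
    qed
    moreover have "stree_of r = stree_of r'"
    proof
      fix v show "stree_of r v = stree_of r' v" using fun_cong[OF Node.prems, of "True # v"] t by simp
    qed
    ultimately show ?thesis using Node.IH fun_cong[OF Node.prems, of "[]"] t by simp
  qed
qed

lemma finite_nodes: "finite (nodes t)"
  by (induction t) auto

lemma nodes_prefix: "u \<in> nodes t \<Longrightarrow> prefix v u \<Longrightarrow> v \<in> nodes t"
proof (induction t arbitrary: u v)
  case (Node a l r)
  then show ?case by (cases v) auto
qed simp

lemma is_tree_stree_of: "is_tree (stree_of t)"
  unfolding is_tree_def dom_stree_of using finite_nodes nodes_prefix by blast

text \<open>Shifting by a letter b loses the root, so both subtrees have a smaller domain.\<close>

lemma is_tree_obtain: "is_tree t \<Longrightarrow> \<exists>s. t = stree_of s"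
proof (induction "card (dom t)" arbitrary: t rule: less_induct)
  case (less t)
  have fin: "finite (dom t)" and pre: "\<And>u v. u \<in> dom t \<Longrightarrow> prefix v u \<Longrightarrow> v \<in> dom t"
    using less.prems unfolding is_tree_def by blast+
  show ?case
  proof (cases "t []")
    case None
    then have "t w = None" for w using pre[of w "[]"] by (cases "t w") (auto simp: domIff)
    then have "t = stree_of Tip" by (simp add: fun_eq_iff)
    then show ?thesis by blast
  next
    case (Some a)
    have sub: "\<exists>s. (\<lambda>v. t (b # v)) = stree_of s" for b
    proof (rule less.hyps)
      let ?t = "\<lambda>v. t (b # v)"
      have "(#) b ` dom ?t \<subseteq> dom t - {[]}" by auto
      then have "card ((#) b ` dom ?t) \<le> card (dom t - {[]})" using fin by (intro card_mono) auto
      moreover have "card (dom t - {[]}) < card (dom t)"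
        using Some fin by (intro card_Diff1_less) auto
      moreover have "card ((#) b ` dom ?t) = card (dom ?t)" by (intro card_image) auto
      ultimately show "card (dom ?t) < card (dom t)" by simp
      have "finite ((#) b ` dom ?t)" using \<open>(#) b ` dom ?t \<subseteq> dom t - {[]}\<close> fin by (meson finite_Diff finite_subset)
      then have "finite (dom ?t)" by (rule finite_imageD) simp
      moreover have "v \<in> dom ?t" if "u \<in> dom ?t" "prefix v u" for u v
        using pre[of "b # u" "b # v"] that by auto
      ultimately show "is_tree ?t" by (auto simp: is_tree_def)
    qed
    obtain l where l: "(\<lambda>v. t (False # v)) = stree_of l" using sub by blast
    obtain r where r: "(\<lambda>v. t (True # v)) = stree_of r" using sub by blast
    have "t w = stree_of (Node a l r) w" for w
      using Some fun_cong[OF l] fun_cong[OF r] by (cases w) auto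
    then show ?thesis by (intro exI[of _ "Node a l r"]) blast
  qed
qed

section \<open>Automata evaluated by structural recursion\<close>

primrec eval :: "('s, 'q) tree_aut \<Rightarrow> 's btree \<Rightarrow> 'q" where
  "eval M Tip = t_init M"
| "eval M (Node a l r) = t_delta M a (eval M l) (eval M r)"

primrec run_of :: "('s, 'q) tree_aut \<Rightarrow> 's btree \<Rightarrow> bool list \<Rightarrow> 'q" where
  "run_of M Tip = (\<lambda>_. t_init M)"
| "run_of M (Node a l r) = (\<lambda>w. case w of [] \<Rightarrow> eval M (Node a l r) | b # v \<Rightarrow> if b then run_of M r v else run_of M l v)"

lemma run_state_Node:
  "run_state M (stree_of (Node a l r)) \<rho> (b # w) = run_state M (stree_of (if b then r else l)) (\<lambda>v. \<rho> (b # v)) w"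
  by (auto simp: run_state_def dom_def)

lemma is_run_unique: "is_run M (stree_of t) \<rho> \<Longrightarrow> run_state M (stree_of t) \<rho> [] = eval M t"
proof (induction t arbitrary: \<rho>)
  case (Node a l r)
  have run: "is_run M (stree_of (if b then r else l)) (\<lambda>v. \<rho> (b # v))" for b
    unfolding is_run_def
  proof
    fix w assume w: "w \<in> dom (stree_of (if b then r else l))"
    then have "b # w \<in> dom (stree_of (Node a l r))" by (auto simp: domIff)
    then have "\<rho> (b # w) = t_delta M (the (stree_of (Node a l r) (b # w)))
       (run_state M (stree_of (Node a l r)) \<rho> ((b # w) @ [False])) (run_state M (stree_of (Node a l r)) \<rho> ((b # w) @ [True]))"
      using Node.prems unfolding is_run_def by blast
    then show "\<rho> (b # w) = t_delta M (the (stree_of (if b then r else l) w))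
       (run_state M (stree_of (if b then r else l)) (\<lambda>v. \<rho> (b # v)) (w @ [False]))
       (run_state M (stree_of (if b then r else l)) (\<lambda>v. \<rho> (b # v)) (w @ [True]))"
      by (simp only: append_Cons run_state_Node) simp
  qed
  have "[] \<in> dom (stree_of (Node a l r))" by auto
  then have "\<rho> [] = t_delta M (the (stree_of (Node a l r) []))
      (run_state M (stree_of (Node a l r)) \<rho> ([] @ [False])) (run_state M (stree_of (Node a l r)) \<rho> ([] @ [True]))"
    using Node.prems unfolding is_run_def by blast
  also have "\<dots> = t_delta M a (run_state M (stree_of (Node a l r)) \<rho> [False]) (run_state M (stree_of (Node a l r)) \<rho> [True])"
    by (simp only: stree_of_Node_eq option.sel append_Nil)
  also have "\<dots> = eval M (Node a l r)"
    unfolding run_state_Node using Node.IH(1)[OF run[of False, simplified]] Node.IH(2)[OF run[of True, simplified]] by simp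
  finally show ?case by (auto simp: run_state_def dom_def)
qed (simp add: run_state_def)

lemma is_run_run_of: "is_run M (stree_of t) (run_of M t)"
proof (induction t)
  case (Node a l r)
  have root: "run_state M (stree_of s) (run_of M s) [] = eval M s" for s
    by (cases s) (auto simp: run_state_def dom_def)
  show ?case
    unfolding is_run_def
  proof
    fix w assume w: "w \<in> dom (stree_of (Node a l r))"
    show "run_of M (Node a l r) w = t_delta M (the (stree_of (Node a l r) w))
       (run_state M (stree_of (Node a l r)) (run_of M (Node a l r)) (w @ [False]))
       (run_state M (stree_of (Node a l r)) (run_of M (Node a l r)) (w @ [True]))"
    proof (cases w)
      case Nil
      have "run_state M (stree_of (Node a l r)) (run_of M (Node a l r)) [False] = eval M l"
        unfolding run_state_Node using root[of l] by simp
      moreover have "run_state M (stree_of (Node a l r)) (run_of M (Node a l r)) [True] = eval M r"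
        unfolding run_state_Node using root[of r] by simp
      ultimately show ?thesis using Nil by simp
    next
      case (Cons b v)
      have e: "(\<lambda>v. run_of M (Node a l r) (b # v)) = run_of M (if b then r else l)" by auto
      have "v \<in> dom (stree_of (if b then r else l))" using w Cons by (auto simp: domIff)
      then have "run_of M (if b then r else l) v = t_delta M (the (stree_of (if b then r else l) v))
       (run_state M (stree_of (if b then r else l)) (run_of M (if b then r else l)) (v @ [False]))
       (run_state M (stree_of (if b then r else l)) (run_of M (if b then r else l)) (v @ [True]))"
        using Node.IH unfolding is_run_def by (cases b) auto
      moreover have "stree_of (Node a l r) (b # v) = stree_of (if b then r else l) v" by simp
      moreover have "run_of M (Node a l r) (b # v) = run_of M (if b then r else l) v" by simp
      ultimately show ?thesis unfolding Cons append_Cons run_state_Node e by (simp only:)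
    qed
  qed
qed (simp add: is_run_def)

lemma accepts_stree_of: "accepts M (stree_of t) \<longleftrightarrow> eval M t \<in> t_final M"
  unfolding accepts_def using is_run_unique is_run_run_of by metis

lemma lang_iff: "t \<in> lang M \<longleftrightarrow> (\<exists>s. t = stree_of s \<and> eval M s \<in> t_final M)"
  unfolding lang_def using is_tree_obtain is_tree_stree_of accepts_stree_of by blast

primrec label :: "'s btree \<Rightarrow> 's option" where
  "label Tip = None" | "label (Node a l r) = Some a"

primrec lsub :: "'s btree \<Rightarrow> 's btree" where
  "lsub Tip = Tip" | "lsub (Node a l r) = l"

primrec rsub :: "'s btree \<Rightarrow> 's btree" where
  "rsub Tip = Tip" | "rsub (Node a l r) = r"

fun bconv :: "'s btree \<Rightarrow> 's btree \<Rightarrow> ('s option \<times> 's option) btree" where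
  "bconv Tip Tip = Tip"
| "bconv Tip (Node b l r) = Node (None, Some b) (bconv Tip l) (bconv Tip r)"
| "bconv (Node a l r) Tip = Node (Some a, None) (bconv l Tip) (bconv r Tip)"
| "bconv (Node a l r) (Node b l' r') = Node (Some a, Some b) (bconv l l') (bconv r r')"

lemma bconv_Node1: "bconv (Node a l r) t = Node (Some a, label t) (bconv l (lsub t)) (bconv r (rsub t))"
  by (cases t) auto

lemma bconv_Node2: "bconv s (Node b l r) = Node (label s, Some b) (bconv (lsub s) l) (bconv (rsub s) r)"
  by (cases s) auto

lemma conv_eq: "conv s t w = (if s w = None \<and> t w = None then None else Some (s w, t w))"
  by (cases "s w"; cases "t w") (auto simp: conv_def dom_def)

lemma conv_stree_of: "conv (stree_of s) (stree_of t) = stree_of (bconv s t)"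
proof (induction s t rule: bconv.induct)
  case (4 a l r b l' r')
  show ?case
  proof
    fix w show "conv (stree_of (Node a l r)) (stree_of (Node b l' r')) w = stree_of (bconv (Node a l r) (Node b l' r')) w"
    proof (cases w)
      case (Cons b v)
      then show ?thesis using fun_cong[OF 4(1), of v] fun_cong[OF 4(2), of v] by (cases b) (auto simp: conv_eq split: if_splits)
    qed (simp add: conv_eq)
  qed
next
  case (2 b l r)
  show ?case
  proof
    fix w show "conv (stree_of Tip) (stree_of (Node b l r)) w = stree_of (bconv Tip (Node b l r)) w"
    proof (cases w)
      case (Cons b v)
      then show ?thesis using fun_cong[OF 2(1), of v] fun_cong[OF 2(2), of v] by (cases b) (auto simp: conv_eq split: if_splits)
    qed (simp add: conv_eq)
  qed
next
  case (3 a l r)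
  show ?case
  proof
    fix w show "conv (stree_of (Node a l r)) (stree_of Tip) w = stree_of (bconv (Node a l r) Tip) w"
    proof (cases w)
      case (Cons b v)
      then show ?thesis using fun_cong[OF 3(1), of v] fun_cong[OF 3(2), of v] by (cases b) (auto simp: conv_eq split: if_splits)
    qed (simp add: conv_eq)
  qed
qed (simp add: conv_eq fun_eq_iff)

lemma conv_inject: "conv s t = conv s' t' \<Longrightarrow> s = s' \<and> t = t'"
proof -
  assume e: "conv s t = conv s' t'"
  have "s w = s' w \<and> t w = t' w" for w
    using fun_cong[OF e, of w] by (auto simp: conv_eq split: if_splits)
  then show ?thesis by blast
qed

section \<open>Ranks of sets of trees\<close>

text \<open>\<open>rank_lt k c\<close> bounds the \<open>VD\<^sub>*\<close>-rank strictly by \<open>\<omega>\<^sup>k (c + 1)\<close>.\<close>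
definition rank_lt :: "nat \<Rightarrow> nat \<Rightarrow> ('b \<Rightarrow> 'b \<Rightarrow> bool) \<Rightarrow> 'b set \<Rightarrow> bool" where
  "rank_lt k c le S \<longleftrightarrow> (\<exists>\<alpha>. length \<alpha> = Suc k \<and> hd \<alpha> \<le> c \<and> vd le \<alpha> S)"

lemma rank_lt_subset: "rank_lt k c le S \<Longrightarrow> S' \<subseteq> S \<Longrightarrow> rank_lt k c le S'"
  unfolding rank_lt_def using vd_subset by blast

lemma rank_lt_mono: "rank_lt k c le S \<Longrightarrow> c \<le> c' \<Longrightarrow> rank_lt k c' le S"
  unfolding rank_lt_def using le_trans by blast

lemma rank_lt_image:
  "rank_lt k c le S \<Longrightarrow> (\<And>x y. x \<in> S \<Longrightarrow> y \<in> S \<Longrightarrow> le' (f x) (f y) = le x y) \<Longrightarrow> rank_lt k c le' (f ` S)"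
  unfolding rank_lt_def using vd_image[of le _ S le' f] by blast

lemma rank_lt_finite: "finite S \<Longrightarrow> lin le S \<Longrightarrow> rank_lt k c le S"
  unfolding rank_lt_def by (intro exI[of _ "replicate (Suc k) 0"]) (simp add: vd_finite)

lemma rank_lt_union:
  assumes "rank_lt k c le S" "rank_lt k c le S'" "lin le (S \<union> S')"
  shows "rank_lt k c le (S \<union> S')"
proof -
  obtain \<alpha> where a: "length \<alpha> = Suc k" "hd \<alpha> \<le> c" "vd le \<alpha> S" using assms(1) by (auto simp: rank_lt_def)
  obtain \<beta> where b: "length \<beta> = Suc k" "hd \<beta> \<le> c" "vd le \<beta> S'" using assms(2) by (auto simp: rank_lt_def)
  have "\<alpha> \<sqsubseteq> \<beta> \<or> \<beta> \<sqsubseteq> \<alpha>" using ole_total a(1) b(1) by simp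
  then show ?thesis
    using vd_union[OF vd_mono[OF a(3)] b(3) assms(3)] vd_union[OF a(3) vd_mono[OF b(3)] assms(3)] a b
    unfolding rank_lt_def by blast
qed

lemma rank_lt_Union:
  "finite F \<Longrightarrow> (\<And>S. S \<in> F \<Longrightarrow> rank_lt k c le S) \<Longrightarrow> lin le (\<Union>F) \<Longrightarrow> rank_lt k c le (\<Union>F)"
proof (induction rule: finite_induct)
  case empty
  then show ?case by (simp add: rank_lt_finite)
next
  case (insert S F)
  have "lin le (\<Union>F)" using insert.prems(2) lin_subset by (metis Sup_insert sup_ge2)
  then show ?case using insert rank_lt_union by (metis Sup_insert insertCI)
qed

lemma rank_lt_box:
  assumes "box le0 le1 le c0 c1 X Y" "rank_lt k c le0 X" "rank_lt k d le1 Y"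
  shows "rank_lt k (c + d) le (X \<times> Y)"
proof -
  obtain \<alpha> where a: "length \<alpha> = Suc k" "hd \<alpha> \<le> c" "vd le0 \<alpha> X" using assms(2) by (auto simp: rank_lt_def)
  obtain \<beta> where b: "length \<beta> = Suc k" "hd \<beta> \<le> d" "vd le1 \<beta> Y" using assms(3) by (auto simp: rank_lt_def)
  have "\<alpha> \<noteq> []" "\<beta> \<noteq> []" using a(1) b(1) by auto
  then have "hd (\<alpha> \<oplus> \<beta>) \<le> c + d" using hd_nsum a(2) b(2) by simp
  moreover have "vd le (\<alpha> \<oplus> \<beta>) (X \<times> Y)" using vd_box[OF a(3) b(3) _ assms(1)] a(1) b(1) by simp
  ultimately show ?thesis unfolding rank_lt_def using a(1) b(1) by (intro exI[of _ "\<alpha> \<oplus> \<beta>"]) simp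
qed

lemma rank_lt_olt:
  assumes "rank_lt k n le S"
  shows "\<exists>\<beta>. \<beta> \<sqsubset> Suc n # replicate k 0 \<and> vd le \<beta> S"
proof -
  obtain \<alpha> where a: "length \<alpha> = Suc k" "hd \<alpha> \<le> n" "vd le \<alpha> S" using assms by (auto simp: rank_lt_def)
  then obtain b \<beta> where "\<alpha> = b # \<beta>" "length \<beta> = k" by (cases \<alpha>) auto
  then have "\<alpha> \<sqsubset> Suc n # replicate k 0" using a by simp
  then show ?thesis using a by blast
qed

text \<open>If no interval has rank in the gap between \<open>\<omega>\<^sup>k (n + 1)\<close> and \<open>\<omega>\<^sup>k\<^sup>+\<^sup>1\<close>, then building up a scattered set
  from smaller ones never crosses the gap. The ordinal \<open>\<gamma>\<close> may have any number of coefficients.\<close>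
lemma vd_gap:
  assumes W: "lin le W"
    and gap: "\<And>x y c. x \<in> W \<Longrightarrow> y \<in> W \<Longrightarrow> rank_lt k c le {z\<in>W. le x z \<and> le z y} \<Longrightarrow> rank_lt k n le {z\<in>W. le x z \<and> le z y}"
  shows "vd le \<gamma> S \<Longrightarrow> S \<subseteq> W \<Longrightarrow> \<forall>x\<in>S. \<forall>y\<in>S. \<forall>z\<in>W. le x z \<and> le z y \<longrightarrow> z \<in> S \<Longrightarrow> vd le (Suc n # replicate k 0) S"
proof (induction rule: vd.induct)
  case (single \<alpha> x)
  then show ?case by (rule_tac vd.single)
next
  case (sum \<alpha> S S')
  have "z \<in> S" if a: "x \<in> S" "y \<in> S" "z \<in> W" "le x z" "le z y" for x y z
  proof (rule ccontr)
    assume n: "z \<notin> S"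
    then have z: "z \<in> S'" using sum.prems(2) a by blast
    then have "le y z" using sum.hyps(3) a by blast
    then have "y = z" using lin_antisym[OF W] a sum.prems(1) by blast
    then show False using n a by blast
  qed
  moreover have "z \<in> S'" if a: "x \<in> S'" "y \<in> S'" "z \<in> W" "le x z" "le z y" for x y z
  proof (rule ccontr)
    assume n: "z \<notin> S'"
    then have z: "z \<in> S" using sum.prems(2) a by blast
    then have "le z x" using sum.hyps(3) a by blast
    then have "x = z" using lin_antisym[OF W] a sum.prems(1) by blast
    then show False using n a by blast
  qed
  ultimately have "vd le (Suc n # replicate k 0) S" "vd le (Suc n # replicate k 0) S'"
    using sum.IH sum.prems(1) by blast+
  then show ?case using sum.hyps(3) by (rule vd.sum)
next
  case (left S \<alpha>)
  let ?a = "Suc n # replicate k 0"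
  have lo: "vd le ?a {z\<in>S. le z x}" if x: "x \<in> S" for x
  proof -
    have "\<forall>u\<in>{z\<in>S. le z x}. \<forall>v\<in>{z\<in>S. le z x}. \<forall>z\<in>W. le u z \<and> le z v \<longrightarrow> z \<in> {z\<in>S. le z x}"
    proof (intro ballI impI)
      fix u v z assume a: "u \<in> {z\<in>S. le z x}" "v \<in> {z\<in>S. le z x}" "z \<in> W" "le u z \<and> le z v"
      then have "z \<in> S" using left.prems(2) by blast
      moreover have "le z x" using lin_trans[OF W, of z v x] a x left.prems(1) by blast
      ultimately show "z \<in> {z\<in>S. le z x}" by simp
    qed
    moreover have "{z\<in>S. le z x} \<subseteq> W" using left.prems(1) by blast
    ultimately show ?thesis using left.IH[OF x] by meson
  qed
  show ?case
  proof (cases "S = {}")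
    case False
    then obtain p where p: "p \<in> S" by blast
    have up: "vd le ?a {z\<in>S. le p z}"
    proof (rule vd.left)
      fix z assume z: "z \<in> {z\<in>S. le p z}"
      let ?I = "{w\<in>W. le p w \<and> le w z}"
      have "?I \<subseteq> {w\<in>S. le w z}" using left.prems(2) z p by blast
      moreover have "vd le ?a {w\<in>S. le w z}" using lo z by blast
      ultimately have "vd le ?a ?I" using vd_subset by blast
      \<comment> \<open>The list ?a has head n + 1, so the gap hypothesis applies and lowers the
        coefficient to n. The interval thus falls strictly below ?a, and the part of S above p is an
        \<omega>-sum of such intervals.\<close>
      then have "rank_lt k (Suc n) le ?I" unfolding rank_lt_def by (intro exI[of _ ?a]) simp
      then have "rank_lt k n le ?I" using gap[of p z] p z left.prems(1) by blast
      then have "rank_lt k n le {w \<in> {z\<in>S. le p z}. le w z}" by (rule rank_lt_subset) (use left.prems(1) in blast)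
      then show "\<exists>\<beta>. \<beta> \<sqsubset> ?a \<and> vd le \<beta> {w \<in> {z\<in>S. le p z}. le w z}" by (rule rank_lt_olt)
    qed
    show ?thesis by (rule vd_cut'[OF lin_subset[OF W left.prems(1)] p lo[OF p] up]) simp_all
  qed (simp add: vd_empty)
next
  case (right S \<alpha>)
  let ?a = "Suc n # replicate k 0"
  have up: "vd le ?a {z\<in>S. le x z}" if x: "x \<in> S" for x
  proof -
    have "\<forall>u\<in>{z\<in>S. le x z}. \<forall>v\<in>{z\<in>S. le x z}. \<forall>z\<in>W. le u z \<and> le z v \<longrightarrow> z \<in> {z\<in>S. le x z}"
    proof (intro ballI impI)
      fix u v z assume a: "u \<in> {z\<in>S. le x z}" "v \<in> {z\<in>S. le x z}" "z \<in> W" "le u z \<and> le z v"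
      then have "z \<in> S" using right.prems(2) by blast
      moreover have "le x z" using lin_trans[OF W, of x u z] a x right.prems(1) by blast
      ultimately show "z \<in> {z\<in>S. le x z}" by simp
    qed
    moreover have "{z\<in>S. le x z} \<subseteq> W" using right.prems(1) by blast
    ultimately show ?thesis using right.IH[OF x] by meson
  qed
  show ?case
  proof (cases "S = {}")
    case False
    then obtain p where p: "p \<in> S" by blast
    have lo: "vd le ?a {z\<in>S. le z p}"
    proof (rule vd.right)
      fix z assume z: "z \<in> {z\<in>S. le z p}"
      let ?I = "{w\<in>W. le z w \<and> le w p}"
      have "?I \<subseteq> {w\<in>S. le z w}" using right.prems(2) z p by blast
      moreover have "vd le ?a {w\<in>S. le z w}" using up z by blast
      ultimately have "vd le ?a ?I" using vd_subset by blast
      then have "rank_lt k (Suc n) le ?I" unfolding rank_lt_def by (intro exI[of _ ?a]) simp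
      then have "rank_lt k n le ?I" using gap[of z p] p z right.prems(1) by blast
      then have "rank_lt k n le {w \<in> {z\<in>S. le z p}. le z w}" by (rule rank_lt_subset) (use right.prems(1) in blast)
      then show "\<exists>\<beta>. \<beta> \<sqsubset> ?a \<and> vd le \<beta> {w \<in> {z\<in>S. le z p}. le z w}" by (rule rank_lt_olt)
    qed
    show ?thesis by (rule vd_cut'[OF lin_subset[OF W right.prems(1)] p lo up[OF p]]) simp_all
  qed (simp add: vd_empty)
qed

text \<open>An index for which no bound exists receives an arbitrary value from \<open>SOME\<close>,
  which can only enlarge the maximum. No bound for such an index is claimed.\<close>

lemma uniform_bound:
  fixes P :: "'j::finite \<Rightarrow> nat \<Rightarrow> bool"
  assumes "\<And>j c c'. P j c \<Longrightarrow> c \<le> c' \<Longrightarrow> P j c'"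
  shows "\<exists>m. \<forall>j c. P j c \<longrightarrow> P j m"
proof -
  define f where "f j = (SOME c. P j c)" for j
  have f: "P j (f j)" if "P j c" for j c unfolding f_def using that by (rule someI[of "P j"])
  have "f j \<le> Max (range f)" for j by (intro Max_ge) auto
  then have "\<forall>j c. P j c \<longrightarrow> P j (Max (range f))" using f assms by blast
  then show ?thesis by blast
qed

section \<open>Profiles, slices and products of subtrees\<close>

definition pair_state :: "('s option \<times> 's option, 'p) tree_aut \<Rightarrow> 's btree \<Rightarrow> 's btree \<Rightarrow> 'p" where
  "pair_state N s t = eval N (bconv s t)"

lemma pair_state_Node1: "pair_state N (Node a l r) t = t_delta N (Some a, label t) (pair_state N l (lsub t)) (pair_state N r (rsub t))"
  by (simp add: pair_state_def bconv_Node1)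

lemma pair_state_Node2: "pair_state N s (Node a l r) = t_delta N (label s, Some a) (pair_state N (lsub s) l) (pair_state N (rsub s) r)"
  by (simp add: pair_state_def bconv_Node2)

text \<open>The set G is the order context: those states of a pair of subtrees that the surrounding
  pair of trees carries to acceptance. It is \<open>t_final\<close> at the root and is recomputed at
  each child.\<close>

definition state_le :: "('s option \<times> 's option, 'p) tree_aut \<Rightarrow> 'p set \<Rightarrow> 's btree \<Rightarrow> 's btree \<Rightarrow> bool" where
  "state_le N G s t \<longleftrightarrow> pair_state N s t \<in> G"

text \<open>The first two components decide membership of \<open>z\<close> in the interval \<open>[x, y]\<close>; the last four are the
  only information about \<open>z\<close> that matters where \<open>x\<close> and \<open>y\<close> are undefined.\<close>
definition profile :: "('s, 'q) tree_aut \<Rightarrow> ('s option \<times> 's option, 'p) tree_aut \<Rightarrow> 's btree \<Rightarrow> 's btree \<Rightarrow> 's btree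
    \<Rightarrow> 'p \<times> 'p \<times> 'p \<times> 'p \<times> 'q \<times> 'p" where
  "profile M N x y z = (pair_state N x z, pair_state N z y, pair_state N Tip z, pair_state N z Tip, eval M z, pair_state N z z)"

text \<open>For x = y = \<open>Tip\<close> the set depends on the profile alone. These slices are
  the factors reached where x and y are undefined, and there are finitely many of them.\<close>

definition slice :: "('s, 'q) tree_aut \<Rightarrow> ('s option \<times> 's option, 'p) tree_aut \<Rightarrow> 's btree \<Rightarrow> 's btree
    \<Rightarrow> 'p \<times> 'p \<times> 'p \<times> 'p \<times> 'q \<times> 'p \<Rightarrow> 's btree set" where
  "slice M N x y r = {z. profile M N x y z = r}"

definition Nodes :: "'s btree set \<Rightarrow> bool list set" where
  "Nodes Z = (\<Union>t\<in>Z. nodes t)"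

lemma prefix_closed_Nodes: "prefix_closed (Nodes Z)"
  unfolding prefix_closed_def Nodes_def using nodes_prefix by blast

text \<open>A profile is computed bottom-up from the label and the profiles of the children.
  Therefore every slice is, apart from \<open>Tip\<close>, a finite union of products of slices of
  the children.\<close>

lemma profile_Node:
  assumes "profile M N (lsub x) (lsub y) l = profile M N (lsub x) (lsub y) l'"
    "profile M N (rsub x) (rsub y) r = profile M N (rsub x) (rsub y) r'"
  shows "profile M N x y (Node a l r) = profile M N x y (Node a l' r')"
  using assms by (simp add: profile_def pair_state_Node1 pair_state_Node2)

lemma lin_vimage:
  assumes "lin le' (f ` S)" "inj_on f S" "\<And>x y. x \<in> S \<Longrightarrow> y \<in> S \<Longrightarrow> le' (f x) (f y) = le x y"
  shows "lin le S"
  unfolding lin_def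
proof (intro conjI ballI impI)
  fix x y assume xy: "x \<in> S" "y \<in> S"
  show "le x y \<or> le y x" using lin_total[OF assms(1), of "f x" "f y"] xy assms(3) by auto
  show "x = y" if "le x y \<and> le y x"
    using lin_antisym[OF assms(1), of "f x" "f y"] xy assms(3) that inj_onD[OF assms(2)] by auto
  show "le x z" if "z \<in> S" "le x y \<and> le y z" for z
    using lin_trans[OF assms(1), of "f x" "f y" "f z"] xy assms(3) that by auto
qed

text \<open>With the right subtree r fixed, the order of two nodes depends on the left subtrees and
  on the state of the pair (r, r), which is q for all r in Y. So one context GX serves for every
  choice of r. This is why a profile records the state of z paired with itself. Fixing one
  coordinate embeds each factor into the box, so a rank of the box yields ranks of both
  factors.\<close>

lemma node_product:
  fixes X Y :: "'s::finite btree set" and N :: "('s option \<times> 's option, 'p::finite) tree_aut"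
  assumes lin: "lin (state_le N G) ((\<lambda>(l, r). Node a l r) ` (X \<times> Y))"
    and p: "\<forall>l\<in>X. pair_state N l l = p" and q: "\<forall>r\<in>Y. pair_state N r r = q"
    and ne: "l0 \<in> X" "r0 \<in> Y"
  defines "GX \<equiv> {s. t_delta N (Some a, Some a) s q \<in> G}" and "GY \<equiv> {s. t_delta N (Some a, Some a) p s \<in> G}"
  shows "lin (state_le N GX) X" "lin (state_le N GY) Y"
    "rank_lt k c (state_le N G) ((\<lambda>(l, r). Node a l r) ` (X \<times> Y)) \<Longrightarrow> rank_lt k c (state_le N GX) X"
    "rank_lt k c (state_le N G) ((\<lambda>(l, r). Node a l r) ` (X \<times> Y)) \<Longrightarrow> rank_lt k c (state_le N GY) Y"
    "rank_lt k c (state_le N GX) X \<Longrightarrow> rank_lt k d (state_le N GY) Y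
      \<Longrightarrow> rank_lt k (c + d) (state_le N G) ((\<lambda>(l, r). Node a l r) ` (X \<times> Y))"
proof -
  let ?f = "\<lambda>(l, r). Node a l r" and ?P = "(\<lambda>(l, r). Node a l r) ` (X \<times> Y)"
  have ordX: "state_le N G (Node a l r) (Node a l' r) = state_le N GX l l'" if "r \<in> Y" for l l' r
    using bspec[OF q that] by (simp add: state_le_def pair_state_Node1 GX_def)
  have ordY: "state_le N G (Node a l r) (Node a l r') = state_le N GY r r'" if "l \<in> X" for l r r'
    using bspec[OF p that] by (simp add: state_le_def pair_state_Node1 GY_def)
  have subX: "(\<lambda>l. Node a l r0) ` X \<subseteq> ?P" and subY: "(\<lambda>r. Node a l0 r) ` Y \<subseteq> ?P" using ne by auto
  show lX: "lin (state_le N GX) X"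
    by (rule lin_vimage[OF lin_subset[OF lin subX]]) (use ordX ne in \<open>auto simp: inj_on_def\<close>)
  show lY: "lin (state_le N GY) Y"
    by (rule lin_vimage[OF lin_subset[OF lin subY]]) (use ordY ne in \<open>auto simp: inj_on_def\<close>)
  show "rank_lt k c (state_le N GX) X" if r: "rank_lt k c (state_le N G) ?P"
  proof -
    have "rank_lt k c (state_le N GX) (lsub ` (\<lambda>l. Node a l r0) ` X)"
      by (rule rank_lt_image[OF rank_lt_subset[OF r subX]]) (use ordX ne in auto)
    then show ?thesis by (simp add: image_image)
  qed
  show "rank_lt k c (state_le N GY) Y" if r: "rank_lt k c (state_le N G) ?P"
  proof -
    have "rank_lt k c (state_le N GY) (rsub ` (\<lambda>r. Node a l0 r) ` Y)"
      by (rule rank_lt_image[OF rank_lt_subset[OF r subY]]) (use ordY ne in auto)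
    then show ?thesis by (simp add: image_image)
  qed
  define le where "le u v = state_le N G (?f u) (?f v)" for u v
  have l: "lin le (X \<times> Y)"
    by (rule lin_vimage[OF lin]) (auto simp: inj_on_def le_def)
  have "box (state_le N GX) (state_le N GY) le (pair_state N) (pair_state N) X Y"
    unfolding box_def
  proof (intro conjI lX lY l)
    show "\<forall>x\<in>X. \<forall>x'\<in>X. \<forall>y\<in>Y. \<forall>y'\<in>Y. state_le N GX x x' \<and> state_le N GY y y' \<longrightarrow> le (x, y) (x', y')"
    proof (intro ballI impI)
      fix x x' y y' assume a: "x \<in> X" "x' \<in> X" "y \<in> Y" "y' \<in> Y" "state_le N GX x x' \<and> state_le N GY y y'"
      \<comment> \<open>Changing one coordinate at a time reduces the product order to the two
        context orders.\<close>
      have "le (x, y) (x', y)" "le (x', y) (x', y')" using a ordX ordY by (simp_all add: le_def)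
      then show "le (x, y) (x', y')" using lin_trans[OF l] a by blast
    qed
    show "\<exists>f. \<forall>x\<in>X. \<forall>x'\<in>X. \<forall>y\<in>Y. \<forall>y'\<in>Y. le (x, y) (x', y') = f (pair_state N x x') (pair_state N y y')"
      by (intro exI[of _ "\<lambda>s t. t_delta N (Some a, Some a) s t \<in> G"]) (simp add: le_def state_le_def pair_state_Node1)
  qed (rule countableI_type)+
  then show "rank_lt k (c + d) (state_le N G) ?P" if "rank_lt k c (state_le N GX) X" "rank_lt k d (state_le N GY) Y"
    by (rule rank_lt_image[OF rank_lt_box[OF _ that]]) (simp add: le_def)
qed

text \<open>The induction follows x and y downwards until both are \<open>Tip\<close>. X only has to
  contain the nodes of the slice; the children receive its residuals, so the branches of the
  derivative are divided between them. The coefficient c serves only as evidence that some bound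
  exists, which is what H1 and H2 ask for.\<close>

lemma rank_lt_slice:
  fixes M :: "('s::finite, 'q::finite) tree_aut" and N :: "('s option \<times> 's option, 'p::finite) tree_aut"
  assumes H1: "\<forall>\<tau> G c. rank_lt k c (state_le N G) (slice M N Tip Tip \<tau>) \<longrightarrow> rank_lt k m (state_le N G) (slice M N Tip Tip \<tau>)"
    and H2: "\<forall>\<tau> G c. lin (state_le N G) (slice M N Tip Tip \<tau>) \<longrightarrow> rank_lt k c (state_le N G) (slice M N Tip Tip \<tau>)
      \<longrightarrow> finite ((tree_deriv ^^ k) (Nodes (slice M N Tip Tip \<tau>))) \<longrightarrow> rank_lt k 0 (state_le N G) (slice M N Tip Tip \<tau>)"
  shows "prefix_closed X \<Longrightarrow> finite (branches ((tree_deriv ^^ k) X)) \<Longrightarrow> Nodes (slice M N x y \<tau>) \<subseteq> X \<Longrightarrow>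
    lin (state_le N G) (slice M N x y \<tau>) \<Longrightarrow> rank_lt k c (state_le N G) (slice M N x y \<tau>) \<Longrightarrow>
    rank_lt k (card (branches ((tree_deriv ^^ k) X)) * m) (state_le N G) (slice M N x y \<tau>)"
proof (induction "size x + size y" arbitrary: x y \<tau> X G rule: less_induct)
  case less
  note X = less.prems(1) and fin = less.prems(2) and sub = less.prems(3) and lin = less.prems(4) and rk = less.prems(5)
  let ?D = "tree_deriv ^^ k" and ?Z = "slice M N x y \<tau>"
  show ?case
  proof (cases "x = Tip \<and> y = Tip")
    case True
    then have xy: "x = Tip" "y = Tip" by simp_all
    show ?thesis
    \<comment> \<open>A factor without branches has a finite derivative by Koenig's lemma and
      contributes 0; any other factor has at least one branch to be charged with its m.\<close>
    proof (cases "branches (?D X) = {}")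
      case True
      then have "finite (?D X)" using koenig[OF prefix_closed_derivn[OF X]] by blast
      then have "finite (?D (Nodes ?Z))" using derivn_mono[OF sub] finite_subset by blast
      then have "rank_lt k 0 (state_le N G) ?Z" using H2 lin rk unfolding xy by blast
      then show ?thesis using True by simp
    next
      case False
      then have "m \<le> card (branches (?D X)) * m" using fin by (simp add: Suc_leI card_gt_0_iff)
      moreover have "rank_lt k m (state_le N G) ?Z" using H1 rk unfolding xy by blast
      ultimately show ?thesis using rank_lt_mono by blast
    qed
  next
    case False
    have smaller: "size (lsub x) + size (lsub y) < size x + size y" "size (rsub x) + size (rsub y) < size x + size y"
      using False by (cases x; cases y; simp)+
    \<comment> \<open>The index consists of the root label and the profiles of the two children. It
      ranges over a finite type, so J is finite.\<close>
    define P where "P j = (case j of (a, \<sigma>, \<upsilon>) \<Rightarrow>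
      (\<lambda>(l, r). Node a l r) ` (slice M N (lsub x) (lsub y) \<sigma> \<times> slice M N (rsub x) (rsub y) \<upsilon>))" for j
    define J where "J = {j. P j \<noteq> {} \<and> P j \<subseteq> ?Z}"
    have cover: "?Z \<subseteq> {Tip} \<union> \<Union>(P ` J)"
    proof
      fix z assume z: "z \<in> ?Z"
      show "z \<in> {Tip} \<union> \<Union>(P ` J)"
      proof (cases z)
        case (Node a l r)
        let ?j = "(a, profile M N (lsub x) (lsub y) l, profile M N (rsub x) (rsub y) r)"
        have zP: "z \<in> P ?j" using Node by (auto simp: P_def slice_def)
        have "P ?j \<subseteq> ?Z"
        proof
          fix w assume "w \<in> P ?j"
          then obtain l' r' where w: "w = Node a l' r'" "profile M N (lsub x) (lsub y) l' = profile M N (lsub x) (lsub y) l"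
              "profile M N (rsub x) (rsub y) r' = profile M N (rsub x) (rsub y) r"
            by (auto simp: P_def slice_def)
          have "profile M N x y w = profile M N x y z" using profile_Node[OF w(2,3)] w(1) Node by simp
          then show "w \<in> ?Z" using z by (simp add: slice_def)
        qed
        then have "?j \<in> J" using zP unfolding J_def by blast
        then show ?thesis using zP by blast
      qed simp
    qed
    have part: "rank_lt k (card (branches (?D X)) * m) (state_le N G) (P j)" if j: "j \<in> J" for j
    proof -
      obtain a \<sigma> \<upsilon> where j_eq: "j = (a, \<sigma>, \<upsilon>)" by (cases j)
      let ?X = "slice M N (lsub x) (lsub y) \<sigma>" and ?Y = "slice M N (rsub x) (rsub y) \<upsilon>"
      have Pj: "P j = (\<lambda>(l, r). Node a l r) ` (?X \<times> ?Y)" by (simp add: P_def j_eq)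
      have PZ: "P j \<subseteq> ?Z" and ne: "P j \<noteq> {}" using j by (auto simp: J_def)
      obtain l0 r0 where lr: "l0 \<in> ?X" "r0 \<in> ?Y" using ne unfolding Pj by auto
      define p where "p = snd (snd (snd (snd (snd \<sigma>))))"
      define q where "q = snd (snd (snd (snd (snd \<upsilon>))))"
      have p: "\<forall>l\<in>?X. pair_state N l l = p" by (auto simp: slice_def profile_def p_def)
      have q: "\<forall>r\<in>?Y. pair_state N r r = q" by (auto simp: slice_def profile_def q_def)
      note prod = node_product[OF lin_subset[OF lin PZ[unfolded Pj]] p q lr]
      have rkP: "rank_lt k c (state_le N G) ((\<lambda>(l, r). Node a l r) ` (?X \<times> ?Y))"
        using rank_lt_subset[OF rk PZ] unfolding Pj .
      have subX: "Nodes ?X \<subseteq> residual [False] X"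
      proof
        fix v assume "v \<in> Nodes ?X"
        then obtain l where l: "l \<in> ?X" "v \<in> nodes l" by (auto simp: Nodes_def)
        then have "Node a l r0 \<in> ?Z" using PZ lr unfolding Pj by auto
        then have "False # v \<in> X" using sub l(2) by (force simp: Nodes_def)
        then show "v \<in> residual [False] X" by (simp add: residual_def)
      qed
      have subY: "Nodes ?Y \<subseteq> residual [True] X"
      proof
        fix v assume "v \<in> Nodes ?Y"
        then obtain r where r: "r \<in> ?Y" "v \<in> nodes r" by (auto simp: Nodes_def)
        then have "Node a l0 r \<in> ?Z" using PZ lr unfolding Pj by auto
        then have "True # v \<in> X" using sub r(2) by (force simp: Nodes_def)
        then show "v \<in> residual [True] X" by (simp add: residual_def)
      qed
      have D: "?D (residual [b] X) = residual [b] (?D X)" for b by (rule derivn_res[OF X])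
      note cb = card_branches_res[OF prefix_closed_derivn[OF X] fin]
      have "rank_lt k (card (branches (?D (residual [False] X))) * m) (state_le N {s. t_delta N (Some a, Some a) s q \<in> G}) ?X"
        by (rule less.hyps[OF smaller(1) prefix_closed_res[OF X] _ subX prod(1) prod(3)[OF rkP]]) (simp add: D cb)
      moreover have "rank_lt k (card (branches (?D (residual [True] X))) * m) (state_le N {s. t_delta N (Some a, Some a) p s \<in> G}) ?Y"
        by (rule less.hyps[OF smaller(2) prefix_closed_res[OF X] _ subY prod(2) prod(4)[OF rkP]]) (simp add: D cb)
      ultimately have "rank_lt k (card (branches (?D (residual [False] X))) * m + card (branches (?D (residual [True] X))) * m) (state_le N G) (P j)"
        unfolding Pj by (rule prod(5))
      moreover have "card (branches (?D (residual [False] X))) * m + card (branches (?D (residual [True] X))) * m \<le> card (branches (?D X)) * m"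
        using mult_le_mono1[OF cb(2)] by (simp add: D add_mult_distrib)
      ultimately show ?thesis by (rule rank_lt_mono)
    qed
    have sub': "\<Union>(P ` J) \<subseteq> ?Z" by (auto simp: J_def)
    have "rank_lt k (card (branches (?D X)) * m) (state_le N G) (\<Union>(P ` J))"
      by (rule rank_lt_Union) (use part lin_subset[OF lin sub'] in auto)
    \<comment> \<open>\<open>Tip\<close> has no children and lies in none of the boxes; it is added
      as a finite remainder.\<close>
    moreover have "rank_lt k (card (branches (?D X)) * m) (state_le N G) (?Z \<inter> {Tip})"
      by (rule rank_lt_finite) (auto intro: lin_subset[OF lin])
    moreover have "(?Z \<inter> {Tip}) \<union> \<Union>(P ` J) = ?Z" using cover sub' by blast
    ultimately show ?thesis using rank_lt_union[of k _ "state_le N G" "?Z \<inter> {Tip}" "\<Union>(P ` J)"] lin by simp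
  qed
qed

text \<open>Both the accepted language and a single factor have this property, so one bound on
  intervals serves the theorem as well as the induction on k.\<close>

definition type_closed :: "('s, 'q) tree_aut \<Rightarrow> ('s option \<times> 's option, 'p) tree_aut \<Rightarrow> 's btree set \<Rightarrow> bool" where
  "type_closed M N W \<longleftrightarrow> (\<forall>z z'. profile M N Tip Tip z = profile M N Tip Tip z' \<longrightarrow> z \<in> W \<longrightarrow> z' \<in> W)"

text \<open>Membership in the interval is visible in the first two components of a profile and
  membership in W in the other four. The interval is thus a union of finitely many whole
  slices.\<close>

lemma rank_lt_interval:
  fixes M :: "('s::finite, 'q::finite) tree_aut" and N :: "('s option \<times> 's option, 'p::finite) tree_aut"
  assumes H1: "\<forall>\<tau> G c. rank_lt k c (state_le N G) (slice M N Tip Tip \<tau>) \<longrightarrow> rank_lt k m (state_le N G) (slice M N Tip Tip \<tau>)"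
    and H2: "\<forall>\<tau> G c. lin (state_le N G) (slice M N Tip Tip \<tau>) \<longrightarrow> rank_lt k c (state_le N G) (slice M N Tip Tip \<tau>)
      \<longrightarrow> finite ((tree_deriv ^^ k) (Nodes (slice M N Tip Tip \<tau>))) \<longrightarrow> rank_lt k 0 (state_le N G) (slice M N Tip Tip \<tau>)"
    and W: "type_closed M N W" and fin: "finite (branches ((tree_deriv ^^ k) (Nodes W)))" and lin: "lin (state_le N G) W"
    and rk: "rank_lt k c (state_le N G) {z\<in>W. state_le N G x z \<and> state_le N G z y}"
  shows "rank_lt k (card (branches ((tree_deriv ^^ k) (Nodes W))) * m) (state_le N G) {z\<in>W. state_le N G x z \<and> state_le N G z y}"
proof -
  let ?I = "{z\<in>W. state_le N G x z \<and> state_le N G z y}"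
  let ?F = "(\<lambda>z. slice M N x y (profile M N x y z)) ` ?I"
  have sub: "S \<subseteq> ?I" if "S \<in> ?F" for S
  proof
    fix w assume w: "w \<in> S"
    obtain z where z: "z \<in> ?I" "profile M N x y w = profile M N x y z" using w \<open>S \<in> ?F\<close> by (auto simp: slice_def)
    have "profile M N Tip Tip z = profile M N Tip Tip w" using z(2) by (simp add: profile_def)
    then have "w \<in> W" using W z(1) unfolding type_closed_def by blast
    then show "w \<in> ?I" using z by (simp add: profile_def state_le_def)
  qed
  have un: "\<Union>?F = ?I"
  proof
    show "\<Union>?F \<subseteq> ?I" using sub by blast
    show "?I \<subseteq> \<Union>?F" by (auto simp: slice_def)
  qed
  have lI: "lin (state_le N G) ?I" by (rule lin_subset[OF lin]) blast
  have NI: "Nodes ?I \<subseteq> Nodes W" by (auto simp: Nodes_def)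
  have "rank_lt k (card (branches ((tree_deriv ^^ k) (Nodes W))) * m) (state_le N G) S" if S: "S \<in> ?F" for S
  proof -
    obtain \<tau> where t: "S = slice M N x y \<tau>" using S by blast
    have "Nodes S \<subseteq> Nodes W" using sub[OF S] by (auto simp: Nodes_def)
    then show ?thesis
      using rank_lt_slice[OF H1 H2 prefix_closed_Nodes fin] lin_subset[OF lI sub[OF S]] rank_lt_subset[OF rk sub[OF S]]
      unfolding t by blast
  qed
  moreover have "finite ?F"
    by (rule finite_subset[of _ "range (slice M N x y)"]) auto
  ultimately show ?thesis using rank_lt_Union[of ?F k _ "state_le N G"] lI unfolding un by blast
qed

section \<open>Induction on the number of derivatives\<close>

lemma finite_btrees:
  fixes X :: "bool list set"
  assumes "finite X"
  shows "finite {t :: 's::finite btree. nodes t \<subseteq> X}"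
proof -
  have "stree_of ` {t :: 's btree. nodes t \<subseteq> X} \<subseteq> (\<Union>A\<in>Pow X. {m. dom m = A \<and> ran m \<subseteq> UNIV})"
    by (auto simp: dom_stree_of)
  moreover have "finite (\<Union>A\<in>Pow X. {m :: 's stree. dom m = A \<and> ran m \<subseteq> UNIV})"
  proof (rule finite_UN_I)
    show "finite (Pow X)" using assms by simp
    show "finite {m :: 's stree. dom m = A \<and> ran m \<subseteq> UNIV}" if "A \<in> Pow X" for A
      using that assms finite_subset by (intro finite_set_of_finite_maps) auto
  qed
  ultimately have "finite (stree_of ` {t :: 's btree. nodes t \<subseteq> X})" by (rule finite_subset)
  then show ?thesis by (rule finite_imageD) (auto simp: inj_on_def dest: stree_of_inject)
qed

text \<open>The list \<gamma> may have any length while \<alpha> has length k: if the k-th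
  derivative is finite, having a rank at all implies having one below \<omega>^k. For k = 0 the only
  value is \<alpha> = [], the rank of finite sets.\<close>

definition small_types :: "('s, 'q) tree_aut \<Rightarrow> ('s option \<times> 's option, 'p) tree_aut \<Rightarrow> nat \<Rightarrow> bool" where
  "small_types M N k \<longleftrightarrow> (\<forall>\<tau> G \<gamma>. lin (state_le N G) (slice M N Tip Tip \<tau>) \<longrightarrow>
     finite ((tree_deriv ^^ k) (Nodes (slice M N Tip Tip \<tau>))) \<longrightarrow> vd (state_le N G) \<gamma> (slice M N Tip Tip \<tau>) \<longrightarrow>
     (\<exists>\<alpha>. length \<alpha> = k \<and> vd (state_le N G) \<alpha> (slice M N Tip Tip \<tau>)))"

lemma interval_bound:
  fixes M :: "('s::finite, 'q::finite) tree_aut" and N :: "('s option \<times> 's option, 'p::finite) tree_aut"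
  assumes small: "small_types M N k"
    and W: "type_closed M N W" and fin: "finite ((tree_deriv ^^ Suc k) (Nodes W))" and lin: "lin (state_le N G) W"
  shows "\<exists>n. \<forall>x y c. rank_lt k c (state_le N G) {z\<in>W. state_le N G x z \<and> state_le N G z y}
    \<longrightarrow> rank_lt k n (state_le N G) {z\<in>W. state_le N G x z \<and> state_le N G z y}"
proof -
  let ?B = "slice M N Tip Tip"
  \<comment> \<open>The index j is a pair of a profile and an order context. Both range over finite
    types, which makes m independent of the interval.\<close>
  have "\<exists>m. \<forall>j c. (case j of (\<tau>, G) \<Rightarrow> rank_lt k c (state_le N G) (?B \<tau>)) \<longrightarrow> (case j of (\<tau>, G) \<Rightarrow> rank_lt k m (state_le N G) (?B \<tau>))"
    by (rule uniform_bound) (auto intro: rank_lt_mono)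
  then obtain m where m: "\<forall>\<tau> G c. rank_lt k c (state_le N G) (?B \<tau>) \<longrightarrow> rank_lt k m (state_le N G) (?B \<tau>)" by auto
  have "rank_lt k 0 (state_le N G) (?B \<tau>)"
    if h: "lin (state_le N G) (?B \<tau>)" "rank_lt k c (state_le N G) (?B \<tau>)" "finite ((tree_deriv ^^ k) (Nodes (?B \<tau>)))" for \<tau> G c
  proof -
    obtain \<gamma> where "vd (state_le N G) \<gamma> (?B \<tau>)" using h(2) by (auto simp: rank_lt_def)
    then obtain \<alpha> where "length \<alpha> = k" "vd (state_le N G) \<alpha> (?B \<tau>)" using small h unfolding small_types_def by blast
    \<comment> \<open>A rank below \<omega>^k is read as a list of length k + 1 with leading
      coefficient 0, so factors of smaller tree rank cost nothing.\<close>
    then show ?thesis unfolding rank_lt_def by (intro exI[of _ "0 # \<alpha>"]) (simp add: vd_Cons0)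
  qed
  then have H2: "\<forall>\<tau> G c. lin (state_le N G) (?B \<tau>) \<longrightarrow> rank_lt k c (state_le N G) (?B \<tau>)
      \<longrightarrow> finite ((tree_deriv ^^ k) (Nodes (?B \<tau>))) \<longrightarrow> rank_lt k 0 (state_le N G) (?B \<tau>)" by blast
  have "finite (branches ((tree_deriv ^^ k) (Nodes W)))" using fin by (intro finite_branches) simp
  from rank_lt_interval[OF m H2 W this lin] show ?thesis by blast
qed

lemma type_closed_slice: "type_closed M N (slice M N Tip Tip \<tau>)"
  by (simp add: type_closed_def slice_def)

text \<open>In the successor step the intervals inside the factor leave a gap above \<omega>^k (n +
  1), and \<open>vd_gap\<close> carries this over to the whole factor. Its rank is then at most
  \<omega>^k (n + 1), which is below \<omega>^(k+1).\<close>

lemma small_types: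
  fixes M :: "('s::finite, 'q::finite) tree_aut" and N :: "('s option \<times> 's option, 'p::finite) tree_aut"
  shows "small_types M N k"
proof (induction k)
  case 0
  show ?case
    unfolding small_types_def
  proof (intro allI impI)
    fix \<tau> G assume l: "lin (state_le N G) (slice M N Tip Tip \<tau>)" and "finite ((tree_deriv ^^ 0) (Nodes (slice M N Tip Tip \<tau>)))"
    then have "finite (Nodes (slice M N Tip Tip \<tau>))" by simp
    from finite_btrees[OF this] have "finite (slice M N Tip Tip \<tau>)"
      by (rule rev_finite_subset) (auto simp: Nodes_def)
    then show "\<exists>\<alpha>. length \<alpha> = 0 \<and> vd (state_le N G) \<alpha> (slice M N Tip Tip \<tau>)" using vd_finite l by auto
  qed
next
  case (Suc k)
  show ?case
    unfolding small_types_def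
  proof (intro allI impI)
    fix \<tau> G \<gamma> assume l: "lin (state_le N G) (slice M N Tip Tip \<tau>)"
      and f: "finite ((tree_deriv ^^ Suc k) (Nodes (slice M N Tip Tip \<tau>)))" and v: "vd (state_le N G) \<gamma> (slice M N Tip Tip \<tau>)"
    let ?B = "slice M N Tip Tip \<tau>"
    obtain n where n: "\<forall>x y c. rank_lt k c (state_le N G) {z\<in>?B. state_le N G x z \<and> state_le N G z y}
        \<longrightarrow> rank_lt k n (state_le N G) {z\<in>?B. state_le N G x z \<and> state_le N G z y}"
      using interval_bound[OF Suc type_closed_slice f l] by (elim exE)
    have "vd (state_le N G) (Suc n # replicate k 0) ?B"
      by (rule vd_gap[OF l _ v]) (use n in blast)+
    then show "\<exists>\<alpha>. length \<alpha> = Suc k \<and> vd (state_le N G) \<alpha> ?B" by (intro exI[of _ "Suc n # replicate k 0"]) simp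
  qed
qed

text \<open>A residual of such a node set is the node set of the same automaton with another set of
  root states, and there are finitely many sets of states.\<close>

lemma finite_residuals:
  fixes M :: "('s, 'q::finite) tree_aut"
  shows "finite (range (\<lambda>u. residual u (Nodes {t. eval M t \<in> C})))"
proof -
  let ?T = "\<lambda>C. Nodes {t. eval M t \<in> C}"
  have step: "\<exists>C'. residual [b] (?T C) = ?T C'" for b C
  proof -
    \<comment> \<open>These are the states of a b-child in some tree whose root state is in C. Such
      a child may be replaced by any tree of the same state while its sibling is kept.\<close>
    let ?C = "{eval M (if b then r else l) | a l r. t_delta M a (eval M l) (eval M r) \<in> C}"
    have "residual [b] (?T C) = ?T ?C"
    proof
      show "residual [b] (?T C) \<subseteq> ?T ?C"
      proof
        fix v assume "v \<in> residual [b] (?T C)"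
        then obtain t where t: "eval M t \<in> C" "b # v \<in> nodes t" by (auto simp: Nodes_def residual_def)
        then obtain a l r where n: "t = Node a l r" by (cases t) auto
        have "v \<in> nodes (if b then r else l)" using t n by auto
        moreover have "eval M (if b then r else l) \<in> ?C" using t n by auto
        ultimately show "v \<in> ?T ?C" unfolding Nodes_def by blast
      qed
      show "?T ?C \<subseteq> residual [b] (?T C)"
      proof
        fix v assume "v \<in> ?T ?C"
        then obtain s a l r where s: "v \<in> nodes s" "eval M s = eval M (if b then r else l)"
          "t_delta M a (eval M l) (eval M r) \<in> C" by (auto simp: Nodes_def)
        let ?t = "if b then Node a l s else Node a s r"
        have t: "eval M ?t \<in> C" "b # v \<in> nodes ?t" using s by (cases b; simp)+
        show "v \<in> residual [b] (?T C)"
          unfolding Nodes_def residual_def using t by (simp only: mem_Collect_eq append_Cons append_Nil UN_iff) (rule bexI[of _ ?t], simp_all)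
      qed
    qed
    then show ?thesis by blast
  qed
  have "\<exists>C'. residual u (?T C) = ?T C'" for u C
  proof (induction u arbitrary: C)
    case (Cons b u)
    have "residual (b # u) (?T C) = residual u (residual [b] (?T C))" using residual_append[of "[b]" u] by simp
    then show ?case using step[of b C] Cons.IH by metis
  qed auto
  then have "range (\<lambda>u. residual u (?T C)) \<subseteq> range ?T" by blast
  then show ?thesis by (rule finite_subset) simp
qed

section \<open>Application to the presented ordering\<close>

lemma tree_of_lang_eq: "tree_of_lang (lang M) = Nodes {t. eval M t \<in> t_final M}"
proof -
  have "lang M = stree_of ` {t. eval M t \<in> t_final M}" using lang_iff by blast
  then show ?thesis by (simp add: tree_of_lang_def Nodes_def dom_stree_of)
qed

theorem theorem5p4:
  fixes M :: "('s::finite, 'q::finite) tree_aut"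
    and Mle :: "('s option \<times> 's option, 'p::finite) tree_aut"
    and \<mu> :: "'a::linorder \<Rightarrow> 's stree"
    and k :: nat
  assumes "tree_aut_pres M Mle \<mu>"
    and "Tbin_free (tree_of_lang (lang M))"
    and "CB_star (tree_of_lang (lang M)) = k"
    and "k \<ge> 1"
  shows "FC_less_omega_pow TYPE('a) k"
proof -
  define W where "W = {t. eval M t \<in> t_final M}"
  let ?le = "state_le Mle (t_final Mle)"
  note pres = assms(1)[unfolded tree_aut_pres_def]
  have "\<exists>n. finite ((tree_deriv ^^ n) (Nodes W))"
    using Tbin_free_deriv_finite[OF prefix_closed_Nodes finite_residuals] assms(2) unfolding tree_of_lang_eq W_def .
  \<comment> \<open>\<open>CB_star\<close> is a \<open>LEAST\<close>, so k is a stage with a finite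
    derivative only because some such stage exists.\<close>
  then have fin: "finite ((tree_deriv ^^ k) (Nodes W))"
    using assms(3) unfolding CB_star_def tree_of_lang_eq W_def[symmetric] by (metis (mono_tags, lifting) LeastI_ex)
  obtain k' where k': "k = Suc k'" using assms(4) by (cases k) auto
  have langM: "lang M = stree_of ` W" using lang_iff unfolding W_def by blast
  have \<mu>: "\<exists>t\<in>W. \<mu> x = stree_of t" for x
    using conjunct1[OF pres] unfolding langM bij_betw_def by blast
  \<comment> \<open>\<nu> is \<mu> transported to the datatype; it is an isomorphism from the
    ordering onto W with the root context \<open>t_final Mle\<close>.\<close>
  define \<nu> where "\<nu> x = (SOME t. t \<in> W \<and> \<mu> x = stree_of t)" for x
  have \<nu>: "\<nu> x \<in> W \<and> \<mu> x = stree_of (\<nu> x)" for x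
    unfolding \<nu>_def using \<mu>[of x] by (rule_tac someI_ex[of "\<lambda>t. t \<in> W \<and> \<mu> x = stree_of t"]) blast
  have inj: "x = y" if "\<nu> x = \<nu> y" for x y
    using conjunct1[OF pres] \<nu>[of x] \<nu>[of y] that by (metis bij_betw_def injD)
  have surj: "\<exists>x. \<nu> x = t" if t: "t \<in> W" for t
  proof -
    have "stree_of t \<in> range \<mu>" using conjunct1[OF pres] t unfolding langM bij_betw_def by blast
    then show ?thesis using \<nu> stree_of_inject by (metis rangeE)
  qed
  have le: "?le (\<nu> x) (\<nu> y) \<longleftrightarrow> x \<le> y" for x y
  proof -
    have "?le (\<nu> x) (\<nu> y) \<longleftrightarrow> stree_of (bconv (\<nu> x) (\<nu> y)) \<in> lang Mle"
      unfolding lang_iff state_le_def pair_state_def using stree_of_inject by blast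
    also have "\<dots> \<longleftrightarrow> conv (\<mu> x) (\<mu> y) \<in> {conv (\<mu> a) (\<mu> b) | a b. a \<le> b}"
      using conjunct2[OF pres] \<nu> conv_stree_of by metis
    also have "\<dots> \<longleftrightarrow> x \<le> y"
    proof
      assume "conv (\<mu> x) (\<mu> y) \<in> {conv (\<mu> a) (\<mu> b) | a b. a \<le> b}"
      then obtain a b where ab: "conv (\<mu> x) (\<mu> y) = conv (\<mu> a) (\<mu> b)" "a \<le> b" by blast
      have "inj \<mu>" using conjunct1[OF pres] by (simp add: bij_betw_def)
      then have "x = a" "y = b" using conv_inject[OF ab(1)] by (simp_all add: inj_eq)
      then show "x \<le> y" using ab by simp
    qed blast
    finally show ?thesis .
  qed
  have W: "W = range \<nu>" using \<nu> surj by blast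
  have lin: "lin ?le W"
    unfolding W lin_def using inj by (auto simp: le)
  have closed: "type_closed M Mle W" by (auto simp: type_closed_def W_def profile_def)
  obtain n where n: "\<forall>x y c. rank_lt k' c ?le {z\<in>W. ?le x z \<and> ?le z y} \<longrightarrow> rank_lt k' n ?le {z\<in>W. ?le x z \<and> ?le z y}"
    using interval_bound[OF small_types closed fin[unfolded k'] lin] by (elim exE)
  show ?thesis
  proof (rule FC_less_omega_powI)
    show "length (Suc n # replicate k' 0) = k" by (simp add: k')
    fix x y :: 'a and \<beta> assume xy: "x \<le> y" "length \<beta> = k" "vd (\<le>) \<beta> {x..y}"
    have img: "\<nu> ` {x..y} = {z\<in>W. ?le (\<nu> x) z \<and> ?le z (\<nu> y)}" using surj \<nu> by (auto simp: le W)
    \<comment> \<open>Any rank of length k' + 1 is bounded through its own leading coefficient,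
      which depends on the interval. The gap replaces it by the uniform n.\<close>
    have "rank_lt k' (hd \<beta>) (\<le>) {x..y}" using xy(2,3) k' by (auto simp: rank_lt_def)
    then have "rank_lt k' (hd \<beta>) ?le (\<nu> ` {x..y})" by (rule rank_lt_image) (rule le)
    then have "rank_lt k' n ?le (\<nu> ` {x..y})" using n unfolding img by blast
    then have "rank_lt k' n (\<le>) (inv \<nu> ` \<nu> ` {x..y})"
    proof (rule rank_lt_image)
      have "inv \<nu> (\<nu> z) = z" for z using inj by (intro inv_f_f injI)
      then show "(inv \<nu> s \<le> inv \<nu> t) = ?le s t" if "s \<in> \<nu> ` {x..y}" "t \<in> \<nu> ` {x..y}" for s t
        using that by (auto simp: le)
    qed
    moreover have "inv \<nu> ` \<nu> ` {x..y} = {x..y}" using inj by (simp add: image_inv_f_f injI)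
    ultimately show "\<exists>\<gamma>. \<gamma> \<sqsubset> Suc n # replicate k' 0 \<and> vd (\<le>) \<gamma> {x..y}" using rank_lt_olt by simp
  qed
qed

end
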